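(* Let $n$ be a positive integer, let $\mathsf D$ be the vector field on $\mathsf T=\mathsf T_n$ given either by Option 1 or by Option 2, let $\widetilde{\mathcal M}$ and $\mathcal M$ be the associated graded algebras of Calabi-Yau quasi-modular and modular forms for the Dwork family, $\mathcal D$ the derivation of $\widetilde{\mathcal M}$ induced by $\mathsf D$, and $\mathcal M^{>0}$ the algebra of Calabi-Yau modular forms of positive weight together with the constants (all as defined in the context). Then the Rankin-Cohen brackets $[\cdot,\cdot]_{\mathcal D,k}$, $k\ge0$, endow $\mathcal M^{>0}$ with a canonical Rankin-Cohen algebra structure; that is, they restrict to bilinear maps $[\cdot,\cdot]_{\mathcal D,k}:\mathcal M^{>0}_r\otimes\mathcal M^{>0}_s\to\mathcal M^{>0}_{r+s+2k}$ for all $r,s,k\ge0$, and there exist a derivation $\partial$ of degree $2$ on $\mathcal M^{>0}$ and an element $\Lambda\in\mathcal M^{>0}_4$ such that $[f,g]_{\mathcal D,k}=[f,g]_{\partial,\Lambda,k}$ for all $k\ge0$ and all homogeneous $f,g\in\mathcal M^{>0}$.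
   Context: **Rankin-Cohen brackets.** Binomial coefficients are $\binom ai=\frac{a(a-1)\cdots(a-i+1)}{i!}$. For $f\in\widetilde{\mathcal M}_r$, $g\in\widetilde{\mathcal M}_s$, $r,s,k\ge0$: $[f,g]_{\mathcal D,k}:=\sum_{i+j=k}(-1)^j\binom{k+r-1}{i}\binom{k+s-1}{j}\mathcal D^jf\cdot\mathcal D^ig$. Let $M=\bigoplus_{r\ge0}M_r$ be a commutative associative graded algebra over a field $\mathsf k$ of characteristic $0$ with $M_0=\mathsf k\cdot1$, $\partial$ a derivation of degree $2$ on $M$ (i.e. $\partial(M_r)\subseteq M_{r+2}$) and $\Lambda\in M_4$. For $f\in M_r$, $g\in M_s$ put $[f,g]_{\partial,\Lambda,k}:=\sum_{i+j=k}(-1)^j\binom{k+r-1}{i}\binom{k+s-1}{j}f_{(j)}g_{(i)}$, where $f_{(0)}=f$, $f_{(j+1)}=\partial f_{(j)}+j(j+r-1)\Lambda f_{(j-1)}$ and $g_{(0)}=g$, $g_{(i+1)}=\partial g_{(i)}+i(i+s-1)\Lambda g_{(i-1)}$. Brackets $[\cdot,\cdot]_k:M_r\otimes M_s\to M_{r+s+2k}$ on $M$ are said to give a canonical Rankin-Cohen algebra structure if $[\cdot,\cdot]_k=[\cdot,\cdot]_{\partial,\Lambda,k}$ for all $k$, for some derivation $\partial$ of degree $2$ on $M$ and some $\Lambda\in M_4$. **The moduli space $\mathsf T$.** Fix $n\ge 1$. Put $m=\frac{n+1}2$ if $n$ is odd, $m=\frac n2$ if $n$ is even; $d=\frac{(n+1)(n+3)}4+1$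 if $n$ is odd, $d=\frac{n(n+2)}4+1$ if $n$ is even. $\mathsf T=\mathsf T_n$ is the moduli space of pairs $(X,[\alpha_1,\dots,\alpha_{n+1}])$, where $X$ is a mirror $n$-fold of the Dwork family (desingularized quotient of $t_{n+2}x_0^{n+2}+x_1^{n+2}+\dots+x_{n+1}^{n+2}-(n+2)t_1x_0\cdots x_{n+1}=0$ by the group of $(\zeta_0,\dots,\zeta_{n+1})$ with $\zeta_i^{n+2}=1$, $\prod\zeta_i=1$) and $\alpha_1,\dots,\alpha_{n+1}$ is a basis of $H^n_{\rm dR}(X)$ with $\alpha_i\in F^{n+1-i}\setminus F^{n+2-i}$ (Hodge filtration) and intersection matrix $(\langle\alpha_i,\alpha_j\rangle)=\Phi$, where $\Phi=\begin{pmatrix}0&J_m\\-J_m&0\end{pmatrix}$ for $n$ odd, $\Phi=J_{n+1}$ for $n$ even, $J_k$ being the $k\times k$ matrix with $1$'s on the antidiagonal and $0$ elsewhere. It has the following explicit description. Let $B$ be the $(n+1)\times(n+1)$ matrix of $1$-forms in $t_1,t_{n+2}$ (Gauss-Manin matrix in a basis $\omega=(\omega_1,\dots,\omega_{n+1})^{\rm tr}$) with entries: $B[i,i]=-\frac{i}{(n+2)t_{n+2}}dt_{n+2}$ and $B[i,i+1]=dt_1-\frac{t_1}{(n+2)t_{n+2}}dt_{n+2}$ for $1\le i\le n$; $B[n+1,j]=\frac{-S_2(n+2,j)t_1^j}{t_1^{n+2}-t_{n+2}}dt_1+\frac{S_2(n+2,j)t_1^{j+1}}{(n+2)t_{n+2}(t_1^{n+2}-t_{n+2})}dt_{n+2}$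 for $1\le j\le n$; $B[n+1,n+1]=\frac{-S_2(n+2,n+1)t_1^{n+1}}{t_1^{n+2}-t_{n+2}}dt_1+\frac{\frac{n(n+1)}2t_1^{n+2}+(n+1)t_{n+2}}{(n+2)t_{n+2}(t_1^{n+2}-t_{n+2})}dt_{n+2}$; all other entries $0$. Here $S_2$ denotes Stirling numbers of the second kind. Let $\Omega=(\langle\omega_i,\omega_j\rangle)$ be the $(-1)^n$-symmetric matrix determined by $\Omega_{ij}=0$ for $i+j\le n+1$, $\Omega_{1,n+1}=(-(n+2))^n\frac{c_n}{t_1^{n+2}-t_{n+2}}$ ($c_n$ a fixed nonzero constant), $\Omega_{j,n+2-j}=(-1)^{j-1}\Omega_{1,n+1}$, and $d\Omega=B\Omega+\Omega B^{\rm tr}$. Points of $\mathsf T$ are given by $(t_1,t_{n+2})$ with $t_{n+2}(t_1^{n+2}-t_{n+2})\ne0$ and an invertible lower triangular matrix $S=(s_{ij})$ with $s_{11}=1$ and $S\Omega S^{\rm tr}=\Phi$; then $\alpha=S\omega$. Independent coordinates: the entries $s_{ij}$, $i\ge j$, $(i,j)\neq(1,1)$, with $i+j\le n+2$ ($n$ odd) or $i+j<n+2$ ($n$ even), read from left to right and top to bottom, are named $t_2,t_3,\dots$ in order, skipping the index $n+2$ (already used). So $t_2=s_{21}$. Let $I=\{1,\dots,d\}$ if $n\ne2$, $I=\{1,2,4\}$ if $n=2$; $(t_j)_{j\in I}$ is the chart. For $n$ even let in addition $u=s_{\frac{n+2}2\frac{n+2}2}$, so $u^2=\frac{(-1)^{n/2}}{c_n(n+2)^n}(t_1^{n+2}-t_{n+2})$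 ($u$ is called $t_{d+1}$, and $t_3$ when $n=2$). All other entries of $S$ are regular functions of these, and $\mathcal O_{\mathsf T}=\mathbb C\big[t_j\,(j\in I),\,u,\,\frac1{t_{n+2}(t_{n+2}-t_1^{n+2})\check t}\big]$ ($u$ present only for $n$ even, subject to its quadratic relation), where $\check t$ is the product of the $m-1$ coordinates $t_j$ lying on the main diagonal of $S$. Vector fields on $\mathsf T$ are $\mathbb C$-derivations of $\mathcal O_{\mathsf T}$, written $\sum_{j\in I}E^j\frac{\partial}{\partial t_j}$ ($\frac{\partial}{\partial t_j}$ extends uniquely to $u$). **Vector fields.** For a vector field $E$ its Gauss-Manin matrix $A_E$ (i.e. $\nabla_E\alpha=A_E\alpha$) is determined by $E(S)=A_ES-S\,B(E)$, with $E(S)$ taken entrywise; $E$ is determined by $A_E$. - The modular vector field $\mathsf R$ is the unique vector field for which there are regular functions $\mathsf Y_1,\dots,\mathsf Y_{n-2}$ such that $A_{\mathsf R}=\mathsf Y$, where $\mathsf Y$ has superdiagonal $(1,\mathsf Y_1,\dots,\mathsf Y_{n-2},-1)$ (for $n=2$: $(1,-1)$; for $n=1$: $(1)$) and zeros elsewhere, and $\mathsf Y\Phi+\Phi\mathsf Y^{\rm tr}=0$. - For $\mathfrak g$ upper triangular with $\mathfrak g^{\rm tr}\Phi+\Phi\mathfrak g=0$, $\mathsf R_{\mathfrak g}$ is the unique vector field with $A_{\mathsf R_{\mathfrak g}}=\mathfrak g^{\rm tr}$. With $E_{ij}$ the matrix units put $\mathfrak g_{11}=E_{11}-E_{n+1,n+1}$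 and, for $n\ge3$, $\mathfrak g_{22}=E_{22}-E_{nn}$. - $\mathsf H:=-\mathsf R_{\mathfrak g_{11}}$ if $n=1$, $\mathsf H:=-2\mathsf R_{\mathfrak g_{11}}$ if $n=2$, $\mathsf H:=\mathsf R_{\mathfrak g_{22}}-\mathsf R_{\mathfrak g_{11}}$ if $n\ge3$. One has $\mathsf H=\sum_{j\in I}w_jt_j\frac{\partial}{\partial t_j}$ with non-negative integers $w_j$: for $n=1$, $(w_1,w_2,w_3)=(1,2,3)$; for $n=2$, $(w_1,w_2,w_4)=(2,2,8)$; for $n\ge3$, $w_1=1$, $w_{n+2}=n+2$, and if $t_j=s_{ik}$ then $w_j=k+1$ for $i\in\{2,n+1\}$, $w_j=k$ for $3\le i\le n-1$, $w_j=k-1$ for $i=n$. **Weights.** $\deg t_j=w_j$, and for $n$ even $\deg u=\frac{n+2}2$ if $n\ge4$, $\deg u=4$ if $n=2$. This makes $\mathcal O_{\mathsf T}$ $\mathbb Z$-graded. **The vector field $\mathsf D$.** Let $\delta_2^n$ be the Kronecker delta. Option 1: $\mathsf D:=\mathsf R$, but for odd $n\ge3$ the coordinate $t_d$ of the chart is replaced by $\tilde t_d:=t_7+t_2t_4$ if $n=3$ (here $d=7$), $\tilde t_d:=t_d+t_2t_{d-2}$ if $n\ge5$; $\tilde t_d$ has weight $w_d=2$ and is again denoted $t_d$, and all partial derivatives $\frac{\partial}{\partial t_j}$ are with respect to the new chart. Option 2: the original chart is kept and $\mathsf D:=\mathsf R+t_2\big([\mathsf R,(1+\delta_2^n)\frac{\partial}{\partial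 t_2}]-\mathsf H\big)$. **Calabi-Yau (quasi-)modular forms.** Let $\mathsf t_j$ ($j\in I$; and $\mathsf u$ for $n$ even) be the components of a solution of $\mathsf D$, $\mathsf t_j$ corresponding to the coordinate $t_j$ of the chart used in the chosen option, with $\deg\mathsf t_j=w_j$ (and $\deg \mathsf u=\deg u$). $\widetilde{\mathcal M}$ is the $\mathbb C$-algebra $\mathbb C\big[\mathsf t_j\,(j\in I),\,\mathsf u,\,\frac1{\mathsf t_{n+2}(\mathsf t_{n+2}-\mathsf t_1^{n+2})\check{\mathsf t}}\big]$ and $\mathcal M$ is its subalgebra generated by the same elements with $\mathsf t_2$ omitted, so $\widetilde{\mathcal M}=\mathcal M[\mathsf t_2]$; $\check{\mathsf t}$ corresponds to $\check t$. The $\mathsf t_j$ are treated as independent variables, i.e. $\widetilde{\mathcal M}$ is identified with $\mathcal O_{\mathsf T}$ as a graded algebra via $\mathsf t_j\leftrightarrow t_j$, $\mathsf u\leftrightarrow u$. $\widetilde{\mathcal M}_r$, $\mathcal M_r$ ($r\in\mathbb Z$) denote the weight $r$ parts. $\mathcal D$ is the derivation of $\widetilde{\mathcal M}$ obtained from $\mathsf D$ by replacing $t_j$ by $\mathsf t_j$ and $\frac{\partial}{\partial t_j}$ by $\frac{\partial}{\partial\mathsf t_j}$. Finally $\mathcal M^{>0}:=\mathbb C\oplus\bigoplus_{r>0}\mathcal M_r$, graded with $\mathcal M^{>0}_0=\mathbb C$ (only constants are kept in weight $0$) and $\mathcal M^{>0}_r=\mathcal M_r$ for $r>0$. *)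

theory Defs
  imports
    Complex_Main
    "HOL-Library.Function_Algebras"
    "HOL-Combinatorics.Stirling"
    "Jordan_Normal_Form.Matrix"
begin

section \<open>Rankin-Cohen brackets on algebras of complex-valued functions\<close>

text \<open>
  All algebras below are algebras of complex-valued functions on a fixed set of points \<open>X\<close>,
  with pointwise operations. Such a function is represented by a total function vanishing outside
  \<open>X\<close>, so that two functions agreeing on \<open>X\<close> are equal; the unit is the indicator of \<open>X\<close>.
\<close>

definition const_on :: "'p set \<Rightarrow> complex \<Rightarrow> 'p \<Rightarrow> complex" where
  "const_on X c = (\<lambda>x. if x \<in> X then c else 0)"

inductive_set generated_algebra :: "'p set \<Rightarrow> ('p \<Rightarrow> complex) set \<Rightarrow> ('p \<Rightarrow> complex) set"
  for X :: "'p set" and G :: "('p \<Rightarrow> complex) set" where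
  const: "const_on X c \<in> generated_algebra X G"
| gen: "g \<in> G \<Longrightarrow> g \<in> generated_algebra X G"
| add: "f \<in> generated_algebra X G \<Longrightarrow> g \<in> generated_algebra X G \<Longrightarrow> f + g \<in> generated_algebra X G"
| mult: "f \<in> generated_algebra X G \<Longrightarrow> g \<in> generated_algebra X G \<Longrightarrow> f * g \<in> generated_algebra X G"

text \<open>The weight \<open>r\<close> part of the algebra generated by the elements \<open>g\<close> of degree \<open>w\<close>,
  for \<open>(g, w) \<in> W\<close>.\<close>

inductive homogeneous ::
  "'p set \<Rightarrow> (('p \<Rightarrow> complex) \<times> int) set \<Rightarrow> int \<Rightarrow> ('p \<Rightarrow> complex) \<Rightarrow> bool"
  for X :: "'p set" and W :: "(('p \<Rightarrow> complex) \<times> int) set" where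
  zero: "homogeneous X W r 0"
| const: "homogeneous X W 0 (const_on X c)"
| gen: "(g, w) \<in> W \<Longrightarrow> homogeneous X W w g"
| add: "homogeneous X W r f \<Longrightarrow> homogeneous X W r g \<Longrightarrow> homogeneous X W r (f + g)"
| mult: "homogeneous X W r f \<Longrightarrow> homogeneous X W s g \<Longrightarrow> homogeneous X W (r + s) (f * g)"

definition derivation_on ::
  "('p \<Rightarrow> complex) set \<Rightarrow> (('p \<Rightarrow> complex) \<Rightarrow> ('p \<Rightarrow> complex)) \<Rightarrow> bool" where
  "derivation_on A E \<longleftrightarrow>
     (\<forall>f\<in>A. E f \<in> A) \<and>
     (\<forall>f\<in>A. \<forall>g\<in>A. E (f + g) = E f + E g) \<and>
     (\<forall>c. \<forall>f\<in>A. E (\<lambda>x. c * f x) = (\<lambda>x. c * E f x)) \<and>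
     (\<forall>f\<in>A. \<forall>g\<in>A. E (f * g) = E f * g + f * E g)"

definition bilinear_on ::
  "('p \<Rightarrow> complex) set \<Rightarrow> ('p \<Rightarrow> complex) set \<Rightarrow> ('p \<Rightarrow> complex) set \<Rightarrow>
   (('p \<Rightarrow> complex) \<Rightarrow> ('p \<Rightarrow> complex) \<Rightarrow> ('p \<Rightarrow> complex)) \<Rightarrow> bool" where
  "bilinear_on A B C br \<longleftrightarrow>
     (\<forall>f\<in>A. \<forall>g\<in>B. br f g \<in> C) \<and>
     (\<forall>f\<in>A. \<forall>f'\<in>A. \<forall>g\<in>B. br (f + f') g = br f g + br f' g) \<and>
     (\<forall>f\<in>A. \<forall>g\<in>B. \<forall>g'\<in>B. br f (g + g') = br f g + br f g') \<and>
     (\<forall>c. \<forall>f\<in>A. \<forall>g\<in>B. br (\<lambda>x. c * f x) g = (\<lambda>x. c * br f g x)) \<and>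
     (\<forall>c. \<forall>f\<in>A. \<forall>g\<in>B. br f (\<lambda>x. c * g x) = (\<lambda>x. c * br f g x))"

definition graded_sum :: "(nat \<Rightarrow> ('p \<Rightarrow> complex) set) \<Rightarrow> ('p \<Rightarrow> complex) set" where
  "graded_sum M = {f. \<exists>N h. (\<forall>r. h r \<in> M r) \<and> f = (\<lambda>x. \<Sum>r\<le>N. h r x)}"

text \<open>Here \<open>r\<close> and \<open>s\<close> are the weights of \<open>f\<close> and \<open>g\<close>, and \<open>j = k - i\<close>.\<close>

definition rc_bracket ::
  "(('p \<Rightarrow> complex) \<Rightarrow> ('p \<Rightarrow> complex)) \<Rightarrow> nat \<Rightarrow> nat \<Rightarrow> nat \<Rightarrow>
   ('p \<Rightarrow> complex) \<Rightarrow> ('p \<Rightarrow> complex) \<Rightarrow> ('p \<Rightarrow> complex)" where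
  "rc_bracket D k r s f g = (\<lambda>x. \<Sum>i\<le>k. (- 1) ^ (k - i)
      * ((of_nat k + of_nat r - 1) gchoose i) * ((of_nat k + of_nat s - 1) gchoose (k - i))
      * (D ^^ (k - i)) f x * (D ^^ i) g x)"

fun canonical_iterate ::
  "(('p \<Rightarrow> complex) \<Rightarrow> ('p \<Rightarrow> complex)) \<Rightarrow> ('p \<Rightarrow> complex) \<Rightarrow> nat \<Rightarrow> ('p \<Rightarrow> complex) \<Rightarrow>
   nat \<Rightarrow> ('p \<Rightarrow> complex)" where
  "canonical_iterate d L r f 0 = f"
| "canonical_iterate d L r f (Suc j) =
     (\<lambda>x. d (canonical_iterate d L r f j) x
        + of_nat j * (of_nat j + of_nat r - 1) * L x * canonical_iterate d L r f (j - 1) x)"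

definition canonical_bracket ::
  "(('p \<Rightarrow> complex) \<Rightarrow> ('p \<Rightarrow> complex)) \<Rightarrow> ('p \<Rightarrow> complex) \<Rightarrow> nat \<Rightarrow> nat \<Rightarrow> nat \<Rightarrow>
   ('p \<Rightarrow> complex) \<Rightarrow> ('p \<Rightarrow> complex) \<Rightarrow> ('p \<Rightarrow> complex)" where
  "canonical_bracket d L k r s f g = (\<lambda>x. \<Sum>i\<le>k. (- 1) ^ (k - i)
      * ((of_nat k + of_nat r - 1) gchoose i) * ((of_nat k + of_nat s - 1) gchoose (k - i))
      * canonical_iterate d L r f (k - i) x * canonical_iterate d L s g i x)"

definition canonical_rankin_cohen ::
  "(nat \<Rightarrow> ('p \<Rightarrow> complex) set) \<Rightarrow>
   (nat \<Rightarrow> nat \<Rightarrow> nat \<Rightarrow> ('p \<Rightarrow> complex) \<Rightarrow> ('p \<Rightarrow> complex) \<Rightarrow> ('p \<Rightarrow> complex)) \<Rightarrow> bool" where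
  "canonical_rankin_cohen M br \<longleftrightarrow>
     (\<forall>k r s. bilinear_on (M r) (M s) (M (r + s + 2 * k)) (br k r s)) \<and>
     (\<exists>d L. derivation_on (graded_sum M) d \<and> (\<forall>r. \<forall>f\<in>M r. d f \<in> M (r + 2)) \<and> L \<in> M 4 \<and>
        (\<forall>k r s. \<forall>f\<in>M r. \<forall>g\<in>M s. br k r s f g = canonical_bracket d L k r s f g))"


section \<open>The moduli space\<close>

text \<open>Matrices are indexed from 1 in all formulas, whereas the underlying type indexes from 0.\<close>

definition mat1 :: "nat \<Rightarrow> (nat \<Rightarrow> nat \<Rightarrow> 'a) \<Rightarrow> 'a mat" where
  "mat1 k f = mat k k (\<lambda>(i, j). f (i + 1) (j + 1))"

definition ent :: "'a mat \<Rightarrow> nat \<Rightarrow> nat \<Rightarrow> 'a" where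
  "ent A i j = A $$ (i - 1, j - 1)"

definition half_dim :: "nat \<Rightarrow> nat" where
  "half_dim n = (if odd n then (n + 1) div 2 else n div 2)"

definition moduli_dim :: "nat \<Rightarrow> nat" where
  "moduli_dim n = (if odd n then (n + 1) * (n + 3) div 4 + 1 else n * (n + 2) div 4 + 1)"

definition antidiag :: "nat \<Rightarrow> complex mat" where
  "antidiag k = mat1 k (\<lambda>i j. if i + j = k + 1 then 1 else 0)"

definition Phi :: "nat \<Rightarrow> complex mat" where
  "Phi n = (if odd n
     then four_block_mat (0\<^sub>m (half_dim n) (half_dim n)) (antidiag (half_dim n))
            (- antidiag (half_dim n)) (0\<^sub>m (half_dim n) (half_dim n))
     else antidiag (n + 1))"

text \<open>The Gauss-Manin matrix \<open>B\<close> of 1-forms at the point \<open>(t\<^sub>1, t\<^sub>n\<^sub>+\<^sub>2) = (a, b)\<close>,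
  evaluated on a tangent vector with \<open>dt\<^sub>1 = v\<close> and \<open>dt\<^sub>n\<^sub>+\<^sub>2 = w\<close>.\<close>

definition gm_form :: "nat \<Rightarrow> complex \<Rightarrow> complex \<Rightarrow> complex \<Rightarrow> complex \<Rightarrow> complex mat" where
  "gm_form n a b v w = mat1 (n + 1) (\<lambda>i j.
     let N = of_nat (n + 2) :: complex; S2 = (\<lambda>k. of_nat (Stirling (n + 2) k) :: complex);
         dlt = a ^ (n + 2) - b
     in if i \<le> n then
          (if j = i then - of_nat i / (N * b) * w
           else if j = i + 1 then v - a / (N * b) * w
           else 0)
        else if j \<le> n then
          - S2 j * a ^ j / dlt * v + S2 j * a ^ (j + 1) / (N * b * dlt) * w
        else
          - S2 (n + 1) * a ^ (n + 1) / dlt * v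
          + (of_nat n * (of_nat n + 1) / 2 * a ^ (n + 2) + (of_nat n + 1) * b) / (N * b * dlt) * w)"

text \<open>The conditions determining the intersection matrix \<open>\<Omega>\<close>, a matrix of functions of
  \<open>(t\<^sub>1, t\<^sub>n\<^sub>+\<^sub>2) = (a, b)\<close>. The last two conjuncts are the components of
  \<open>d\<Omega> = B \<Omega> + \<Omega> B\<^sup>t\<^sup>r\<close> along \<open>dt\<^sub>1\<close> and \<open>dt\<^sub>n\<^sub>+\<^sub>2\<close>.\<close>

definition intersection_matrix ::
  "nat \<Rightarrow> complex \<Rightarrow> (complex \<Rightarrow> complex \<Rightarrow> complex mat) \<Rightarrow> bool" where
  "intersection_matrix n c \<Omega> \<longleftrightarrow>
     (\<forall>a b. b * (a ^ (n + 2) - b) \<noteq> 0 \<longrightarrow>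
        \<Omega> a b \<in> carrier_mat (n + 1) (n + 1) \<and>
        transpose_mat (\<Omega> a b) = (- 1) ^ n \<cdot>\<^sub>m \<Omega> a b \<and>
        (\<forall>i\<in>{1..n+1}. \<forall>j\<in>{1..n+1}. i + j \<le> n + 1 \<longrightarrow> ent (\<Omega> a b) i j = 0) \<and>
        ent (\<Omega> a b) 1 (n + 1) = (- of_nat (n + 2)) ^ n * c / (a ^ (n + 2) - b) \<and>
        (\<forall>j\<in>{1..n+1}. ent (\<Omega> a b) j (n + 2 - j) = (- 1) ^ (j - 1) * ent (\<Omega> a b) 1 (n + 1)) \<and>
        (\<forall>i\<in>{1..n+1}. \<forall>j\<in>{1..n+1}.
           ((\<lambda>z. ent (\<Omega> z b) i j) has_field_derivative
              ent (gm_form n a b 1 0 * \<Omega> a b + \<Omega> a b * transpose_mat (gm_form n a b 1 0)) i j) (at a)) \<and>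
        (\<forall>i\<in>{1..n+1}. \<forall>j\<in>{1..n+1}.
           ((\<lambda>z. ent (\<Omega> a z) i j) has_field_derivative
              ent (gm_form n a b 0 1 * \<Omega> a b + \<Omega> a b * transpose_mat (gm_form n a b 0 1)) i j) (at b)))"

text \<open>A point is a triple \<open>(t\<^sub>1, t\<^sub>n\<^sub>+\<^sub>2, S)\<close>.\<close>

type_synonym point = "complex \<times> complex \<times> complex mat"

definition moduli :: "nat \<Rightarrow> (complex \<Rightarrow> complex \<Rightarrow> complex mat) \<Rightarrow> point set" where
  "moduli n \<Omega> = {(a, b, S). b * (a ^ (n + 2) - b) \<noteq> 0 \<and>
      S \<in> carrier_mat (n + 1) (n + 1) \<and> invertible_mat S \<and>
      (\<forall>i\<in>{1..n+1}. \<forall>j\<in>{1..n+1}. i < j \<longrightarrow> ent S i j = 0) \<and> ent S 1 1 = 1 \<and>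
      S * \<Omega> a b * transpose_mat S = Phi n}"

definition reg :: "nat \<Rightarrow> (complex \<Rightarrow> complex \<Rightarrow> complex mat) \<Rightarrow> (point \<Rightarrow> complex) \<Rightarrow> point \<Rightarrow> complex"
  where "reg n \<Omega> f = (\<lambda>x. if x \<in> moduli n \<Omega> then f x else 0)"

definition s_entry ::
  "nat \<Rightarrow> (complex \<Rightarrow> complex \<Rightarrow> complex mat) \<Rightarrow> nat \<Rightarrow> nat \<Rightarrow> point \<Rightarrow> complex" where
  "s_entry n \<Omega> i j = reg n \<Omega> (\<lambda>(a, b, S). ent S i j)"

definition chart_positions :: "nat \<Rightarrow> (nat \<times> nat) list" where
  "chart_positions n = [(i, j). i \<leftarrow> [2..<n+2], j \<leftarrow> [1..<i+1],
     if odd n then i + j \<le> n + 2 else i + j < n + 2]"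

text \<open>The position \<open>(i, k)\<close> with \<open>t\<^sub>j = s\<^sub>i\<^sub>k\<close>, for \<open>j\<close> other than \<open>1\<close> and \<open>n + 2\<close>. The numbering of
  the entries starts at \<open>j = 2\<close> and skips \<open>j = n + 2\<close>.\<close>

definition chart_pos :: "nat \<Rightarrow> nat \<Rightarrow> nat \<times> nat" where
  "chart_pos n j = chart_positions n ! (if j < n + 2 then j - 2 else j - 3)"

definition chart_indices :: "nat \<Rightarrow> nat set" where
  "chart_indices n = (if n = 2 then {1, 2, 4} else {1..moduli_dim n})"

definition coord ::
  "nat \<Rightarrow> (complex \<Rightarrow> complex \<Rightarrow> complex mat) \<Rightarrow> nat \<Rightarrow> point \<Rightarrow> complex" where
  "coord n \<Omega> j =
     (if j = 1 then reg n \<Omega> (\<lambda>(a, b, S). a)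
      else if j = n + 2 then reg n \<Omega> (\<lambda>(a, b, S). b)
      else s_entry n \<Omega> (fst (chart_pos n j)) (snd (chart_pos n j)))"

definition coord_u :: "nat \<Rightarrow> (complex \<Rightarrow> complex \<Rightarrow> complex mat) \<Rightarrow> point \<Rightarrow> complex" where
  "coord_u n \<Omega> = s_entry n \<Omega> ((n + 2) div 2) ((n + 2) div 2)"

definition diag_indices :: "nat \<Rightarrow> nat set" where
  "diag_indices n =
     {j \<in> chart_indices n - {1, n + 2}. fst (chart_pos n j) = snd (chart_pos n j)}"

definition inv_disc :: "nat \<Rightarrow> (complex \<Rightarrow> complex \<Rightarrow> complex mat) \<Rightarrow> point \<Rightarrow> complex" where
  "inv_disc n \<Omega> = reg n \<Omega> (\<lambda>x. 1 / (coord n \<Omega> (n + 2) x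
      * (coord n \<Omega> (n + 2) x - coord n \<Omega> 1 x ^ (n + 2)) * (\<Prod>j\<in>diag_indices n. coord n \<Omega> j x)))"

definition regular_functions ::
  "nat \<Rightarrow> (complex \<Rightarrow> complex \<Rightarrow> complex mat) \<Rightarrow> (point \<Rightarrow> complex) set" where
  "regular_functions n \<Omega> = generated_algebra (moduli n \<Omega>)
     (coord n \<Omega> ` chart_indices n \<union> (if even n then {coord_u n \<Omega>} else {}) \<union> {inv_disc n \<Omega>})"


section \<open>Vector fields\<close>

type_synonym vfield = "(point \<Rightarrow> complex) \<Rightarrow> (point \<Rightarrow> complex)"

definition vector_field :: "nat \<Rightarrow> (complex \<Rightarrow> complex \<Rightarrow> complex mat) \<Rightarrow> vfield \<Rightarrow> bool" where
  "vector_field n \<Omega> E \<longleftrightarrow> derivation_on (regular_functions n \<Omega>) E"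

text \<open>\<open>A\<close> is the Gauss-Manin matrix of \<open>E\<close>, i.e. \<open>E(S) = A S - S B(E)\<close>. All entries of \<open>S\<close>, not only
  the chart coordinates, are regular functions, so \<open>E\<close> applies to them. Since \<open>E\<close> is determined by
  \<open>A\<close> on regular functions, the vector fields below are given as predicates on derivations; their
  values on functions that are not regular are irrelevant.\<close>

definition gauss_manin_matrix ::
  "nat \<Rightarrow> (complex \<Rightarrow> complex \<Rightarrow> complex mat) \<Rightarrow> vfield \<Rightarrow> (point \<Rightarrow> complex mat) \<Rightarrow> bool" where
  "gauss_manin_matrix n \<Omega> E A \<longleftrightarrow>
     (\<forall>a b S. (a, b, S) \<in> moduli n \<Omega> \<longrightarrow>
        A (a, b, S) \<in> carrier_mat (n + 1) (n + 1) \<and>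
        mat1 (n + 1) (\<lambda>i j. E (s_entry n \<Omega> i j) (a, b, S)) =
          A (a, b, S) * S
          - S * gm_form n a b (E (coord n \<Omega> 1) (a, b, S)) (E (coord n \<Omega> (n + 2)) (a, b, S)))"

definition yukawa_matrix ::
  "nat \<Rightarrow> (nat \<Rightarrow> point \<Rightarrow> complex) \<Rightarrow> point \<Rightarrow> complex mat" where
  "yukawa_matrix n Y x = mat1 (n + 1) (\<lambda>i j.
     if j = i + 1 then (if i = 1 then 1 else if i = n then - 1 else Y (i - 1) x) else 0)"

definition modular_vector_field ::
  "nat \<Rightarrow> (complex \<Rightarrow> complex \<Rightarrow> complex mat) \<Rightarrow> vfield \<Rightarrow> bool" where
  "modular_vector_field n \<Omega> R \<longleftrightarrow> vector_field n \<Omega> R \<and>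
     (\<exists>Y. (\<forall>i. 1 \<le> i \<and> i + 2 \<le> n \<longrightarrow> Y i \<in> regular_functions n \<Omega>) \<and>
        gauss_manin_matrix n \<Omega> R (yukawa_matrix n Y) \<and>
        (\<forall>x\<in>moduli n \<Omega>. yukawa_matrix n Y x * Phi n + Phi n * transpose_mat (yukawa_matrix n Y x)
            = 0\<^sub>m (n + 1) (n + 1)))"

definition lie_vector_field ::
  "nat \<Rightarrow> (complex \<Rightarrow> complex \<Rightarrow> complex mat) \<Rightarrow> complex mat \<Rightarrow> vfield \<Rightarrow> bool" where
  "lie_vector_field n \<Omega> g E \<longleftrightarrow>
     vector_field n \<Omega> E \<and> gauss_manin_matrix n \<Omega> E (\<lambda>x. transpose_mat g)"

definition matrix_unit :: "nat \<Rightarrow> nat \<Rightarrow> nat \<Rightarrow> complex mat" where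
  "matrix_unit k p q = mat1 k (\<lambda>i j. if i = p \<and> j = q then 1 else 0)"

definition g11 :: "nat \<Rightarrow> complex mat" where
  "g11 n = matrix_unit (n + 1) 1 1 - matrix_unit (n + 1) (n + 1) (n + 1)"

definition g22 :: "nat \<Rightarrow> complex mat" where
  "g22 n = matrix_unit (n + 1) 2 2 - matrix_unit (n + 1) n n"

definition radial_vector_field ::
  "nat \<Rightarrow> (complex \<Rightarrow> complex \<Rightarrow> complex mat) \<Rightarrow> vfield \<Rightarrow> bool" where
  "radial_vector_field n \<Omega> H \<longleftrightarrow>
     (\<exists>R11. lie_vector_field n \<Omega> (g11 n) R11 \<and>
        (if n = 1 then H = (\<lambda>f. - R11 f)
         else if n = 2 then H = (\<lambda>f. - (2 * R11 f))
         else \<exists>R22. lie_vector_field n \<Omega> (g22 n) R22 \<and> H = (\<lambda>f. R22 f - R11 f)))"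

definition partial_derivative ::
  "nat \<Rightarrow> (complex \<Rightarrow> complex \<Rightarrow> complex mat) \<Rightarrow> nat \<Rightarrow> vfield \<Rightarrow> bool" where
  "partial_derivative n \<Omega> j P \<longleftrightarrow> vector_field n \<Omega> P \<and>
     (\<forall>i\<in>chart_indices n. P (coord n \<Omega> i) = const_on (moduli n \<Omega>) (if i = j then 1 else 0))"

definition lie_bracket :: "vfield \<Rightarrow> vfield \<Rightarrow> vfield" where
  "lie_bracket E F = (\<lambda>f. E (F f) - F (E f))"

datatype field_option = Option1 | Option2

fun dwork_field ::
  "field_option \<Rightarrow> nat \<Rightarrow> (complex \<Rightarrow> complex \<Rightarrow> complex mat) \<Rightarrow> vfield \<Rightarrow> bool" where
  "dwork_field Option1 n \<Omega> D \<longleftrightarrow> modular_vector_field n \<Omega> D"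
| "dwork_field Option2 n \<Omega> D \<longleftrightarrow>
     (\<exists>R P H. modular_vector_field n \<Omega> R \<and> partial_derivative n \<Omega> 2 P \<and>
        radial_vector_field n \<Omega> H \<and>
        (\<forall>f\<in>regular_functions n \<Omega>.
           D f = R f + coord n \<Omega> 2 *
             (lie_bracket R (\<lambda>h. (1 + (if n = 2 then 1 else 0)) * P h) f - H f)))"


section \<open>Calabi-Yau modular forms\<close>

definition chart_weight :: "nat \<Rightarrow> nat \<Rightarrow> int" where
  "chart_weight n j =
     (if n = 1 then int j
      else if n = 2 then (if j = 4 then 8 else 2)
      else if j = 1 then 1
      else if j = n + 2 then int n + 2
      else let i = fst (chart_pos n j); k = int (snd (chart_pos n j))
           in if i = 2 \<or> i = n + 1 then k + 1 else if i = n then k - 1 else k)"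

definition u_weight :: "nat \<Rightarrow> int" where
  "u_weight n = (if n = 2 then 4 else int ((n + 2) div 2))"

text \<open>Under the first option the last coordinate is replaced for odd \<open>n \<ge> 3\<close>.\<close>

definition chart_coord ::
  "field_option \<Rightarrow> nat \<Rightarrow> (complex \<Rightarrow> complex \<Rightarrow> complex mat) \<Rightarrow> nat \<Rightarrow> point \<Rightarrow> complex" where
  "chart_coord opt n \<Omega> j =
     (if opt = Option1 \<and> odd n \<and> n \<ge> 3 \<and> j = moduli_dim n
      then coord n \<Omega> j + coord n \<Omega> 2 * coord n \<Omega> (if n = 3 then 4 else j - 2)
      else coord n \<Omega> j)"

definition weighted_generators ::
  "field_option \<Rightarrow> nat \<Rightarrow> (complex \<Rightarrow> complex \<Rightarrow> complex mat) \<Rightarrow> nat set \<Rightarrow>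
   ((point \<Rightarrow> complex) \<times> int) set" where
  "weighted_generators opt n \<Omega> J =
     (\<lambda>j. (chart_coord opt n \<Omega> j, chart_weight n j)) ` J
     \<union> (if even n then {(coord_u n \<Omega>, u_weight n)} else {})
     \<union> {(inv_disc n \<Omega>, - (2 * chart_weight n (n + 2) + (\<Sum>j\<in>diag_indices n. chart_weight n j)))}"

definition quasi_modular_part ::
  "field_option \<Rightarrow> nat \<Rightarrow> (complex \<Rightarrow> complex \<Rightarrow> complex mat) \<Rightarrow> int \<Rightarrow> (point \<Rightarrow> complex) set" where
  "quasi_modular_part opt n \<Omega> r =
     {f. homogeneous (moduli n \<Omega>) (weighted_generators opt n \<Omega> (chart_indices n)) r f}"

definition modular_forms ::
  "field_option \<Rightarrow> nat \<Rightarrow> (complex \<Rightarrow> complex \<Rightarrow> complex mat) \<Rightarrow> (point \<Rightarrow> complex) set" where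
  "modular_forms opt n \<Omega> = generated_algebra (moduli n \<Omega>)
     (fst ` weighted_generators opt n \<Omega> (chart_indices n - {2}))"

definition positive_modular_part ::
  "field_option \<Rightarrow> nat \<Rightarrow> (complex \<Rightarrow> complex \<Rightarrow> complex mat) \<Rightarrow> nat \<Rightarrow> (point \<Rightarrow> complex) set" where
  "positive_modular_part opt n \<Omega> r =
     (if r = 0 then range (const_on (moduli n \<Omega>))
      else modular_forms opt n \<Omega> \<inter> quasi_modular_part opt n \<Omega> (int r))"

end

theory Submission
  imports
    Defs
    "HOL-Computational_Algebra.Polynomial"
    "Jordan_Normal_Form.Determinant"
begin

text \<open>
  Write \<open>h\<close> for the weight of \<open>t\<^sub>1\<close> (so \<open>h = 1\<close>, or \<open>h = 2\<close> if \<open>n = 2\<close>) and \<open>\<phi> = - t\<^sub>2 / h\<close>. For a modular form \<open>f\<close>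
  of weight \<open>r\<close> the function \<open>\<partial> f = D f - r \<phi> f\<close> does not involve \<open>t\<^sub>2\<close>, and neither does
  \<open>\<Lambda> = D \<phi> - \<phi>\<^sup>2\<close>. Zagier's argument then applies: \<open>D\<^sup>j f\<close> is a combination of the
  \<open>\<phi>\<^sup>j\<^sup>-\<^sup>m f\<^sub>(\<^sub>m\<^sub>)\<close>, and in the bracket all terms with a positive power of \<open>\<phi>\<close> cancel.

  The dependence on \<open>t\<^sub>2\<close> is read off from the unipotent matrix \<open>G = exp(-t\<^sub>2 g)\<close>, where \<open>g\<close> is an
  infinitesimal isometry of \<open>\<Phi>\<close> whose flow moves \<open>t\<^sub>2\<close>: as \<open>(G S) \<Omega> (G S)\<^sup>t\<^sup>r = \<Phi>\<close>, the
  entries of \<open>G S\<close> can be computed recursively from the chart coordinates other than \<open>t\<^sub>2\<close>.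
  The grading is controlled by an action of the multiplicative group on the moduli space, which
  shows that weight components of functions are well defined and provides the Euler derivation.
\<close>


section \<open>The canonical form of Rankin-Cohen brackets\<close>

text \<open>The mechanism is that of Ramanujan's relations, with t_2 in the role of E_2: D t_j =
  -(w_j/h) t_2 t_j and D t_2 = -(1/h) t_2^2, each up to terms free of t_2. Both relations must carry
  the same constant 1/h, since only then is \<Lambda> free of t_2. The obstacle is the entry
  s_{n+1,1} for odd n \<ge> 3. The matrix exp(-t_2 g) S contains s_{n+1,1} + t_2 s_{n,1} in its
  place, and in the original chart R has the wrong coefficient of t_2 on s_{n,1} and on s_{n+1,1}.
  Option 1 takes exactly this combination as the coordinate. Option 2 keeps s_{n+1,1}; there the
  commutator with \<partial>/\<partial>t_2 reads off the coefficient of t_2 and removes it, and H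
  puts the weight in its place. The value h = 2 for n = 2 reflects that g^2 is not zero there: the
  quadratic term of the exponential turns the coefficient 1 of -t_2^2 in R t_2 into 1/2.\<close>

lemma derivation_onD:
  assumes "derivation_on A E"
  shows "f \<in> A \<Longrightarrow> E f \<in> A"
    and "f \<in> A \<Longrightarrow> g \<in> A \<Longrightarrow> E (\<lambda>x. f x + g x) = (\<lambda>x. E f x + E g x)"
    and "f \<in> A \<Longrightarrow> E (\<lambda>x. c * f x) = (\<lambda>x. c * E f x)"
    and "f \<in> A \<Longrightarrow> g \<in> A \<Longrightarrow> E (\<lambda>x. f x * g x) = (\<lambda>x. E f x * g x + f x * E g x)"
  using assms by (simp_all add: derivation_on_def plus_fun_def times_fun_def)

section \<open>Derivations on subalgebras of functions\<close>

definition subalgebra :: "('p \<Rightarrow> complex) set \<Rightarrow> bool" where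
  "subalgebra A \<longleftrightarrow> (\<forall>f\<in>A. \<forall>g\<in>A. (\<lambda>x. f x + g x) \<in> A \<and> (\<lambda>x. f x * g x) \<in> A) \<and>
     (\<forall>c. \<forall>f\<in>A. (\<lambda>x. c * f x) \<in> A)"

lemma subalgebraD:
  assumes "subalgebra A"
  shows "f \<in> A \<Longrightarrow> g \<in> A \<Longrightarrow> (\<lambda>x. f x + g x) \<in> A"
    and "f \<in> A \<Longrightarrow> g \<in> A \<Longrightarrow> (\<lambda>x. f x * g x) \<in> A"
    and "f \<in> A \<Longrightarrow> (\<lambda>x. c * f x) \<in> A"
  using assms by (auto simp: subalgebra_def)

lemma subalgebra_sum:
  assumes "subalgebra A" "\<And>m. m \<le> n \<Longrightarrow> f m \<in> A"
  shows "(\<lambda>x. \<Sum>m\<le>(n::nat). f m x) \<in> A"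
  using assms(2) by (induction n) (auto intro: subalgebraD[OF assms(1)])

lemma subalgebra_power_mult:
  assumes "subalgebra A" "p \<in> A" "f \<in> A"
  shows "(\<lambda>x. p x ^ k * f x) \<in> A"
proof (induction k)
  case (Suc k)
  have "(\<lambda>x. p x * (p x ^ k * f x)) \<in> A"
    by (intro subalgebraD(2)[OF assms(1)] assms Suc)
  then show ?case by (simp add: mult.assoc)
qed (use assms in simp)

lemma derivation_on_sum:
  assumes "derivation_on A E" "subalgebra A" "\<And>m. m \<le> n \<Longrightarrow> f m \<in> A"
  shows "E (\<lambda>x. \<Sum>m\<le>(n::nat). f m x) = (\<lambda>x. \<Sum>m\<le>n. E (f m) x)"
  using assms(3)
  by (induction n) (simp_all add: derivation_onD[OF assms(1)] subalgebra_sum[OF assms(2)])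

lemma derivation_on_power_mult:
  assumes "derivation_on A E" "subalgebra A" "p \<in> A" "f \<in> A"
  shows "E (\<lambda>x. p x ^ k * f x)
    = (\<lambda>x. of_nat k * p x ^ (k - 1) * E p x * f x + p x ^ k * E f x)"
proof (induction k)
  case (Suc k)
  have "E (\<lambda>x. p x * (p x ^ k * f x))
      = (\<lambda>x. E p x * (p x ^ k * f x) + p x * E (\<lambda>x. p x ^ k * f x) x)"
    by (intro derivation_onD[OF assms(1)] assms subalgebra_power_mult)
  then show ?case unfolding Suc
    by (cases k) (auto simp: algebra_simps fun_eq_iff)
qed simp

text \<open>The coefficient of \<phi>^(n-m) f_(m) in D^n f. The quotient (n+r-1)!/(m+r-1)! is
  written as a rising factorial, which also covers r = m = 0, where it vanishes for n > 0.\<close>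

definition iterate_coeff :: "nat \<Rightarrow> nat \<Rightarrow> nat \<Rightarrow> complex" where
  "iterate_coeff r n m = of_nat (n choose m) * pochhammer (of_nat (m + r)) (n - m)"

lemma iterate_coeff_self [simp]: "iterate_coeff r n n = 1"
  by (simp add: iterate_coeff_def)

lemma iterate_coeff_gt [simp]: "n < m \<Longrightarrow> iterate_coeff r n m = 0"
  by (simp add: iterate_coeff_def)

lemma iterate_coeff_Suc_0: "iterate_coeff r (Suc n) 0 = of_nat (n + r) * iterate_coeff r n 0"
  by (simp add: iterate_coeff_def pochhammer_Suc algebra_simps)

text \<open>In D(\<phi>^(n-m) f_(m)) the power of \<phi> grows with factor n - m from D \<phi> and r
  + 2m from D f_(m), together n + r + m, here with m shifted by one. The first summand comes from
  the f_(m+1) contained in D f_(m).\<close>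

lemma iterate_coeff_Suc_Suc:
  "iterate_coeff r (Suc n) (Suc m)
    = iterate_coeff r n m + of_nat (n + r + Suc m) * iterate_coeff r n (Suc m)"
proof -
  consider "n < m" | "n = m" | "m < n" by linarith
  then show ?thesis
  proof cases
    case 3
    define e where "e = n - Suc m"
    have n: "n = Suc m + e" using 3 by (simp add: e_def)
    define P where "P = pochhammer (of_nat (Suc m + r) :: complex) e"
    have p1: "pochhammer (of_nat (Suc m + r) :: complex) (n - m)
        = P * (of_nat (n + r))" and p2: "pochhammer (of_nat (Suc m + r) :: complex) (n - Suc m) = P"
      by (simp_all add: n P_def pochhammer_Suc add_ac)
    have p3: "pochhammer (of_nat (m + r) :: complex) (n - m) = of_nat (m + r) * P"
      using pochhammer_rec[of "of_nat (m + r) :: complex" e] by (simp add: n P_def add_ac)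
    have "Suc m * (n choose Suc m) = (n - m) * (n choose m)"
      using binomial_absorb_comp binomial_absorption by presburger
    then have "of_nat (Suc m * (n choose Suc m)) = (of_nat ((n - m) * (n choose m)) :: complex)"
      by simp
    then have absorb: "of_nat (Suc m) * of_nat (n choose Suc m)
        = (of_nat n - of_nat m) * (of_nat (n choose m) :: complex)"
      using 3 by (simp only: of_nat_mult of_nat_diff[OF less_imp_le[OF 3]])
    have "iterate_coeff r (Suc n) (Suc m) - iterate_coeff r n m
          - of_nat (n + r + Suc m) * iterate_coeff r n (Suc m)
        = P * ((of_nat n - of_nat m) * of_nat (n choose m) - of_nat (Suc m) * of_nat (n choose Suc m))"
      unfolding iterate_coeff_def diff_Suc_Suc p1 p2 p3
      by (simp add: algebra_simps)
    also have "\<dots> = 0" using absorb by simp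
    finally show ?thesis by (simp only: diff_diff_eq right_minus_eq)
  qed (auto simp: iterate_coeff_def)
qed

text \<open>This is why the \<Lambda>-terms cancel: the left side is the multiple of \<Lambda>
  produced by D \<phi>, the right side the one produced by the recursion defining f_(m+2) from
  f_(m+1).\<close>

lemma iterate_coeff_descend:
  "of_nat (n - m) * iterate_coeff r n m
    = of_nat (Suc m) * of_nat (m + r) * iterate_coeff r n (Suc m)"
proof (cases "m < n")
  case True
  define e where "e = n - Suc m"
  have n: "n = Suc m + e" using True by (simp add: e_def)
  have p: "pochhammer (of_nat (m + r) :: complex) (n - m)
      = of_nat (m + r) * pochhammer (of_nat (Suc m + r)) (n - Suc m)"
    using pochhammer_rec[of "of_nat (m + r) :: complex" e] by (simp add: n add_ac)
  have "Suc m * (n choose Suc m) = (n - m) * (n choose m)"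
    using binomial_absorb_comp binomial_absorption by presburger
  then have absorb: "of_nat (Suc m) * of_nat (n choose Suc m)
      = (of_nat (n - m) * of_nat (n choose m) :: complex)"
    by (metis of_nat_mult)
  show ?thesis unfolding iterate_coeff_def p
    using absorb by (simp add: mult_ac)
qed simp

text \<open>D applied to the formula for D^n f, at one point: \<open>p\<close>, \<open>L\<close>,
  \<open>F m\<close> are the values of \<phi>, \<Lambda>, f_(m). The truncated indices n - m - 1 and
  m - 1 come with the factors n - m and m, which are zero where truncation happens.\<close>

lemma iterate_coeff_step:
  fixes p L :: complex and F :: "nat \<Rightarrow> complex"
  shows "(\<Sum>m\<le>n. iterate_coeff r n m *
      (of_nat (n - m) * p ^ (n - m - 1) * (p\<^sup>2 + L) * F m
       + p ^ (n - m) * (F (Suc m) - of_nat m * (of_nat m + of_nat r - 1) * L * F (m - 1)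
           + of_nat (r + 2 * m) * p * F m)))
    = (\<Sum>m\<le>Suc n. iterate_coeff r (Suc n) m * p ^ (Suc n - m) * F m)"
    (is "?lhs = ?rhs")
proof -
  let ?c = "iterate_coeff r n"
  \<comment> \<open>\<open>X\<close> and \<open>Y\<close> collect the \<Lambda>-terms from D \<phi>
    and from D f_(m), \<open>Z\<close> the terms in which the power of \<phi> grows,
    \<open>V\<close> those in which f_(m) becomes f_(m+1).\<close>
  define X where "X m = ?c m * of_nat (n - m) * p ^ (n - m - 1) * L * F m" for m
  define Y where "Y m = ?c m * p ^ (n - m) * of_nat m * (of_nat m + of_nat r - 1) * L * F (m - 1)" for m
  define Z where "Z m = ?c m * of_nat (n + r + m) * p ^ (Suc n - m) * F m" for m
  define V where "V m = ?c m * p ^ (n - m) * F (Suc m)" for m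
  have "?lhs = (\<Sum>m\<le>n. X m - Y m + Z m + V m)"
  proof (rule sum.cong[OF refl])
    fix m assume "m \<in> {..n}"
    then have m: "m \<le> n" by simp
    have 1: "of_nat (n - m) * p ^ (n - m - 1) * p\<^sup>2 = of_nat (n - m) * p ^ (Suc n - m)"
    proof (cases "n - m")
      case (Suc k)
      then have "Suc n - m = Suc (Suc k)" by simp
      with Suc show ?thesis by (simp add: power2_eq_square)
    qed simp
    have 2: "p ^ (n - m) * p = p ^ (Suc n - m)" using m by (simp add: Suc_diff_le)
    have 3: "of_nat (n + r + m) = (of_nat (n - m) + of_nat (r + 2 * m) :: complex)"
      using m by (simp only: of_nat_add[symmetric]) (simp add: mult_2)
    have "?c m * (of_nat (n - m) * p ^ (n - m - 1) * (p\<^sup>2 + L) * F m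
        + p ^ (n - m) * (F (Suc m) - of_nat m * (of_nat m + of_nat r - 1) * L * F (m - 1)
           + of_nat (r + 2 * m) * p * F m))
      = X m - Y m + V m + ?c m * ((of_nat (n - m) * p ^ (n - m - 1) * p\<^sup>2) * F m
          + of_nat (r + 2 * m) * (p ^ (n - m) * p) * F m)"
      by (simp only: X_def Y_def V_def) (simp add: algebra_simps)
    also have "\<dots> = X m - Y m + Z m + V m"
      unfolding 1 2 Z_def 3 by (simp add: algebra_simps)
    finally show "?c m * (of_nat (n - m) * p ^ (n - m - 1) * (p\<^sup>2 + L) * F m
        + p ^ (n - m) * (F (Suc m) - of_nat m * (of_nat m + of_nat r - 1) * L * F (m - 1)
           + of_nat (r + 2 * m) * p * F m)) = X m - Y m + Z m + V m" .
  qed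
  also have "\<dots> = (\<Sum>m\<le>n. X m) - (\<Sum>m\<le>n. Y m) + (\<Sum>m\<le>n. Z m) + (\<Sum>m\<le>n. V m)"
    by (simp add: sum.distrib sum_subtractf)
  \<comment> \<open>The index shift loses nothing, because \<open>Y 0\<close> and
    \<open>Y (Suc n)\<close> both vanish.\<close>
  also have "(\<Sum>m\<le>n. Y m) = (\<Sum>m\<le>n. X m)"
  proof -
    have "X m = Y (Suc m)" for m
      using iterate_coeff_descend[of n m r] by (simp add: X_def Y_def mult_ac)
    then have "(\<Sum>m\<le>n. X m) = (\<Sum>m\<le>n. Y (Suc m))" by simp
    also have "\<dots> = (\<Sum>m\<le>Suc n. Y m) - Y 0" using sum.atMost_Suc_shift[of Y n] by simp
    also have "\<dots> = (\<Sum>m\<le>n. Y m)" by (simp add: Y_def)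
    finally show ?thesis by simp
  qed
  also have "(\<Sum>m\<le>n. X m) - (\<Sum>m\<le>n. X m) + (\<Sum>m\<le>n. Z m) + (\<Sum>m\<le>n. V m)
      = (\<Sum>m\<le>Suc n. Z m) + (\<Sum>m\<le>n. V m)" by (simp add: Z_def)
  also have "\<dots> = Z 0 + (\<Sum>m\<le>n. Z (Suc m) + V m)"
    by (subst sum.atMost_Suc_shift) (simp add: sum.distrib)
  also have "\<dots> = ?rhs"
    unfolding sum.atMost_Suc_shift iterate_coeff_Suc_Suc iterate_coeff_Suc_0
    by (simp add: Z_def V_def algebra_simps)
  finally show ?thesis .
qed

text \<open>The upper index is -1 for k = r = 0, so the binomial is a generalised one. In this form
  it merges with the rising factorials of \<open>iterate_coeff\<close>.\<close>

lemma gbinomial_shift: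
  assumes "i \<le> k"
  shows "((of_nat k + of_nat r - 1 :: complex) gchoose i)
    = pochhammer (of_nat (k - i + r)) i / fact i"
  using assms by (simp add: gbinomial_pochhammer' of_nat_diff algebra_simps)

text \<open>The coefficient of f_(a) g_(b) in the bracket. Put i = b + l and e = k - a - b. All
  rising factorials merge into products independent of l; what depends on l is (-1)^l times the
  binomial e over l, whose sum is zero unless e = 0.\<close>

lemma bracket_coeff_sum:
  fixes p :: complex
  shows "(\<Sum>i\<le>k. (- 1) ^ (k - i)
      * ((of_nat k + of_nat r - 1) gchoose i) * ((of_nat k + of_nat s - 1) gchoose (k - i))
      * (iterate_coeff r (k - i) a * p ^ (k - i - a)) * (iterate_coeff s i b * p ^ (i - b)))
    = (if a + b = k then (- 1) ^ a * ((of_nat k + of_nat r - 1) gchoose b)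
        * ((of_nat k + of_nat s - 1) gchoose a) else 0)" (is "sum ?t {..k} = _")
proof (cases "a + b \<le> k")
  case False
  then have "k - i < a \<or> i < b" if "i \<le> k" for i using that by linarith
  then have "?t i = 0" if "i \<le> k" for i using that by (metis iterate_coeff_gt mult_zero_left mult_zero_right)
  then have "sum ?t {..k} = 0"
    by (intro sum.neutral ballI) (simp only: atMost_iff)
  then show ?thesis using False by simp
next
  case True
  define e where "e = k - (a + b)"
  have k: "k = a + b + e" using True by (simp add: e_def)
  have "sum ?t {..k} = sum ?t {b..b + e}"
  proof (rule sum.mono_neutral_right)
    show "\<forall>i\<in>{..k} - {b..b + e}. ?t i = 0"
    proof
      fix i assume "i \<in> {..k} - {b..b + e}"
      then have "i < b \<or> k - i < a" using k by auto
      then show "?t i = 0" by (metis iterate_coeff_gt mult_zero_left mult_zero_right)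
    qed
  qed (auto simp: k)
  also have "\<dots> = (\<Sum>l\<le>e. ?t (b + l))"
    using sum.shift_bounds_cl_nat_ivl[of ?t 0 b e] by (simp add: atLeast0AtMost add.commute)
  also have "\<dots> = (\<Sum>l\<le>e. (- 1) ^ (a + e) * p ^ e
      * (pochhammer (of_nat (a + r)) (b + e) * pochhammer (of_nat (b + s)) (a + e)
         / (fact a * fact b * fact e)) * ((- 1) ^ l * of_nat (e choose l)))"
  proof (rule sum.cong[OF refl])
    fix l assume "l \<in> {..e}"
    then have l: "l \<le> e" by simp
    define m where "m = e - l"
    have e: "e = l + m" using l by (simp add: m_def)
    have ki: "k - (b + l) = a + m" using k l by (simp add: m_def)
    have s1: "(- 1) ^ (a + m) = (- 1 :: complex) ^ (a + e) * (- 1) ^ l"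
      by (simp add: e power_add flip: power2_eq_square power_mult)
    \<comment> \<open>The factorial of \<open>iterate_coeff\<close> runs from a + r over m factors
      and stops at a + m + r = k - i + r, just where the one of the binomial begins.\<close>
    have g1: "((of_nat k + of_nat r - 1 :: complex) gchoose (b + l)) * pochhammer (of_nat (a + r)) m
        = pochhammer (of_nat (a + r)) (b + e) / fact (b + l)"
      using gbinomial_shift[of "b + l" k r] pochhammer_product'[of "of_nat (a + r) :: complex" m "b + l"] k l ki
      by (simp add: e add_ac)
    have g2: "((of_nat k + of_nat s - 1 :: complex) gchoose (a + m)) * pochhammer (of_nat (b + s)) l
        = pochhammer (of_nat (b + s)) (a + e) / fact (a + m)"
      using gbinomial_shift[of "a + m" k s] pochhammer_product'[of "of_nat (b + s) :: complex" l "a + m"] k l ki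
      by (simp add: e add_ac)
    have c1: "(of_nat (a + m choose a) :: complex) = fact (a + m) / (fact a * fact m)"
      by (simp add: binomial_fact)
    have c2: "(of_nat (b + l choose b) :: complex) = fact (b + l) / (fact b * fact l)"
      by (simp add: binomial_fact)
    have c3: "(of_nat (e choose l) :: complex) = fact e / (fact l * fact m)"
      using l by (simp add: binomial_fact m_def)
    have "?t (b + l) = (- 1) ^ (a + m)
      * (((of_nat k + of_nat r - 1) gchoose (b + l)) * pochhammer (of_nat (a + r)) m)
      * (((of_nat k + of_nat s - 1) gchoose (a + m)) * pochhammer (of_nat (b + s)) l)
      * of_nat (a + m choose a) * of_nat (b + l choose b) * (p ^ m * p ^ l)"
      by (simp add: ki iterate_coeff_def mult_ac)
    also have "p ^ m * p ^ l = p ^ e" by (simp add: e power_add)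
    finally show "?t (b + l) = (- 1) ^ (a + e) * p ^ e
      * (pochhammer (of_nat (a + r)) (b + e) * pochhammer (of_nat (b + s)) (a + e)
         / (fact a * fact b * fact e)) * ((- 1) ^ l * of_nat (e choose l))"
      unfolding g1 g2 c1 c2 c3 s1 by (simp add: field_simps)
  qed
  also have "\<dots> = (- 1) ^ (a + e) * p ^ e
      * (pochhammer (of_nat (a + r)) (b + e) * pochhammer (of_nat (b + s)) (a + e)
         / (fact a * fact b * fact e)) * (\<Sum>l\<le>e. (- 1) ^ l * of_nat (e choose l))"
    by (simp only: sum_distrib_left)
  also have "\<dots> = (if a + b = k then (- 1) ^ a * ((of_nat k + of_nat r - 1) gchoose b)
        * ((of_nat k + of_nat s - 1) gchoose a) else 0)"
  proof (cases "e = 0")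
    case True
    then show ?thesis using gbinomial_shift[of b k r] gbinomial_shift[of a k s]
      by (simp add: k mult_ac)
  next
    case False
    then show ?thesis using choose_alternating_sum[of e, where ?'a = complex] k by simp
  qed
  finally show ?thesis .
qed

text \<open>\<open>A\<close> is the algebra on which D acts and which contains \<phi>; the graded
  pieces \<open>M r\<close> lie inside it. The assumptions concern \<open>d\<close> on each piece
  separately; that it is a derivation of their sum is a separate input of the concluding
  theorem.\<close>

locale rankin_cohen =
  fixes M :: "nat \<Rightarrow> ('p \<Rightarrow> complex) set" and A :: "('p \<Rightarrow> complex) set"
    and D d :: "('p \<Rightarrow> complex) \<Rightarrow> ('p \<Rightarrow> complex)" and \<phi> L :: "'p \<Rightarrow> complex"
  assumes derivation: "derivation_on A D" and subalgebra: "subalgebra A" and \<phi>_mem: "\<phi> \<in> A"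
    and M_subset: "M r \<subseteq> A"
    and add_mem: "f \<in> M r \<Longrightarrow> g \<in> M r \<Longrightarrow> (\<lambda>x. f x + g x) \<in> M r"
    and scale_mem: "f \<in> M r \<Longrightarrow> (\<lambda>x. a * f x) \<in> M r"
    and mult_mem: "f \<in> M r \<Longrightarrow> g \<in> M s \<Longrightarrow> (\<lambda>x. f x * g x) \<in> M (r + s)"
    and D_eq: "f \<in> M r \<Longrightarrow> D f = (\<lambda>x. d f x + of_nat r * \<phi> x * f x)"
    and d_mem: "f \<in> M r \<Longrightarrow> d f \<in> M (r + 2)"
    and D_\<phi>: "D \<phi> = (\<lambda>x. (\<phi> x)\<^sup>2 + L x)"
    and L_mem: "L \<in> M 4"
begin

lemma canonical_iterate_mem: "f \<in> M r \<Longrightarrow> canonical_iterate d L r f j \<in> M (r + 2 * j)"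
proof (induction j rule: less_induct)
  case (less j)
  show ?case
  proof (cases j)
    case (Suc i)
    have 1: "d (canonical_iterate d L r f i) \<in> M (r + 2 * j)"
      using d_mem[OF less.IH[of i]] less.prems Suc by (simp add: add_ac)
    show ?thesis
    proof (cases i)
      case 0
      then show ?thesis using 1 Suc by simp
    next
      case (Suc l)
      have "(\<lambda>x. L x * canonical_iterate d L r f l x) \<in> M (4 + (r + 2 * l))"
        using less.IH[of l] less.prems Suc \<open>j = Suc i\<close> by (intro mult_mem L_mem) simp
      moreover have idx: "4 + (r + 2 * l) = r + 2 * j" using Suc \<open>j = Suc i\<close> by simp
      ultimately have "(\<lambda>x. L x * canonical_iterate d L r f l x) \<in> M (r + 2 * j)" by simp
      from scale_mem[OF this, of "of_nat i * (of_nat i + of_nat r - 1)"]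
      have "(\<lambda>x. of_nat i * (of_nat i + of_nat r - 1) * L x * canonical_iterate d L r f (i - 1) x)
          \<in> M (r + 2 * j)"
        using idx Suc by (simp add: mult_ac)
      from add_mem[OF 1 this] show ?thesis using \<open>j = Suc i\<close> by simp
    qed
  qed (use less in simp)
qed

lemma D_canonical_iterate:
  assumes "f \<in> M r"
  shows "D (canonical_iterate d L r f m) = (\<lambda>x. canonical_iterate d L r f (Suc m) x
     - of_nat m * (of_nat m + of_nat r - 1) * L x * canonical_iterate d L r f (m - 1) x
     + of_nat (r + 2 * m) * \<phi> x * canonical_iterate d L r f m x)"
  using D_eq[OF canonical_iterate_mem[OF assms], of m] by simp

lemma funpow_D:
  assumes "f \<in> M r"
  shows "(D ^^ n) f
    = (\<lambda>x. \<Sum>m\<le>n. iterate_coeff r n m * \<phi> x ^ (n - m) * canonical_iterate d L r f m x)"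
proof (induction n)
  case (Suc n)
  let ?F = "canonical_iterate d L r f"
  have F: "?F m \<in> A" for m using canonical_iterate_mem[OF assms] M_subset by blast
  note pm = subalgebra_power_mult[OF subalgebra \<phi>_mem F]
  have "(D ^^ Suc n) f = D (\<lambda>x. \<Sum>m\<le>n. iterate_coeff r n m * (\<phi> x ^ (n - m) * ?F m x))"
    by (simp add: Suc mult.assoc)
  also have "\<dots> = (\<lambda>x. \<Sum>m\<le>n. iterate_coeff r n m * D (\<lambda>x. \<phi> x ^ (n - m) * ?F m x) x)"
    by (simp add: derivation_on_sum[OF derivation subalgebra] derivation_onD[OF derivation]
        subalgebraD[OF subalgebra] pm)
  also have "\<dots> = (\<lambda>x. \<Sum>m\<le>Suc n. iterate_coeff r (Suc n) m * \<phi> x ^ (Suc n - m) * ?F m x)"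
    unfolding derivation_on_power_mult[OF derivation subalgebra \<phi>_mem F] D_\<phi>
      D_canonical_iterate[OF assms]
  proof
    fix x
    note step = iterate_coeff_step[where p = "\<phi> x" and L = "L x" and F = "\<lambda>m. ?F m x" and n = n and r = r]
    show "(\<Sum>m\<le>n. iterate_coeff r n m *
        (of_nat (n - m) * \<phi> x ^ (n - m - 1) * ((\<phi> x)\<^sup>2 + L x) * ?F m x + \<phi> x ^ (n - m) *
          (?F (Suc m) x - of_nat m * (of_nat m + of_nat r - 1) * L x * ?F (m - 1) x
            + of_nat (r + 2 * m) * \<phi> x * ?F m x)))
      = (\<Sum>m\<le>Suc n. iterate_coeff r (Suc n) m * \<phi> x ^ (Suc n - m) * ?F m x)"
      by (rule step)
  qed
  finally show ?case .
qed simp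

text \<open>Padding with vanishing coefficients makes the range of summation independent of n, so
  that the sums in the bracket can be interchanged.\<close>

lemma funpow_D_upto:
  assumes "f \<in> M r" "n \<le> k"
  shows "(D ^^ n) f x
    = (\<Sum>m\<le>k. iterate_coeff r n m * \<phi> x ^ (n - m) * canonical_iterate d L r f m x)"
  unfolding funpow_D[OF assms(1)]
  by (rule sum.mono_neutral_left) (use assms(2) in auto)

theorem rc_bracket_eq_canonical:
  assumes "f \<in> M r" "g \<in> M s"
  shows "rc_bracket D k r s f g = canonical_bracket d L k r s f g"
proof
  fix x
  let ?F = "canonical_iterate d L r f" and ?G = "canonical_iterate d L s g"
  let ?c = "\<lambda>i. (- 1) ^ (k - i) * ((of_nat k + of_nat r - 1) gchoose i)
      * ((of_nat k + of_nat s - 1) gchoose (k - i)) :: complex"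
  let ?u = "\<lambda>i a b. ?c i * (iterate_coeff r (k - i) a * \<phi> x ^ (k - i - a))
      * (iterate_coeff s i b * \<phi> x ^ (i - b))"
  have "rc_bracket D k r s f g x = (\<Sum>i\<le>k. ?c i
      * (\<Sum>a\<le>k. iterate_coeff r (k - i) a * \<phi> x ^ (k - i - a) * ?F a x)
      * (\<Sum>b\<le>k. iterate_coeff s i b * \<phi> x ^ (i - b) * ?G b x))"
    unfolding rc_bracket_def
    using funpow_D_upto[OF assms(1) diff_le_self] funpow_D_upto[OF assms(2), of _ k]
    by (intro sum.cong refl) (simp only: atMost_iff)
  also have "\<dots> = (\<Sum>i\<le>k. \<Sum>a\<le>k. \<Sum>b\<le>k. ?u i a b * ?F a x * ?G b x)"
    by (simp only: sum_distrib_left sum_distrib_right mult_ac)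
  also have "\<dots> = (\<Sum>a\<le>k. \<Sum>i\<le>k. \<Sum>b\<le>k. ?u i a b * ?F a x * ?G b x)"
    by (rule sum.swap)
  also have "\<dots> = (\<Sum>a\<le>k. \<Sum>b\<le>k. \<Sum>i\<le>k. ?u i a b * ?F a x * ?G b x)"
    by (intro sum.cong refl sum.swap)
  also have "\<dots> = (\<Sum>a\<le>k. \<Sum>b\<le>k. (\<Sum>i\<le>k. ?u i a b) * ?F a x * ?G b x)"
    by (simp only: sum_distrib_right)
  also have "\<dots> = (\<Sum>a\<le>k. \<Sum>b\<le>k. if b = k - a then ?c b * ?F a x * ?G b x else 0)"
    unfolding bracket_coeff_sum by (intro sum.cong refl) auto
  also have "\<dots> = (\<Sum>a\<le>k. ?c (k - a) * ?F a x * ?G (k - a) x)"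
    by (intro sum.cong refl) (subst sum.delta, auto)
  also have "\<dots> = (\<Sum>i\<le>k. ?c i * ?F (k - i) x * ?G i x)"
    by (rule sum.reindex_bij_witness[where i = "\<lambda>i. k - i" and j = "\<lambda>i. k - i"]) auto
  finally show "rc_bracket D k r s f g x = canonical_bracket d L k r s f g x"
    by (simp add: canonical_bracket_def)
qed

lemma sum_mem:
  assumes "\<And>i. i \<le> k \<Longrightarrow> f i \<in> M r"
  shows "(\<lambda>x. \<Sum>i\<le>(k::nat). f i x) \<in> M r"
  using assms by (induction k) (auto intro: add_mem)

lemma canonical_bracket_mem:
  assumes "f \<in> M r" "g \<in> M s"
  shows "canonical_bracket d L k r s f g \<in> M (r + s + 2 * k)"
  unfolding canonical_bracket_def
proof (rule sum_mem)
  fix i assume i: "i \<le> k"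
  have "(\<lambda>x. canonical_iterate d L r f (k - i) x * canonical_iterate d L s g i x)
      \<in> M (r + 2 * (k - i) + (s + 2 * i))"
    by (intro mult_mem canonical_iterate_mem assms)
  also have "r + 2 * (k - i) + (s + 2 * i) = r + s + 2 * k" using i by simp
  finally show "(\<lambda>x. (- 1) ^ (k - i) * ((of_nat k + of_nat r - 1) gchoose i)
      * ((of_nat k + of_nat s - 1) gchoose (k - i)) * canonical_iterate d L r f (k - i) x
      * canonical_iterate d L s g i x) \<in> M (r + s + 2 * k)"
    using scale_mem by (simp add: mult.assoc)
qed

lemma funpow_D_linear:
  assumes "f \<in> A" "g \<in> A"
  shows "(D ^^ n) (\<lambda>x. f x + g x) = (\<lambda>x. (D ^^ n) f x + (D ^^ n) g x)"
    and "(D ^^ n) (\<lambda>x. a * f x) = (\<lambda>x. a * (D ^^ n) f x)"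
proof -
  have mem: "(D ^^ n) h \<in> A" if "h \<in> A" for h n
    using that by (induction n) (auto intro: derivation_onD(1)[OF derivation])
  show "(D ^^ n) (\<lambda>x. f x + g x) = (\<lambda>x. (D ^^ n) f x + (D ^^ n) g x)"
    using assms mem by (induction n) (simp_all add: derivation_onD[OF derivation])
  show "(D ^^ n) (\<lambda>x. a * f x) = (\<lambda>x. a * (D ^^ n) f x)"
    using assms mem by (induction n) (simp_all add: derivation_onD[OF derivation])
qed

lemma rc_bracket_bilinear: "bilinear_on (M r) (M s) (M (r + s + 2 * k)) (rc_bracket D k r s)"
proof -
  have A: "f \<in> M i \<Longrightarrow> f \<in> A" for f i using M_subset by blast
  show ?thesis
    unfolding bilinear_on_def
  proof (intro conjI ballI allI)
    fix f g assume "f \<in> M r" "g \<in> M s"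
    then show "rc_bracket D k r s f g \<in> M (r + s + 2 * k)"
      by (simp add: rc_bracket_eq_canonical canonical_bracket_mem)
  next
    fix f f' g assume "f \<in> M r" "f' \<in> M r" "g \<in> M s"
    then show "rc_bracket D k r s (f + f') g = rc_bracket D k r s f g + rc_bracket D k r s f' g"
      by (simp add: rc_bracket_def plus_fun_def funpow_D_linear(1)[OF A A] algebra_simps sum.distrib)
  next
    fix f g g' assume "f \<in> M r" "g \<in> M s" "g' \<in> M s"
    then show "rc_bracket D k r s f (g + g') = rc_bracket D k r s f g + rc_bracket D k r s f g'"
      by (simp add: rc_bracket_def plus_fun_def funpow_D_linear(1)[OF A A] algebra_simps sum.distrib)
  next
    fix a f g assume "f \<in> M r" "g \<in> M s"
    then show "rc_bracket D k r s (\<lambda>x. a * f x) g = (\<lambda>x. a * rc_bracket D k r s f g x)"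
      by (simp add: rc_bracket_def funpow_D_linear(2)[OF A A] sum_distrib_left mult_ac)
  next
    fix a f g assume "f \<in> M r" "g \<in> M s"
    then show "rc_bracket D k r s f (\<lambda>x. a * g x) = (\<lambda>x. a * rc_bracket D k r s f g x)"
      by (simp add: rc_bracket_def funpow_D_linear(2)[OF A A] sum_distrib_left mult_ac)
  qed
qed

theorem canonical_rankin_cohen:
  assumes "derivation_on (graded_sum M) d"
  shows "canonical_rankin_cohen M (rc_bracket D)"
  unfolding canonical_rankin_cohen_def
  using assms rc_bracket_bilinear rc_bracket_eq_canonical d_mem L_mem by blast

end


section \<open>Homogeneous functions\<close>

definition restr :: "'p set \<Rightarrow> ('p \<Rightarrow> complex) \<Rightarrow> 'p \<Rightarrow> complex" where
  "restr X f = (\<lambda>x. if x \<in> X then f x else 0)"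

text \<open>Elements of the algebras vanish off X, whereas formulas such as constants or 1 / f need
  not. Restricting first lets only the values on X count, so the closure rules apply to plain lambda
  terms.\<close>

definition hom_on ::
  "'p set \<Rightarrow> (('p \<Rightarrow> complex) \<times> int) set \<Rightarrow> int \<Rightarrow> ('p \<Rightarrow> complex) \<Rightarrow> bool" where
  "hom_on X W r f \<longleftrightarrow> homogeneous X W r (restr X f)"

lemma restr_in: "x \<in> X \<Longrightarrow> restr X f x = f x"
  by (simp add: restr_def)

lemma restr_cong: "(\<And>x. x \<in> X \<Longrightarrow> f x = g x) \<Longrightarrow> restr X f = restr X g"
  by (auto simp: restr_def)

lemma restr_id: "(\<And>x. x \<notin> X \<Longrightarrow> f x = 0) \<Longrightarrow> restr X f = f"
  by (auto simp: restr_def)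

lemma restr_arith:
  "restr X (\<lambda>x. f x + g x) = restr X f + restr X g"
  "restr X (\<lambda>x. f x * g x) = restr X f * restr X g"
  "restr X (\<lambda>x. a) = const_on X a"
  "restr X (\<lambda>x. a * f x) = (\<lambda>x. a * restr X f x)"
  by (auto simp: restr_def const_on_def fun_eq_iff)

lemma hom_on_cong:
  assumes "\<And>x. x \<in> X \<Longrightarrow> f x = g x" "r = s"
  shows "hom_on X W r f \<longleftrightarrow> hom_on X W s g"
proof -
  have "restr X f = restr X g" by (rule restr_cong) (rule assms(1))
  then show ?thesis by (simp add: hom_on_def assms(2))
qed

lemma hom_onI:
  assumes "hom_on X W r f" "\<And>x. x \<in> X \<Longrightarrow> f x = g x" "r = s"
  shows "hom_on X W s g"
proof -
  have "hom_on X W r f \<longleftrightarrow> hom_on X W s g" by (rule hom_on_cong) (fact assms)+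
  then show ?thesis using assms(1) by blast
qed

lemma hom_on_zero: "hom_on X W r (\<lambda>x. 0)"
  using homogeneous.zero[of X W r] by (simp add: hom_on_def restr_def zero_fun_def)

lemma hom_on_const: "hom_on X W 0 (\<lambda>x. a)"
  using homogeneous.const[of X W a] by (simp add: hom_on_def restr_arith)

lemma hom_on_add: "hom_on X W r f \<Longrightarrow> hom_on X W r g \<Longrightarrow> hom_on X W r (\<lambda>x. f x + g x)"
  unfolding hom_on_def restr_arith by (rule homogeneous.add)

lemma hom_on_mult:
  "hom_on X W r f \<Longrightarrow> hom_on X W s g \<Longrightarrow> hom_on X W (r + s) (\<lambda>x. f x * g x)"
  unfolding hom_on_def restr_arith by (rule homogeneous.mult)

lemma hom_on_mult': "hom_on X W r f \<Longrightarrow> hom_on X W s g \<Longrightarrow> t = r + s \<Longrightarrow> hom_on X W t (\<lambda>x. f x * g x)"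
  using hom_on_mult by blast

lemma hom_on_scale: "hom_on X W r f \<Longrightarrow> hom_on X W r (\<lambda>x. a * f x)"
  using hom_on_mult[OF hom_on_const[of X W a], of r f] by simp

lemma hom_on_uminus: "hom_on X W r f \<Longrightarrow> hom_on X W r (\<lambda>x. - f x)"
  using hom_on_scale[of X W r f "- 1"] by simp

lemma hom_on_diff: "hom_on X W r f \<Longrightarrow> hom_on X W r g \<Longrightarrow> hom_on X W r (\<lambda>x. f x - g x)"
  using hom_on_add[OF _ hom_on_uminus, of X W r f g] by simp

lemma hom_on_sum: "(\<And>i. i \<in> I \<Longrightarrow> hom_on X W r (f i)) \<Longrightarrow> hom_on X W r (\<lambda>x. \<Sum>i\<in>I. f i x)"
  by (induction I rule: infinite_finite_induct) (auto simp: hom_on_zero hom_on_add)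

lemma hom_on_prod:
  "(\<And>i. i \<in> I \<Longrightarrow> hom_on X W (r i) (f i)) \<Longrightarrow> hom_on X W (\<Sum>i\<in>I. r i) (\<lambda>x. \<Prod>i\<in>I. f i x)"
  by (induction I rule: infinite_finite_induct) (auto simp: hom_on_const hom_on_mult)

lemma hom_on_power: "hom_on X W r f \<Longrightarrow> hom_on X W (int k * r) (\<lambda>x. f x ^ k)"
proof (induction k)
  case (Suc k)
  then show ?case using hom_on_mult[OF Suc.prems Suc.IH] by (simp add: distrib_right)
qed (simp add: hom_on_const)

lemma hom_on_power': "hom_on X W r f \<Longrightarrow> s = int k * r \<Longrightarrow> hom_on X W s (\<lambda>x. f x ^ k)"
  using hom_on_power by blast

lemma hom_on_gen: "(g, w) \<in> W \<Longrightarrow> (\<And>x. x \<notin> X \<Longrightarrow> g x = 0) \<Longrightarrow> hom_on X W w g"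
  by (auto simp: hom_on_def restr_id intro: homogeneous.gen)

lemma homogeneous_outside:
  assumes "homogeneous X W r f" "\<And>g w. (g, w) \<in> W \<Longrightarrow> x \<notin> X \<Longrightarrow> g x = 0" "x \<notin> X"
  shows "f x = 0"
  using assms by (induction rule: homogeneous.induct) (auto simp: const_on_def)

lemma homogeneous_iff_hom_on:
  assumes "\<And>g w x. (g, w) \<in> W \<Longrightarrow> x \<notin> X \<Longrightarrow> g x = 0"
  shows "homogeneous X W r f \<longleftrightarrow> hom_on X W r f \<and> (\<forall>x. x \<notin> X \<longrightarrow> f x = 0)"
proof
  assume f: "homogeneous X W r f"
  have "f x = 0" if "x \<notin> X" for x
    by (rule homogeneous_outside[OF f _ that]) (rule assms)
  then show "hom_on X W r f \<and> (\<forall>x. x \<notin> X \<longrightarrow> f x = 0)"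
    using f by (simp add: hom_on_def restr_id)
qed (auto simp: hom_on_def restr_id)

lemma homogeneous_mono:
  assumes "homogeneous X W r f" "W \<subseteq> W'"
  shows "homogeneous X W' r f"
  using assms(1)
proof induction
  case (gen g w)
  then show ?case using assms(2) by (blast intro: homogeneous.gen)
qed (rule homogeneous.zero homogeneous.const homogeneous.add homogeneous.mult; assumption)+

lemma homogeneous_in_generated_algebra:
  assumes "homogeneous X W r f"
  shows "f \<in> generated_algebra X (fst ` W)"
  using assms
proof induction
  case (zero r)
  have "(0 :: 'a \<Rightarrow> complex) = const_on X 0" by (auto simp: const_on_def)
  then show ?case by (metis generated_algebra.const)
next
  case (gen g w)
  then show ?case by (intro generated_algebra.gen) (simp add: rev_image_eqI)
qed (rule generated_algebra.const generated_algebra.add generated_algebra.mult; assumption)+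

text \<open>Applied to the scaling of (t_1, t_{n+2}), which gives the behaviour of \<Omega>, and to
  the torus action on the moduli space.\<close>

lemma homogeneous_scaling:
  assumes "homogeneous X W r f" "z \<noteq> 0" "x \<in> X"
    and "\<And>x. x \<in> X \<Longrightarrow> act x \<in> X"
    and "\<And>g w x. (g, w) \<in> W \<Longrightarrow> x \<in> X \<Longrightarrow> g (act x) = z powi w * g x"
  shows "f (act x) = z powi r * f x"
  using assms
  by (induction arbitrary: x rule: homogeneous.induct)
     (auto simp: const_on_def algebra_simps power_int_add)

text \<open>Weights may be negative, hence a finite set of integers as index set instead of an
  initial segment of the naturals.\<close>

lemma generated_algebra_decompose:
  assumes "f \<in> generated_algebra X (fst ` W)"
  shows "\<exists>I h. finite I \<and> (\<forall>i\<in>I. homogeneous X W i (h i)) \<and> f = (\<lambda>x. \<Sum>i\<in>I. h i x)"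
  using assms
proof induction
  case (const c)
  show ?case
    by (rule exI[of _ "{0}"], rule exI[of _ "\<lambda>_. const_on X c"]) (auto intro: homogeneous.const)
next
  case (gen g)
  then obtain w where "(g, w) \<in> W" by auto
  then show ?case
    by (intro exI[of _ "{w}"] exI[of _ "\<lambda>_. g"]) (auto intro: homogeneous.gen)
next
  case (add f g)
  then obtain I h J k where I: "finite I" "\<And>i. i \<in> I \<Longrightarrow> homogeneous X W i (h i)"
      "f = (\<lambda>x. \<Sum>i\<in>I. h i x)"
    and J: "finite J" "\<And>i. i \<in> J \<Longrightarrow> homogeneous X W i (k i)" "g = (\<lambda>x. \<Sum>i\<in>J. k i x)"
    by blast
  define l where "l i = (if i \<in> I then h i else 0) + (if i \<in> J then k i else 0)" for i
  have "homogeneous X W i (l i)" for i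
    unfolding l_def by (intro homogeneous.add) (auto intro: I J homogeneous.zero)
  moreover have "f + g = (\<lambda>x. \<Sum>i\<in>I \<union> J. l i x)"
  proof
    fix x
    have "(\<Sum>i\<in>I \<union> J. if i \<in> I then h i x else 0) = (\<Sum>i\<in>I. h i x)"
      using I(1) J(1) by (intro sum.mono_neutral_cong_right) auto
    moreover have "(\<Sum>i\<in>I \<union> J. if i \<in> J then k i x else 0) = (\<Sum>i\<in>J. k i x)"
      using I(1) J(1) by (intro sum.mono_neutral_cong_right) auto
    moreover have "l i x = (if i \<in> I then h i x else 0) + (if i \<in> J then k i x else 0)" for i
      by (simp add: l_def)
    ultimately show "(f + g) x = (\<Sum>i\<in>I \<union> J. l i x)"
      by (simp add: I(3) J(3) sum.distrib)
  qed
  ultimately show ?case using I(1) J(1) by blast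
next
  case (mult f g)
  then obtain I h J k where I: "finite I" "\<And>i. i \<in> I \<Longrightarrow> homogeneous X W i (h i)"
      "f = (\<lambda>x. \<Sum>i\<in>I. h i x)"
    and J: "finite J" "\<And>i. i \<in> J \<Longrightarrow> homogeneous X W i (k i)" "g = (\<lambda>x. \<Sum>i\<in>J. k i x)"
    by blast
  define K where "K = (\<lambda>(i, j). i + j) ` (I \<times> J)"
  define l where "l s = (\<lambda>x. \<Sum>(i, j)\<in>{p \<in> I \<times> J. fst p + snd p = s}. h i x * k j x)" for s
  have "homogeneous X W s (l s)" for s
  proof -
    have *: "homogeneous X W s (\<lambda>x. \<Sum>(i, j)\<in>P. h i x * k j x)"
      if "P \<subseteq> {p \<in> I \<times> J. fst p + snd p = s}" "finite P" for P
      using that(2,1)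
    proof induction
      case empty
      show ?case using homogeneous.zero[of X W s] by (simp add: zero_fun_def)
    next
      case (insert p P)
      obtain i j where p: "p = (i, j)" by (cases p)
      have "homogeneous X W s (h i * k j)"
        using homogeneous.mult[OF I(2)[of i] J(2)[of j]] insert.prems p by auto
      then have "homogeneous X W s (h i * k j + (\<lambda>x. \<Sum>(i, j)\<in>P. h i x * k j x))"
        using insert by (intro homogeneous.add) auto
      then show ?case using insert(1,2) p by (simp add: plus_fun_def times_fun_def)
    qed
    show ?thesis unfolding l_def by (rule *) (use I(1) J(1) in auto)
  qed
  moreover have "f * g = (\<lambda>x. \<Sum>s\<in>K. l s x)"
  proof
    fix x
    have "(f * g) x = (\<Sum>p\<in>I \<times> J. h (fst p) x * k (snd p) x)"
      by (simp add: I(3) J(3) sum_product sum.cartesian_product case_prod_unfold)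
    also have "\<dots> = (\<Sum>s\<in>K. \<Sum>p\<in>{p \<in> I \<times> J. fst p + snd p = s}. h (fst p) x * k (snd p) x)"
      using I(1) J(1)
      by (intro sum.group[symmetric]) (auto simp: K_def case_prod_unfold)
    finally show "(f * g) x = (\<Sum>s\<in>K. l s x)"
      by (simp add: l_def case_prod_unfold)
  qed
  moreover have "finite K" using I(1) J(1) by (simp add: K_def)
  ultimately show ?case by blast
qed

text \<open>Multiplication by z^K, where K bounds the modulus of every exponent, gives a polynomial
  with infinitely many zeros.\<close>

lemma laurent_polynomial_eq_0:
  fixes c :: "int \<Rightarrow> complex"
  assumes "finite I" "\<And>z. z \<noteq> 0 \<Longrightarrow> (\<Sum>i\<in>I. z powi i * c i) = 0" "i \<in> I"
  shows "c i = 0"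
proof -
  define K where "K = (\<Sum>i\<in>I. \<bar>i\<bar>)"
  have K: "0 \<le> i + K" if "i \<in> I" for i
    using member_le_sum[of i I abs] assms(1) that by (simp add: K_def)
  define P where "P = (\<Sum>i\<in>I. monom (c i) (nat (i + K)))"
  have "poly P z = 0" if "z \<noteq> 0" for z
  proof -
    have "poly P z = (\<Sum>i\<in>I. z powi K * (z powi i * c i))"
      unfolding P_def poly_sum poly_monom
    proof (intro sum.cong refl)
      fix i assume "i \<in> I"
      then have "z ^ nat (i + K) = z powi (i + K)" using K by (simp add: power_int_def)
      then show "c i * z ^ nat (i + K) = z powi K * (z powi i * c i)"
        using that by (simp add: power_int_add mult_ac)
    qed
    also have "\<dots> = 0" using assms(2)[OF that] by (simp flip: sum_distrib_left)
    finally show ?thesis .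
  qed
  then have "UNIV - {0} \<subseteq> {z. poly P z = 0}" by auto
  moreover have "infinite (UNIV - {0 :: complex})"
    using infinite_UNIV_char_0 by (simp add: infinite_remove)
  ultimately have "P = 0" using poly_roots_finite[of P] finite_subset by blast
  then have "0 = coeff P (nat (i + K))" by simp
  also have "\<dots> = (\<Sum>j\<in>I. if j = i then c j else 0)"
    unfolding P_def coeff_sum using K assms(3)
    by (intro sum.cong refl) (auto simp: nat_eq_iff2)
  also have "\<dots> = c i" using assms(1,3) by simp
  finally show ?thesis by simp
qed

text \<open>Homogeneity is a property of functions here, so uniqueness of the weight needs an
  argument. Decompose f over \<open>W\<close> and compare with f(z x) = z^r f(x) as Laurent
  polynomials in z: f equals its component of weight r, which is built from \<open>W\<close>
  alone.\<close>

lemma homogeneous_component: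
  assumes W: "W \<subseteq> W'" and f: "f \<in> generated_algebra X (fst ` W)" "homogeneous X W' r f"
    and act: "\<And>z x. z \<noteq> 0 \<Longrightarrow> x \<in> X \<Longrightarrow> act z x \<in> X"
    and scale: "\<And>z g w x. (g, w) \<in> W' \<Longrightarrow> z \<noteq> 0 \<Longrightarrow> x \<in> X \<Longrightarrow> g (act z x) = z powi w * g x"
    and out: "\<And>g w x. (g, w) \<in> W' \<Longrightarrow> x \<notin> X \<Longrightarrow> g x = 0"
  shows "homogeneous X W r f"
proof -
  obtain I h where I: "finite I" "\<And>i. i \<in> I \<Longrightarrow> homogeneous X W i (h i)"
      "f = (\<lambda>x. \<Sum>i\<in>I. h i x)"
    using generated_algebra_decompose[OF f(1)] by blast
  define c where "c x i = (if i \<in> I then h i x else 0) - (if i = r then f x else 0)" for x i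
  have "c x r = 0" if "x \<in> X" for x
  proof (rule laurent_polynomial_eq_0[of "insert r I"])
    fix z :: complex assume z: "z \<noteq> 0"
    have "(\<Sum>i\<in>insert r I. z powi i * (if i \<in> I then h i x else 0)) = (\<Sum>i\<in>I. z powi i * h i x)"
      using I(1) by (intro sum.mono_neutral_cong_right) auto
    also have "\<dots> = (\<Sum>i\<in>I. h i (act z x))"
    proof (intro sum.cong refl)
      fix i assume "i \<in> I"
      then show "z powi i * h i x = h i (act z x)"
        using homogeneous_scaling[OF I(2) z that, where act = "act z"] act[OF z] scale[OF _ z] W
        by fastforce
    qed
    also have "\<dots> = f (act z x)" by (simp add: I(3))
    also have "\<dots> = z powi r * f x"
      using homogeneous_scaling[OF f(2) z that, where act = "act z"] act[OF z] scale[OF _ z] by blast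
    finally show "(\<Sum>i\<in>insert r I. z powi i * c x i) = 0"
      using I(1) by (simp add: c_def right_diff_distrib sum_subtractf if_distrib[of "\<lambda>u. _ * u"] cong: if_cong)
  qed (use I(1) in auto)
  then have "f x = (if r \<in> I then h r else 0) x" if "x \<in> X" for x
    using that by (cases "r \<in> I") (simp_all add: c_def)
  moreover have "f x = (if r \<in> I then h r else 0) x" if "x \<notin> X" for x
  proof -
    have "f x = 0" using homogeneous_outside[OF f(2)] out that by metis
    moreover have "h r x = 0" if "r \<in> I"
      using homogeneous_outside[OF I(2)[OF that], of x] out W \<open>x \<notin> X\<close> by blast
    ultimately show ?thesis by simp
  qed
  ultimately have "f = (if r \<in> I then h r else 0)" by blast
  then show ?thesis using I(2) by (auto intro: homogeneous.zero)
qed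


section \<open>The intersection matrix\<close>

lemma ent_mat1: "i \<in> {1..k} \<Longrightarrow> j \<in> {1..k} \<Longrightarrow> ent (mat1 k f) i j = f i j"
  by (auto simp: ent_def mat1_def)

lemma ent_mult:
  assumes "A \<in> carrier_mat k k" "B \<in> carrier_mat k k" "i \<in> {1..k}" "j \<in> {1..k}"
  shows "ent (A * B) i j = (\<Sum>l\<in>{1..k}. ent A i l * ent B l j)"
proof -
  have "ent (A * B) i j = (\<Sum>l\<in>{0..<k}. A $$ (i - 1, l) * B $$ (l, j - 1))"
    using assms by (auto simp: ent_def scalar_prod_def row_def col_def intro!: sum.cong)
  also have "\<dots> = (\<Sum>l\<in>{1..k}. ent A i l * ent B l j)"
    by (rule sum.reindex_bij_witness[where i = "\<lambda>l. l - 1" and j = Suc]) (auto simp: ent_def)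
  finally show ?thesis .
qed

lemma ent_transpose:
  "A \<in> carrier_mat k k \<Longrightarrow> i \<in> {1..k} \<Longrightarrow> j \<in> {1..k} \<Longrightarrow> ent (transpose_mat A) i j = ent A j i"
  by (auto simp: ent_def)

lemma ent_add:
  "A \<in> carrier_mat k k \<Longrightarrow> B \<in> carrier_mat k k \<Longrightarrow> i \<in> {1..k} \<Longrightarrow> j \<in> {1..k} \<Longrightarrow>
    ent (A + B) i j = ent A i j + ent B i j"
  by (auto simp: ent_def)

lemma ent_minus:
  "A \<in> carrier_mat k k \<Longrightarrow> B \<in> carrier_mat k k \<Longrightarrow> i \<in> {1..k} \<Longrightarrow> j \<in> {1..k} \<Longrightarrow>
    ent (A - B) i j = ent A i j - ent B i j"
  by (auto simp: ent_def)

lemma mat_eqI_ent: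
  assumes "A \<in> carrier_mat k k" "B \<in> carrier_mat k k"
    and "\<And>i j. i \<in> {1..k} \<Longrightarrow> j \<in> {1..k} \<Longrightarrow> ent A i j = ent B i j"
  shows "A = B"
proof (rule eq_matI)
  fix i j assume "i < dim_row B" "j < dim_col B"
  then show "A $$ (i, j) = B $$ (i, j)"
    using assms(3)[of "Suc i" "Suc j"] assms(1,2) by (auto simp: ent_def)
qed (use assms in auto)

section \<open>The Gauss-Manin matrix\<close>

lemma Stirling_Suc_self: "Stirling (Suc k) k = Suc k choose 2"
proof (induction k)
  case (Suc k)
  have "Suc (Suc k) choose 2 = (Suc k choose 2) + Suc k"
    by (simp add: numeral_2_eq_2)
  then show ?case using Suc by simp
qed simp

lemma gm_form_carrier [simp]: "gm_form n a b v w \<in> carrier_mat (n + 1) (n + 1)"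
  by (simp add: gm_form_def mat1_def)

text \<open>The corner entry, stated separately in the definition, follows the pattern of the others
  because (m+1)(m+2)/2 - (m+1) = m(m+1)/2. Here m = n, N = n + 2, P = a^(n+1), S = S_2(n+2, n+1),
  and e is the discriminant.\<close>

lemma gm_form_corner:
  fixes a b e m v N P S \<tau> :: complex
  assumes "N \<noteq> 0" "b \<noteq> 0" "e \<noteq> 0" and e: "e = a * P - b" and S: "S = (m + 1) * (m + 2) / 2"
  shows "- S * P / e * v + (m * (m + 1) / 2 * (a * P) + (m + 1) * b) / (N * b * e) * (- N * b * \<tau>)
    = (m + 1) * \<tau> - S * P * (v + a * \<tau>) / e"
proof -
  have "(m * (m + 1) / 2 * (a * P) + (m + 1) * b) / (N * b * e) * (- N * b * \<tau>)
      = - ((m * (m + 1) / 2 * (a * P) + (m + 1) * b) * \<tau> / e)"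
    using assms(1,2) by simp
  then have "- S * P / e * v
        + (m * (m + 1) / 2 * (a * P) + (m + 1) * b) / (N * b * e) * (- N * b * \<tau>)
      = (- S * P * v - (m * (m + 1) / 2 * (a * P) + (m + 1) * b) * \<tau>) / e"
    by (simp add: diff_divide_distrib)
  also have "- S * P * v - (m * (m + 1) / 2 * (a * P) + (m + 1) * b) * \<tau>
      = (m + 1) * \<tau> * e - S * P * (v + a * \<tau>)"
    unfolding e S by (simp add: field_simps)
  finally show ?thesis using assms(3) by (simp add: diff_divide_distrib)
qed

text \<open>The coordinates (\<tau>, \<theta>) on tangent vectors split B. The line \<theta> = 0 is
  tangent to the scaling t_1 -> u t_1, t_{n+2} -> u^(n+2) t_{n+2}, and there B is \<tau> diag(1,
  ..., n+1); \<theta> carries the shift and the last row.\<close>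

lemma ent_gm_form:
  assumes "i \<in> {1..n+1}" "j \<in> {1..n+1}" and nz: "b * (a ^ (n + 2) - b) \<noteq> 0"
    and \<tau>: "\<tau> = - w / (of_nat (n + 2) * b)" and \<theta>: "\<theta> = v + a * \<tau>"
  shows "ent (gm_form n a b v w) i j = (if j = i then of_nat j * \<tau> else 0)
    + (if j = i + 1 then \<theta> else 0)
    - (if i = n + 1 then of_nat (Stirling (n + 2) j) * a ^ j * \<theta> / (a ^ (n + 2) - b) else 0)"
proof -
  obtain N :: complex where N: "of_nat (n + 2) = N" by blast
  obtain e where e: "a ^ (n + 2) - b = e" by blast
  obtain m :: complex where m: "of_nat n = m" by blast
  define S where "S l = (of_nat (Stirling (n + 2) l) :: complex)" for l
  have N0: "N \<noteq> 0" unfolding N[symmetric] of_nat_eq_0_iff by simp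
  have b0: "b \<noteq> 0" and e0: "e \<noteq> 0" using nz e by auto
  have w: "w = - N * b * \<tau>" using b0 N0 unfolding \<tau> N by simp
  have aP: "a ^ (n + 2) = a * a ^ (n + 1)" by simp
  have "Stirling (n + 2) (n + 1) = n + 2 choose 2" using Stirling_Suc_self[of "n + 1"] by simp
  moreover have "2 * (n + 2 choose 2) = (n + 1) * (n + 2)" by (simp add: choose_two)
  ultimately have "2 * Stirling (n + 2) (n + 1) = (n + 1) * (n + 2)" by simp
  then have "of_nat (2 * Stirling (n + 2) (n + 1)) = (of_nat ((n + 1) * (n + 2)) :: complex)"
    by (simp only:)
  then have "2 * S (n + 1) = (m + 1) * (m + 2)"
    unfolding S_def m[symmetric] by (simp only: of_nat_mult of_nat_add of_nat_numeral of_nat_1)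
  then have S: "S (n + 1) = (m + 1) * (m + 2) / 2"
    by (metis nonzero_mult_div_cancel_left zero_neq_numeral)
  have last: "- S (n + 1) * a ^ (n + 1) / e * v
        + (m * (m + 1) / 2 * a ^ (n + 2) + (m + 1) * b) / (N * b * e) * w
      = (m + 1) * \<tau> - S (n + 1) * a ^ (n + 1) * \<theta> / e"
    unfolding w \<theta> aP by (rule gm_form_corner[OF N0 b0 e0 _ S]) (use e aP in simp)
  have x: "v - a / (N * b) * w = \<theta>" using b0 N0 unfolding w \<theta> by simp
  have y: "- T * a ^ j / e * v + T * a ^ (j + 1) / (N * b * e) * w = - (T * a ^ j * \<theta> / e)" for T j
    using b0 N0 e0 unfolding w \<theta> by (simp add: field_simps)
  have z: "- of_nat i / (N * b) * w = of_nat i * \<tau>"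
    using b0 N0 unfolding w by simp
  have "ent (gm_form n a b v w) i j = (if i \<le> n then
          (if j = i then - of_nat i / (N * b) * w
           else if j = i + 1 then v - a / (N * b) * w
           else 0)
        else if j \<le> n then - S j * a ^ j / e * v + S j * a ^ (j + 1) / (N * b * e) * w
        else - S (n + 1) * a ^ (n + 1) / e * v
          + (m * (m + 1) / 2 * a ^ (n + 2) + (m + 1) * b) / (N * b * e) * w)"
    unfolding gm_form_def ent_mat1[OF assms(1,2)] Let_def N e m S_def ..
  also have "\<dots> = (if j = i then of_nat j * \<tau> else 0) + (if j = i + 1 then \<theta> else 0)
    - (if i = n + 1 then S j * a ^ j * \<theta> / e else 0)"
    unfolding x y z last using assms(1,2)
    by (cases "i \<le> n"; cases "j \<le> n") (auto simp: le_Suc_eq m[symmetric])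
  finally show ?thesis by (simp only: e S_def)
qed

lemma sum_mult_gm_form:
  assumes j: "j \<in> {1..n+1}" and nz: "b * (a ^ (n + 2) - b) \<noteq> 0"
    and \<tau>: "\<tau> = - w / (of_nat (n + 2) * b)" and \<theta>: "\<theta> = v + a * \<tau>"
  shows "(\<Sum>l\<in>{1..n+1}. y l * ent (gm_form n a b v w) l j)
    = of_nat j * \<tau> * y j + (if j \<ge> 2 then \<theta> * y (j - 1) else 0)
      - of_nat (Stirling (n + 2) j) * a ^ j * \<theta> / (a ^ (n + 2) - b) * y (n + 1)"
proof -
  let ?T = "of_nat (Stirling (n + 2) j) * a ^ j * \<theta> / (a ^ (n + 2) - b)"
  have "y l * ent (gm_form n a b v w) l j = (if l = j then of_nat j * \<tau> * y l else 0)
      + (if l = j - 1 \<and> j \<ge> 2 then \<theta> * y l else 0) - (if l = n + 1 then ?T * y l else 0)"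
    if l: "l \<in> {1..n+1}" for l
  proof -
    have "j = l + 1 \<longleftrightarrow> l = j - 1 \<and> j \<ge> 2" using l by auto
    then show ?thesis unfolding ent_gm_form[OF l j nz \<tau> \<theta>] by (simp add: distrib_left right_diff_distrib)
  qed
  then have "(\<Sum>l\<in>{1..n+1}. y l * ent (gm_form n a b v w) l j)
      = (\<Sum>l\<in>{1..n+1}. (if l = j then of_nat j * \<tau> * y l else 0)
          + (if l = j - 1 \<and> j \<ge> 2 then \<theta> * y l else 0) - (if l = n + 1 then ?T * y l else 0))"
    by (rule sum.cong[OF refl])
  also have "\<dots> = (\<Sum>l\<in>{1..n+1}. if l = j then of_nat j * \<tau> * y l else 0)
      + (\<Sum>l\<in>{1..n+1}. if l = j - 1 \<and> j \<ge> 2 then \<theta> * y l else 0)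
      - (\<Sum>l\<in>{1..n+1}. if l = n + 1 then ?T * y l else 0)"
    by (simp only: sum.distrib sum_subtractf)
  also have "\<dots> = of_nat j * \<tau> * y j + (if j \<ge> 2 then \<theta> * y (j - 1) else 0) - ?T * y (n + 1)"
    using j by (cases "j \<ge> 2") (auto simp: le_Suc_eq)
  finally show ?thesis .
qed

section \<open>Homogeneous functions of t_1 and t_{n+2}\<close>

definition base_points :: "nat \<Rightarrow> (complex \<times> complex) set" where
  "base_points n = {(a, b). b * (a ^ (n + 2) - b) \<noteq> 0}"

text \<open>The entries of \<Omega> turn out to lie in the algebra of these two generators. It is
  closed under differentiation in t_1, which lowers weights by 1: the derivative of 1/e is -(n+2)
  t_1^(n+1)/e^2 for the discriminant e.\<close>

definition base_gens :: "nat \<Rightarrow> (((complex \<times> complex) \<Rightarrow> complex) \<times> int) set" where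
  "base_gens n = {(restr (base_points n) (\<lambda>(a, b). a), 1),
     (restr (base_points n) (\<lambda>(a, b). 1 / (a ^ (n + 2) - b)), - int (n + 2))}"

lemma base_gens_outside: "(g, w) \<in> base_gens n \<Longrightarrow> x \<notin> base_points n \<Longrightarrow> g x = 0"
  by (auto simp: base_gens_def restr_def)

abbreviation base_hom :: "nat \<Rightarrow> int \<Rightarrow> ((complex \<times> complex) \<Rightarrow> complex) \<Rightarrow> bool" where
  "base_hom n \<equiv> hom_on (base_points n) (base_gens n)"

lemma base_homogeneous_imp_hom:
  assumes "homogeneous (base_points n) (base_gens n) r f"
  shows "base_hom n r f"
proof -
  have "homogeneous (base_points n) (base_gens n) r f \<longleftrightarrow>
      base_hom n r f \<and> (\<forall>x. x \<notin> base_points n \<longrightarrow> f x = 0)"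
    by (rule homogeneous_iff_hom_on) (rule base_gens_outside)
  then show ?thesis using assms by simp
qed

lemma base_hom_gens:
  "base_hom n 1 (\<lambda>(a, b). a)" "base_hom n (- int (n + 2)) (\<lambda>(a, b). 1 / (a ^ (n + 2) - b))"
  unfolding hom_on_def by (rule homogeneous.gen, simp add: base_gens_def)+

lemma eventually_base_points:
  assumes "(a, b) \<in> base_points n"
  shows "\<forall>\<^sub>F z in nhds a. (z, b) \<in> base_points n"
proof -
  have "open {z. z ^ (n + 2) \<noteq> b}"
    by (intro open_Collect_neq continuous_intros)
  then have "\<forall>\<^sub>F z in nhds a. z \<in> {z. z ^ (n + 2) \<noteq> b}"
    using assms by (intro eventually_nhds_in_open) (auto simp: base_points_def)
  then show ?thesis using assms by (auto simp: base_points_def elim!: eventually_mono)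
qed

lemma base_has_derivative:
  assumes "(a, b) \<in> base_points n" "(g has_field_derivative l) (at a)"
    "\<And>z. (z, b) \<in> base_points n \<Longrightarrow> f (z, b) = g z"
  shows "((\<lambda>z. f (z, b)) has_field_derivative l) (at a)"
proof -
  have "\<forall>\<^sub>F z in nhds a. f (z, b) = g z"
    using eventually_base_points[OF assms(1)] by (rule eventually_mono) (rule assms(3))
  from DERIV_cong_ev[OF refl this refl, of l] assms(2) show ?thesis by blast
qed

lemma base_homogeneous_derivative:
  assumes "homogeneous (base_points n) (base_gens n) r f"
  shows "\<exists>f'. base_hom n (r - 1) f' \<and>
    (\<forall>a b. (a, b) \<in> base_points n \<longrightarrow> ((\<lambda>z. f (z, b)) has_field_derivative f' (a, b)) (at a))"
  using assms
proof induction
  case (zero r)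
  show ?case by (rule exI[of _ "\<lambda>_. 0"]) (simp add: hom_on_zero)
next
  case (const c)
  show ?case
  proof (intro exI[of _ "\<lambda>_. 0"] conjI allI impI)
    fix a b :: complex assume ab: "(a, b) \<in> base_points n"
    show "((\<lambda>z. const_on (base_points n) c (z, b)) has_field_derivative 0) (at a)"
      by (rule base_has_derivative[OF ab DERIV_const[of c]]) (simp add: const_on_def)
  qed (rule hom_on_zero)
next
  case (gen g w)
  let ?\<Delta> = "\<lambda>(a, b). 1 / (a ^ (n + 2) - b) :: complex"
  consider "g = restr (base_points n) (\<lambda>(a, b). a)" "w = 1"
    | "g = restr (base_points n) ?\<Delta>" "w = - int (n + 2)"
    using gen by (auto simp: base_gens_def)
  then show ?case
  proof cases
    case 1
    show ?thesis
    proof (intro exI[of _ "\<lambda>_. 1"] conjI allI impI)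
      fix a b :: complex assume ab: "(a, b) \<in> base_points n"
      show "((\<lambda>z. g (z, b)) has_field_derivative 1) (at a)"
        by (rule base_has_derivative[OF ab DERIV_ident]) (simp add: 1 restr_def)
    qed (use hom_on_const[of _ _ 1] 1 in simp)
  next
    case 2
    show ?thesis
    proof (intro exI[of _ "\<lambda>p. - of_nat (n + 2) * ((\<lambda>(a, b). a) p ^ (n + 1) * ?\<Delta> p ^ 2)"] conjI allI impI)
      have "base_hom n (int (n + 1) * 1 + int 2 * - int (n + 2)) (\<lambda>p. (\<lambda>(a, b). a) p ^ (n + 1) * ?\<Delta> p ^ 2)"
        by (intro hom_on_mult hom_on_power base_hom_gens)
      from hom_on_scale[OF this, of "- of_nat (n + 2)"]
      show "base_hom n (w - 1) (\<lambda>p. - of_nat (n + 2) * ((\<lambda>(a, b). a) p ^ (n + 1) * ?\<Delta> p ^ 2))"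
        by (simp add: 2 algebra_simps)
      fix a b :: complex assume ab: "(a, b) \<in> base_points n"
      then have nz: "a ^ (n + 2) - b \<noteq> 0" by (auto simp: base_points_def)
      have "((\<lambda>z. z ^ (n + 2) - b) has_field_derivative of_nat (n + 2) * a ^ (n + 1)) (at a)"
        using DERIV_diff[OF DERIV_power[OF DERIV_ident, where n = "n + 2" and x = a and s = UNIV] DERIV_const[of b]] by simp
      from DERIV_inverse_fun[OF this nz]
      have d: "((\<lambda>z. inverse (z ^ (n + 2) - b)) has_field_derivative
          - (of_nat (n + 2) * a ^ (n + 1) * inverse ((a ^ (n + 2) - b) ^ Suc (Suc 0)))) (at a)" .
      have "- (k * P * inverse (e ^ Suc (Suc 0))) = - k * (P * (1 / e)\<^sup>2)" for k P e :: complex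
        by (simp add: power2_eq_square inverse_eq_divide)
      from d[unfolded this] have "((\<lambda>z. 1 / (z ^ (n + 2) - b)) has_field_derivative
          - of_nat (n + 2) * (a ^ (n + 1) * (1 / (a ^ (n + 2) - b)) ^ 2)) (at a)"
        by (simp only: inverse_eq_divide)
      then show "((\<lambda>z. g (z, b)) has_field_derivative
          - of_nat (n + 2) * ((\<lambda>(a, b). a) (a, b) ^ (n + 1) * ?\<Delta> (a, b) ^ 2)) (at a)"
        unfolding prod.case by (rule base_has_derivative[OF ab]) (simp add: 2 restr_def)
    qed
  qed
next
  case (add r f g)
  then obtain f' g' where f': "base_hom n (r - 1) f'" "base_hom n (r - 1) g'"
    "\<And>a b. (a, b) \<in> base_points n \<Longrightarrow> ((\<lambda>z. f (z, b)) has_field_derivative f' (a, b)) (at a)"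
    "\<And>a b. (a, b) \<in> base_points n \<Longrightarrow> ((\<lambda>z. g (z, b)) has_field_derivative g' (a, b)) (at a)"
    by blast
  show ?case
    by (intro exI[of _ "\<lambda>p. f' p + g' p"] conjI allI impI hom_on_add f'(1,2))
       (auto intro!: DERIV_add f'(3,4))
next
  case (mult r f s g)
  then obtain f' g' where f': "base_hom n (r - 1) f'" "base_hom n (s - 1) g'"
    "\<And>a b. (a, b) \<in> base_points n \<Longrightarrow> ((\<lambda>z. f (z, b)) has_field_derivative f' (a, b)) (at a)"
    "\<And>a b. (a, b) \<in> base_points n \<Longrightarrow> ((\<lambda>z. g (z, b)) has_field_derivative g' (a, b)) (at a)"
    by blast
  have fg: "base_hom n r f" "base_hom n s g"
    using mult.hyps by (auto dest: base_homogeneous_imp_hom)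
  show ?case
  proof (intro exI[of _ "\<lambda>p. f' p * g p + g' p * f p"] conjI allI impI hom_on_add)
    show "base_hom n (r + s - 1) (\<lambda>p. f' p * g p)"
      by (rule hom_on_mult'[OF f'(1) fg(2)]) simp
    show "base_hom n (r + s - 1) (\<lambda>p. g' p * f p)"
      by (rule hom_on_mult'[OF f'(2) fg(1)]) simp
    fix a b :: complex assume ab: "(a, b) \<in> base_points n"
    show "((\<lambda>z. (f * g) (z, b)) has_field_derivative f' (a, b) * g (a, b) + g' (a, b) * f (a, b)) (at a)"
      using DERIV_mult[OF f'(3)[OF ab] f'(4)[OF ab]] by simp
  qed
qed

text \<open>\<open>f'\<close> is whatever expression the derivative is known to have; uniqueness of
  derivatives transfers the homogeneity to it.\<close>

lemma base_hom_derivative: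
  assumes f: "base_hom n r f"
    and f': "\<And>a b. (a, b) \<in> base_points n \<Longrightarrow> ((\<lambda>z. f (z, b)) has_field_derivative f' (a, b)) (at a)"
  shows "base_hom n (r - 1) f'"
proof -
  obtain g where g: "base_hom n (r - 1) g"
    "\<And>a b. (a, b) \<in> base_points n \<Longrightarrow>
      ((\<lambda>z. restr (base_points n) f (z, b)) has_field_derivative g (a, b)) (at a)"
    using base_homogeneous_derivative[OF f[unfolded hom_on_def]] by blast
  show ?thesis
  proof (rule hom_onI[OF g(1)])
    fix p assume p: "p \<in> base_points n"
    obtain a b where ab: "p = (a, b)" by (cases p)
    have ab': "(a, b) \<in> base_points n" using p ab by simp
    have "((\<lambda>z. restr (base_points n) f (z, b)) has_field_derivative f' (a, b)) (at a)"
      by (rule base_has_derivative[OF ab' f'[OF ab']]) (simp add: restr_def)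
    from DERIV_unique[OF g(2)[OF ab'] this] show "g p = f' p" by (simp add: ab)
  qed simp
qed

section \<open>The entries of the intersection matrix\<close>

context
  fixes n :: nat and c :: complex and \<Omega> :: "complex \<Rightarrow> complex \<Rightarrow> complex mat"
  assumes \<Omega>: "intersection_matrix n c \<Omega>"
begin

lemma Omega_conditions:
  assumes "(a, b) \<in> base_points n"
  shows "\<Omega> a b \<in> carrier_mat (n + 1) (n + 1)"
    and "\<lbrakk>i \<in> {1..n+1}; j \<in> {1..n+1}; i + j \<le> n + 1\<rbrakk> \<Longrightarrow> ent (\<Omega> a b) i j = 0"
    and "ent (\<Omega> a b) 1 (n + 1) = (- of_nat (n + 2)) ^ n * c / (a ^ (n + 2) - b)"
    and "i \<in> {1..n+1} \<Longrightarrow> ent (\<Omega> a b) i (n + 2 - i) = (- 1) ^ (i - 1) * ent (\<Omega> a b) 1 (n + 1)"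
    and "\<lbrakk>i \<in> {1..n+1}; j \<in> {1..n+1}\<rbrakk> \<Longrightarrow> ((\<lambda>z. ent (\<Omega> z b) i j) has_field_derivative
      ent (gm_form n a b 1 0 * \<Omega> a b + \<Omega> a b * transpose_mat (gm_form n a b 1 0)) i j) (at a)"
proof -
  have "b * (a ^ (n + 2) - b) \<noteq> 0" using assms by (simp add: base_points_def)
  note body = \<Omega>[unfolded intersection_matrix_def, THEN spec, THEN spec, THEN mp, OF this]
  note body2 = body[THEN conjunct2, THEN conjunct2]
  show "\<Omega> a b \<in> carrier_mat (n + 1) (n + 1)" by (rule body[THEN conjunct1])
  show "ent (\<Omega> a b) i j = 0" if "i \<in> {1..n+1}" "j \<in> {1..n+1}" "i + j \<le> n + 1"
    by (rule body2[THEN conjunct1, THEN bspec, THEN bspec, THEN mp, OF that])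
  show "ent (\<Omega> a b) 1 (n + 1) = (- of_nat (n + 2)) ^ n * c / (a ^ (n + 2) - b)"
    by (rule body2[THEN conjunct2, THEN conjunct1])
  show "ent (\<Omega> a b) i (n + 2 - i) = (- 1) ^ (i - 1) * ent (\<Omega> a b) 1 (n + 1)" if "i \<in> {1..n+1}"
    by (rule body2[THEN conjunct2, THEN conjunct2, THEN conjunct1, THEN bspec, OF that])
  show "((\<lambda>z. ent (\<Omega> z b) i j) has_field_derivative
      ent (gm_form n a b 1 0 * \<Omega> a b + \<Omega> a b * transpose_mat (gm_form n a b 1 0)) i j) (at a)"
    if "i \<in> {1..n+1}" "j \<in> {1..n+1}"
    by (rule body2[THEN conjunct2, THEN conjunct2, THEN conjunct2, THEN conjunct1,
          THEN bspec, THEN bspec, OF that])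
qed

lemmas Omega_carrier = Omega_conditions(1) and Omega_zero = Omega_conditions(2)

lemma Omega_antidiagonal:
  assumes "(a, b) \<in> base_points n" "i \<in> {1..n+1}"
  shows "ent (\<Omega> a b) i (n + 2 - i)
    = (- 1) ^ (i - 1) * ((- of_nat (n + 2)) ^ n * c) * (1 / (a ^ (n + 2) - b))"
  unfolding Omega_conditions(4)[OF assms] Omega_conditions(3)[OF assms(1)]
  by (simp only: times_divide_eq_right mult_1_right mult.assoc)

text \<open>For dt_1 = 1 and dt_{n+2} = 0 one has \<tau> = 0 and \<theta> = 1. Row j of B is a mere
  shift for j \<le> n, so the Stirling numbers enter only through the row index i = n + 1.\<close>

lemma Omega_derivative:
  assumes ab: "(a, b) \<in> base_points n" and ij: "i \<in> {1..n+1}" "j \<in> {1..n}"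
  shows "((\<lambda>z. ent (\<Omega> z b) i j) has_field_derivative
    ent (\<Omega> a b) i (j + 1) + (if i \<le> n then ent (\<Omega> a b) (i + 1) j
      else - (\<Sum>l\<in>{1..n+1}. of_nat (Stirling (n + 2) l) * (a ^ l * (1 / (a ^ (n + 2) - b)))
          * ent (\<Omega> a b) l j))) (at a)"
proof -
  have nz: "b * (a ^ (n + 2) - b) \<noteq> 0" using ab by (simp add: base_points_def)
  have j: "j \<in> {1..n+1}" using ij by auto
  note car = Omega_carrier[OF ab]
  let ?B = "gm_form n a b 1 0" and ?O = "ent (\<Omega> a b)"
  have B: "ent ?B k l = (if l = k + 1 then 1 else 0)
      - (if k = n + 1 then of_nat (Stirling (n + 2) l) * a ^ l / (a ^ (n + 2) - b) else 0)"
    if "k \<in> {1..n+1}" "l \<in> {1..n+1}" for k l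
    using ent_gm_form[OF that nz, of 0 0 1 1] by simp
  have "((\<lambda>z. ent (\<Omega> z b) i j) has_field_derivative
      ent (?B * \<Omega> a b + \<Omega> a b * transpose_mat ?B) i j) (at a)"
    by (rule Omega_conditions(5)[OF ab ij(1) j])
  also have "ent (?B * \<Omega> a b + \<Omega> a b * transpose_mat ?B) i j
      = (\<Sum>l\<in>{1..n+1}. ent ?B i l * ?O l j) + (\<Sum>l\<in>{1..n+1}. ?O i l * ent ?B j l)"
  proof -
    have ct: "transpose_mat ?B \<in> carrier_mat (n + 1) (n + 1)" by (simp only: transpose_carrier_mat gm_form_carrier)
    have "(\<Sum>l\<in>{1..n+1}. ?O i l * ent (transpose_mat ?B) l j) = (\<Sum>l\<in>{1..n+1}. ?O i l * ent ?B j l)"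
      by (rule sum.cong[OF refl]) (simp only: ent_transpose[OF gm_form_carrier _ j])
    then show ?thesis
      unfolding ent_add[OF mult_carrier_mat[OF gm_form_carrier car] mult_carrier_mat[OF car ct] ij(1) j]
        ent_mult[OF gm_form_carrier car ij(1) j] ent_mult[OF car ct ij(1) j] by (simp only:)
  qed
  also have "(\<Sum>l\<in>{1..n+1}. ?O i l * ent ?B j l) = (\<Sum>l\<in>{1..n+1}. if l = j + 1 then ?O i (j + 1) else 0)"
    using ij j by (intro sum.cong refl) (auto simp: B)
  also have "\<dots> = ?O i (j + 1)" using ij by simp
  also have "(\<Sum>l\<in>{1..n+1}. ent ?B i l * ?O l j) = (if i \<le> n then ?O (i + 1) j
      else - (\<Sum>l\<in>{1..n+1}. of_nat (Stirling (n + 2) l) * (a ^ l * (1 / (a ^ (n + 2) - b))) * ?O l j))"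
  proof (cases "i \<le> n")
    case True
    then have "(\<Sum>l\<in>{1..n+1}. ent ?B i l * ?O l j) = (\<Sum>l\<in>{1..n+1}. if l = i + 1 then ?O (i + 1) j else 0)"
      using ij j by (intro sum.cong refl) (auto simp: B)
    then show ?thesis using True by simp
  next
    case False
    then have i: "i = n + 1" using ij by auto
    show ?thesis using i ij by (simp add: B sum_negf[symmetric] del: sum_negf Stirling.simps)
  qed
  finally show ?thesis by (simp only: add.commute)
qed

text \<open>The entries on and below the antidiagonal are recovered from \<open>d\<Omega> = B \<Omega> + \<Omega> B\<^sup>t\<^sup>r\<close> along
  \<open>dt\<^sub>1\<close> alone: the relation expresses each antidiagonal through the previous one.\<close>

lemma Omega_base_hom:
  assumes "i \<in> {1..n+1}" "j \<in> {1..n+1}"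
  shows "base_hom n (- int (i + j)) (\<lambda>(a, b). ent (\<Omega> a b) i j)"
  using assms
proof (induction "i + j" arbitrary: i j rule: less_induct)
  case less
  note IH = less.hyps
  show ?case
  proof (cases "i + j \<le> n + 2")
    case True
    show ?thesis
    proof (cases "i + j = n + 2")
      case True
      then have j: "j = n + 2 - i" by simp
      have "base_hom n (- int (n + 2))
          (\<lambda>p. ((- 1) ^ (i - 1) * ((- of_nat (n + 2)) ^ n * c)) * (\<lambda>(a, b). 1 / (a ^ (n + 2) - b)) p)"
        by (intro hom_on_scale base_hom_gens)
      then show ?thesis
        by (rule hom_onI)
          (use True Omega_antidiagonal[OF _ less.prems(1)] in \<open>auto simp only: j prod.case\<close>)
    next
      case False
      with True have "i + j \<le> n + 1" by simp
      then show ?thesis using less.prems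
        by (intro hom_onI[OF hom_on_zero]) (auto simp: Omega_zero)
    qed
  next
    case False
    define s where "s = i + j"
    \<comment> \<open>The antidiagonal i + j = s is climbed from the bottom. The derivative of the
      entry (n+1, l) of the previous antidiagonal yields (n+1, l+1); that of (k, l) is (k, l+1) +
      (k+1, l), whose second summand is already known.\<close>
    have "base_hom n (- int s) (\<lambda>(a, b). ent (\<Omega> a b) k (s - k))"
      if "k \<le> n + 1" "i \<le> k" for k
      using that
    proof (induction rule: inc_induct)
      case base
      define l where "l = s - (n + 2)"
      have l: "l \<in> {1..n}" "s - (n + 1) = l + 1" "s = n + l + 2"
        using less.prems False by (auto simp: l_def s_def)
      have prev: "base_hom n (- int (n + 1 + l)) (\<lambda>(a, b). ent (\<Omega> a b) (n + 1) l)"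
        using IH[of "n + 1" l] l by (simp add: s_def)
      have prev': "base_hom n (- int (k + l)) (\<lambda>(a, b). ent (\<Omega> a b) k l)" if "k \<in> {1..n+1}" for k
        using IH[of k l] l that by (simp add: s_def)
      have "base_hom n (- int (n + 1 + l) - 1) (\<lambda>p. (\<lambda>(a, b). ent (\<Omega> a b) (n + 1) (l + 1)) p
          - (\<Sum>k\<in>{1..n+1}. of_nat (Stirling (n + 2) k)
            * ((\<lambda>(a, b). a) p ^ k * (\<lambda>(a, b). 1 / (a ^ (n + 2) - b)) p)
            * (\<lambda>(a, b). ent (\<Omega> a b) k l) p))"
        by (rule base_hom_derivative[OF prev])
           (use Omega_derivative[of _ _ "n + 1" l] l in \<open>simp add: algebra_simps del: Stirling.simps\<close>)
      moreover have "base_hom n (- int (n + 1 + l) - 1) (\<lambda>p. \<Sum>k\<in>{1..n+1}. of_nat (Stirling (n + 2) k)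
            * ((\<lambda>(a, b). a) p ^ k * (\<lambda>(a, b). 1 / (a ^ (n + 2) - b)) p)
            * (\<lambda>(a, b). ent (\<Omega> a b) k l) p)"
      proof (rule hom_on_sum)
        fix k assume k: "k \<in> {1..n+1}"
        show "base_hom n (- int (n + 1 + l) - 1) (\<lambda>p. of_nat (Stirling (n + 2) k)
            * ((\<lambda>(a, b). a) p ^ k * (\<lambda>(a, b). 1 / (a ^ (n + 2) - b)) p)
            * (\<lambda>(a, b). ent (\<Omega> a b) k l) p)"
          by (rule hom_on_mult'[OF hom_on_scale[OF hom_on_mult[OF hom_on_power[OF base_hom_gens(1)]
                base_hom_gens(2)]] prev'[OF k]]) simp
      qed
      ultimately have "base_hom n (- int (n + 1 + l) - 1) (\<lambda>p. (\<lambda>(a, b). ent (\<Omega> a b) (n + 1) (l + 1)) p)"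
        by (drule_tac hom_on_add) (assumption, simp)
      then show ?case by (rule hom_onI) (use l in auto)
    next
      case (step k)
      define l where "l = s - k - 1"
      have l: "l \<in> {1..n}" "s - k = l + 1" "s - Suc k = l" "s = k + l + 1" and k: "k \<in> {1..n}"
        using less.prems False step.hyps step.prems by (auto simp: l_def s_def)
      have eq: "- int (k + l) - 1 = - int s" using l by simp
      have prev: "base_hom n (- int (k + l)) (\<lambda>(a, b). ent (\<Omega> a b) k l)"
        using IH[of k l] l k by (simp add: s_def)
      have "base_hom n (- int (k + l) - 1)
          (\<lambda>p. (\<lambda>(a, b). ent (\<Omega> a b) k (l + 1)) p + (\<lambda>(a, b). ent (\<Omega> a b) (k + 1) l) p)"
        by (rule base_hom_derivative[OF prev]) (use Omega_derivative[of _ _ k l] l k in simp)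
      moreover have "base_hom n (- int (k + l) - 1) (\<lambda>(a, b). ent (\<Omega> a b) (k + 1) l)"
        using step.IH step.prems l unfolding eq by simp
      ultimately have "base_hom n (- int (k + l) - 1) (\<lambda>p. (\<lambda>(a, b). ent (\<Omega> a b) k (l + 1)) p)"
        by (drule_tac hom_on_diff) (assumption, simp)
      then show ?case by (rule hom_onI) (use l in auto)
    qed
    from this[of i] less.prems show ?thesis by (simp add: s_def)
  qed
qed

end


section \<open>The chart\<close>

lemma moduli_dim_eq: "moduli_dim n = half_dim n * (half_dim n + 1) + 1"
proof (cases "odd n")
  case True
  then obtain k where n: "n = 2 * k + 1" by (rule oddE)
  have "(n + 1) * (n + 3) = 4 * ((k + 1) * (k + 2))" by (simp add: n algebra_simps)
  then have "(n + 1) * (n + 3) div 4 = (k + 1) * (k + 2)" by simp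
  moreover have "half_dim n = k + 1" by (simp add: n half_dim_def)
  ultimately show ?thesis using True by (simp add: moduli_dim_def)
next
  case False
  then obtain k where n: "n = 2 * k" by (auto elim: evenE)
  have "n * (n + 2) = 4 * (k * (k + 1))" by (simp add: n algebra_simps)
  then have "n * (n + 2) div 4 = k * (k + 1)" by simp
  then show ?thesis using False by (simp add: moduli_dim_def n half_dim_def)
qed

lemma half_dim_cases: "if odd n then n + 1 = 2 * half_dim n else n = 2 * half_dim n"
  by (auto simp: half_dim_def)

text \<open>For both parities of n the chart condition reads i + k \<le> 2q + 1 with q =
  \<open>half_dim n\<close>.\<close>

definition chart_row :: "nat \<Rightarrow> nat \<Rightarrow> (nat \<times> nat) list" where
  "chart_row n i = map (Pair i) [1..<min i (2 * half_dim n + 1 - i) + 1]"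

lemma filter_upt_le: "filter (\<lambda>j. i + j \<le> B) [1..<k + 1] = [1..<min k (B - i) + 1]"
  if "i \<le> B" for B :: nat
proof (induction k)
  case (Suc k)
  show ?case
  proof (cases "i + Suc k \<le> B")
    case True
    then have "min (Suc k) (B - i) = Suc k" "min k (B - i) = k" by auto
    then show ?thesis using Suc True by simp
  next
    case False
    then have "min (Suc k) (B - i) = B - i" "min k (B - i) = B - i" using that by auto
    then show ?thesis using Suc False by simp
  qed
qed simp

lemma chart_positions_rows:
  assumes "n \<ge> 1"
  shows "chart_positions n = concat (map (chart_row n) [2..<n + 2])"
proof -
  have row: "concat (map (\<lambda>j. if (if odd n then i + j \<le> n + 2 else i + j < n + 2) then [(i, j)] else []) [1..<i + 1])
      = chart_row n i" if "i \<in> {2..<n + 2}" for i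
  proof -
    have 1: "(if odd n then i + j \<le> n + 2 else i + j < n + 2) \<longleftrightarrow> i + j \<le> 2 * half_dim n + 1" for j
      using half_dim_cases[of n] by (auto split: if_splits)
    have 2: "concat (map (\<lambda>j. if P j then [(i, j)] else []) xs) = map (Pair i) (filter P xs)" for P xs
      by (induction xs) auto
    have 3: "i \<le> 2 * half_dim n + 1" using that half_dim_cases[of n] by (auto split: if_splits)
    show ?thesis unfolding 1 2 chart_row_def filter_upt_le[OF 3] ..
  qed
  show ?thesis unfolding chart_positions_def
    by (intro arg_cong[where f = concat] map_cong refl row) auto
qed

text \<open>Two triangles of q(q+1)/2 entries each, exchanged by i -> 2q + 1 - i.\<close>

lemma sum_min_reflect: "(\<Sum>i = 1..2 * q. min i (2 * q + 1 - i)) = q * (q + 1)" for q :: nat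
proof -
  have "(\<Sum>i = 1..2 * q. min i (2 * q + 1 - i)) = (\<Sum>i = 1..q. i) + (\<Sum>i = q + 1..2 * q. 2 * q + 1 - i)"
    by (subst sum.ub_add_nat[of 1 q _ q, unfolded mult_2[symmetric]])
      (auto intro!: arg_cong2[where f = "(+)"] sum.cong)
  also have "(\<Sum>i = q + 1..2 * q. 2 * q + 1 - i) = (\<Sum>i = 1..q. i)"
    by (rule sum.reindex_bij_witness[where i = "\<lambda>i. 2 * q + 1 - i" and j = "\<lambda>i. 2 * q + 1 - i"]) auto
  also have "(\<Sum>i = 1..q. i) + (\<Sum>i = 1..q. i) = q * (q + 1)"
    using double_gauss_sum_from_Suc_0[of q, where ?'a = nat] by (simp add: mult_2)
  finally show ?thesis .
qed

text \<open>The triangle sum q(q+1) includes the entry (1,1), which is not listed; t_1 and t_{n+2}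
  are not entries of S. Thus q(q+1) - 1 + 2 = d.\<close>

lemma length_chart_positions:
  assumes "n \<ge> 1"
  shows "length (chart_positions n) + 2 = moduli_dim n"
proof -
  define q where "q = half_dim n"
  have q: "q \<ge> 1" using assms half_dim_cases[of n] by (auto simp: q_def split: if_splits)
  have "length (chart_positions n) = (\<Sum>i\<in>{2..<n + 2}. min i (2 * q + 1 - i))"
  proof -
    have "length (chart_row n i) = min i (2 * q + 1 - i)" for i 
      by (simp only: chart_row_def q_def length_map length_upt diff_add_inverse2)
    then show ?thesis
      unfolding chart_positions_rows[OF assms] length_concat map_map o_def
      by (simp only: interv_sum_list_conv_sum_set_nat set_upt)
  qed
  also have "\<dots> = (\<Sum>i\<in>{2..2 * q}. min i (2 * q + 1 - i))"
    using half_dim_cases[of n] by (intro sum.mono_neutral_right) (auto simp: q_def split: if_splits)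
  also have "\<dots> + 1 = (\<Sum>i = 1..2 * q. min i (2 * q + 1 - i))"
    using q sum.atLeast_Suc_atMost[of 1 "2 * q" "\<lambda>i. min i (2 * q + 1 - i)"]
    by (simp add: numeral_2_eq_2)
  also have "\<dots> = q * (q + 1)" by (rule sum_min_reflect)
  finally show ?thesis by (simp add: moduli_dim_eq q_def)
qed

lemma set_chart_row:
  "(i', k) \<in> set (chart_row n i) \<longleftrightarrow> i' = i \<and> 1 \<le> k \<and> k \<le> i \<and> i + k \<le> 2 * half_dim n + 1"
  by (auto simp: chart_row_def simp del: upt_Suc)

lemma set_chart_positions:
  assumes "n \<ge> 1"
  shows "(i, k) \<in> set (chart_positions n)
    \<longleftrightarrow> 2 \<le> i \<and> i \<le> n + 1 \<and> 1 \<le> k \<and> k \<le> i \<and> i + k \<le> 2 * half_dim n + 1"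
  unfolding chart_positions_rows[OF assms]
  by (auto simp: set_chart_row simp del: upt_Suc)

lemma distinct_concat_map:
  assumes "distinct xs" "\<And>x. distinct (f x)" "\<And>x y. x \<noteq> y \<Longrightarrow> set (f x) \<inter> set (f y) = {}"
  shows "distinct (concat (map f xs))"
  using assms(1)
proof (induction xs)
  case (Cons x xs)
  then have "set (f x) \<inter> set (f y) = {}" if "y \<in> set xs" for y
    using assms(3)[of x y] that by auto
  with Cons show ?case using assms(2) by auto
qed simp

lemma distinct_chart_positions:
  assumes "n \<ge> 1"
  shows "distinct (chart_positions n)"
  unfolding chart_positions_rows[OF assms]
proof (rule distinct_concat_map)
  show "set (chart_row n x) \<inter> set (chart_row n y) = {}" if "x \<noteq> y" for x y
    using that by (auto simp: set_chart_row)
qed (simp_all add: chart_row_def distinct_map inj_on_def del: upt_Suc)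

lemma hd_chart_positions:
  assumes "n \<ge> 1"
  shows "chart_positions n ! 0 = (2, 1)"
proof -
  have "half_dim n \<ge> 1" using assms half_dim_cases[of n] by (auto split: if_splits)
  then have "chart_row n 2 ! 0 = (2, 1)" "chart_row n 2 \<noteq> []"
    by (auto simp: chart_row_def nth_append upt_rec[of 1])
  moreover have "[2..<n + 2] = 2 # [3..<n + 2]" using assms by (simp add: upt_rec[of 2] numeral_3_eq_3)
  ultimately show ?thesis unfolding chart_positions_rows[OF assms]
    by (simp add: nth_append)
qed

lemma last_chart_positions:
  assumes "odd n" "n \<ge> 3"
  shows "chart_positions n ! (moduli_dim n - 3) = (n + 1, 1)"
    and "chart_positions n ! (moduli_dim n - 5) = (n, 1)"
proof -
  have n: "n \<ge> 1" using assms by simp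
  have q: "n + 1 = 2 * half_dim n" using half_dim_cases[of n] assms by simp
  have "[2..<n + 2] = [2..<n] @ [n, n + 1]" using assms by (simp add: upt_conv_Cons)
  moreover have "chart_row n n = [(n, 1), (n, 2)]" "chart_row n (n + 1) = [(n + 1, 1)]"
    using assms q[symmetric] by (simp_all add: chart_row_def min_def upt_rec numeral_2_eq_2)
  ultimately obtain xs where xs: "chart_positions n = xs @ [(n, 1), (n, 2), (n + 1, 1)]"
    unfolding chart_positions_rows[OF n] by simp
  have "length xs + 5 = moduli_dim n" using length_chart_positions[OF n] xs by simp
  then have "moduli_dim n - 3 = length xs + 2" "moduli_dim n - 5 = length xs" by simp_all
  then show "chart_positions n ! (moduli_dim n - 3) = (n + 1, 1)"
    "chart_positions n ! (moduli_dim n - 5) = (n, 1)"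
    by (simp_all only: xs) (simp_all add: nth_append)
qed

lemma moduli_dim_ge:
  assumes "n \<ge> 3"
  shows "n + 2 < moduli_dim n"
proof -
  define q where "q = half_dim n"
  have q: "n \<le> 2 * q" "q \<ge> 2" using half_dim_cases[of n] assms by (auto simp: q_def split: if_splits)
  have "2 * (q + 1) \<le> q * (q + 1)" using q(2) by (rule mult_right_mono) simp
  moreover have "n + 2 \<le> 2 * (q + 1)" using q(1) by simp
  ultimately have "n + 2 \<le> q * (q + 1)" by (rule order_trans[rotated])
  then show ?thesis unfolding moduli_dim_eq q_def[symmetric] by simp
qed

section \<open>The coordinates that are entries of S\<close>

definition inner_indices :: "nat \<Rightarrow> nat set" where
  "inner_indices n = chart_indices n - {1, n + 2}"

lemma inner_indices_eq:
  assumes "n \<ge> 1"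
  shows "inner_indices n = (if n \<le> 2 then {2} else {2..moduli_dim n} - {n + 2})"
proof -
  consider "n = 1" | "n = 2" | "n \<ge> 3" using assms by linarith
  then show ?thesis
  proof cases
    case 1
    then show ?thesis by (auto simp: inner_indices_def chart_indices_def moduli_dim_def)
  qed (auto simp: inner_indices_def chart_indices_def)
qed

lemma finite_inner_indices: "n \<ge> 1 \<Longrightarrow> finite (inner_indices n)"
  by (simp add: inner_indices_eq)

lemma chart_indices_eq:
  assumes "n \<ge> 1"
  shows "chart_indices n = insert 1 (insert (n + 2) (inner_indices n))"
proof -
  consider "n = 1" | "n = 2" | "n \<ge> 3" using assms by linarith
  then have "1 \<in> chart_indices n \<and> n + 2 \<in> chart_indices n"
  proof cases
    case 3
    then show ?thesis using moduli_dim_ge[OF 3] by (simp add: chart_indices_def)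
  qed (simp_all add: chart_indices_def moduli_dim_def)
  then show ?thesis by (auto simp: inner_indices_def)
qed

lemma chart_pos_bij:
  assumes "n \<ge> 1"
  shows "bij_betw (chart_pos n) (inner_indices n) (set (chart_positions n))"
proof -
  let ?idx = "\<lambda>j. if j < n + 2 then j - 2 else j - 3"
  have "bij_betw ?idx (inner_indices n) {..<length (chart_positions n)}"
  proof (cases "n \<le> 2")
    case True
    then have "n = 1 \<or> n = 2" using assms by auto
    then have "length (chart_positions n) = 1"
      using length_chart_positions[OF assms] by (auto simp: moduli_dim_def)
    then show ?thesis using True assms
      by (auto simp: inner_indices_eq bij_betw_def)
  next
    case False
    then have len: "length (chart_positions n) = moduli_dim n - 2" "n + 2 < moduli_dim n"
      using length_chart_positions[OF assms] moduli_dim_ge[of n] by auto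
    show ?thesis
      by (rule bij_betw_byWitness[where f' = "\<lambda>k. if k < n then k + 2 else k + 3"])
        (use False len in \<open>auto simp: inner_indices_eq[OF assms] split: if_splits\<close>)
  qed
  moreover have "bij_betw ((!) (chart_positions n)) {..<length (chart_positions n)} (set (chart_positions n))"
    by (rule bij_betw_nth[OF distinct_chart_positions[OF assms] refl refl])
  ultimately have "bij_betw ((!) (chart_positions n) \<circ> ?idx) (inner_indices n) (set (chart_positions n))"
    by (rule bij_betw_trans)
  then show ?thesis by (simp add: chart_pos_def[abs_def] o_def if_distrib)
qed

lemma chart_pos_2: "n \<ge> 1 \<Longrightarrow> chart_pos n 2 = (2, 1)"
  using hd_chart_positions[of n] by (simp add: chart_pos_def)

lemma two_in_inner: "n \<ge> 1 \<Longrightarrow> 2 \<in> inner_indices n"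
  using moduli_dim_ge[of n] by (cases "n \<le> 2") (auto simp: inner_indices_eq)

text \<open>The list of positions ends with (n,1), (n,2), (n+1,1), so s_{n,1} is t_{d-2} unless the
  skipped index intervenes. That happens for n = 3, where d - 2 = 5 = n + 2 and s_{n,1} is t_4; for
  n \<ge> 5 the estimates give d - 2 > n + 2.\<close>

lemma chart_pos_last:
  assumes "odd n" "n \<ge> 3"
  shows "chart_pos n (moduli_dim n) = (n + 1, 1)"
    and "chart_pos n (if n = 3 then 4 else moduli_dim n - 2) = (n, 1)"
    and "(if n = 3 then 4 else moduli_dim n - 2) \<in> inner_indices n - {2}"
proof -
  have d: "n + 2 < moduli_dim n" using moduli_dim_ge assms by simp
  then show "chart_pos n (moduli_dim n) = (n + 1, 1)"
    using last_chart_positions[OF assms] by (simp add: chart_pos_def)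
  have "n = 3 \<or> n \<ge> 5" using assms by presburger
  then show "chart_pos n (if n = 3 then 4 else moduli_dim n - 2) = (n, 1)"
  proof
    assume "n = 3"
    then show ?thesis using last_chart_positions(2)[OF assms]
      by (simp add: chart_pos_def moduli_dim_def)
  next
    assume "n \<ge> 5"
    then have "half_dim n \<ge> 3" "2 * half_dim n = n + 1"
      using half_dim_cases[of n] assms by (auto split: if_splits)
    then have "3 * (half_dim n + 1) \<le> half_dim n * (half_dim n + 1)" by (intro mult_right_mono) simp_all
    moreover have "n + 4 \<le> 3 * (half_dim n + 1)"
      using \<open>2 * half_dim n = n + 1\<close> \<open>half_dim n \<ge> 3\<close> by simp
    ultimately have "n + 4 \<le> half_dim n * (half_dim n + 1)" by (rule order_trans[rotated])
    then have "n + 4 \<le> moduli_dim n" unfolding moduli_dim_eq by simp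
    then have "\<not> moduli_dim n - 2 < n + 2" by simp
    then show ?thesis using last_chart_positions(2)[OF assms] \<open>n \<ge> 5\<close>
      by (simp add: chart_pos_def)
  qed
  show "(if n = 3 then 4 else moduli_dim n - 2) \<in> inner_indices n - {2}"
  proof (cases "n = 3")
    case True
    then show ?thesis by (simp add: inner_indices_eq moduli_dim_def)
  next
    case False
    with \<open>n = 3 \<or> n \<ge> 5\<close> have "n \<ge> 5" by simp
    then have "half_dim n \<ge> 3" "2 * half_dim n = n + 1"
      using half_dim_cases[of n] assms by (auto split: if_splits)
    then have "3 * (half_dim n + 1) \<le> half_dim n * (half_dim n + 1)" by (intro mult_right_mono) simp_all
    moreover have "n + 4 \<le> 3 * (half_dim n + 1)"
      using \<open>2 * half_dim n = n + 1\<close> \<open>half_dim n \<ge> 3\<close> by simp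
    ultimately have "n + 4 \<le> half_dim n * (half_dim n + 1)" by (rule order_trans[rotated])
    then have "n + 5 \<le> moduli_dim n" unfolding moduli_dim_eq by simp
    then show ?thesis using False \<open>n \<ge> 5\<close> by (auto simp: inner_indices_eq)
  qed
qed


section \<open>Points of the moduli space\<close>

text \<open>The only nonzero entry in row i of \<Phi>, for both parities of n.\<close>

definition Phi_sign :: "nat \<Rightarrow> nat \<Rightarrow> complex" where
  "Phi_sign n i = (if odd n \<and> i > half_dim n then - 1 else 1)"

lemma Phi_carrier: "Phi n \<in> carrier_mat (n + 1) (n + 1)"
proof (cases "odd n")
  case True
  then have "n + 1 = half_dim n + half_dim n" using half_dim_cases[of n] by simp
  then show ?thesis using True by (simp add: Phi_def antidiag_def mat1_def)
qed (simp add: Phi_def antidiag_def mat1_def)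

lemma antidiag_index:
  "i < k \<Longrightarrow> j < k \<Longrightarrow> antidiag k $$ (i, j) = (if i + j + 1 = k then 1 else 0)"
  "dim_row (antidiag k) = k" "dim_col (antidiag k) = k"
  by (simp_all add: antidiag_def mat1_def)

lemma ent_Phi:
  assumes "i \<in> {1..n+1}" "j \<in> {1..n+1}"
  shows "ent (Phi n) i j = (if i + j = n + 2 then Phi_sign n i else 0)"
proof -
  obtain i' j' where ij: "i = Suc i'" "j = Suc j'" using assms by (cases i; cases j) auto
  show ?thesis
  proof (cases "odd n")
    case True
    define m where "m = half_dim n"
    have n: "n + 1 = m + m" using half_dim_cases[of n] True by (simp add: m_def)
    have b: "i' < m + m" "j' < m + m" using assms n ij by auto
    have P: "ent (Phi n) (Suc i') (Suc j') = (if i' < m then if j' < m then 0 else antidiag m $$ (i', j' - m)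
        else if j' < m then - antidiag m $$ (i' - m, j') else 0)"
      using True b by (simp add: Phi_def m_def[symmetric] ent_def ij antidiag_index)
    show ?thesis
    proof (cases "i' < m")
      case i: True
      show ?thesis
      proof (cases "j' < m")
        case True
        then show ?thesis using i n by (simp add: P ij)
      next
        case False
        then have "j' - m < m" "(i' + (j' - m) + 1 = m) \<longleftrightarrow> i + j = n + 2" using b n ij by auto
        then show ?thesis using i False by (simp add: P antidiag_index Phi_sign_def m_def[symmetric] ij)
      qed
    next
      case i: False
      show ?thesis
      proof (cases "j' < m")
        case True
        then have "i' - m < m" "(i' - m + j' + 1 = m) \<longleftrightarrow> i + j = n + 2" using b n ij i by auto
        then show ?thesis using i True \<open>odd n\<close> by (simp add: P antidiag_index Phi_sign_def m_def[symmetric] ij)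
      next
        case False
        then show ?thesis using i n by (simp add: P ij)
      qed
    qed
  next
    case False
    then show ?thesis using assms
      by (simp add: Phi_def ent_def antidiag_index Phi_sign_def ij)
  qed
qed

lemma Phi_sign_square [simp]: "Phi_sign n i * Phi_sign n i = 1"
  by (simp add: Phi_sign_def)

section \<open>Coordinates of points and the form given by \<Omega>\<close>

definition pt_a :: "point \<Rightarrow> complex" where "pt_a = (\<lambda>(a, b, S). a)"
definition pt_b :: "point \<Rightarrow> complex" where "pt_b = (\<lambda>(a, b, S). b)"
definition pt_s :: "nat \<Rightarrow> nat \<Rightarrow> point \<Rightarrow> complex" where "pt_s i j = (\<lambda>(a, b, S). ent S i j)"
definition pt_o :: "(complex \<Rightarrow> complex \<Rightarrow> complex mat) \<Rightarrow> nat \<Rightarrow> nat \<Rightarrow> point \<Rightarrow> complex" where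
  "pt_o \<Omega> i j = (\<lambda>(a, b, S). ent (\<Omega> a b) i j)"

lemmas pt_simps = pt_a_def pt_b_def pt_s_def pt_o_def

definition gram :: "nat \<Rightarrow> (complex \<Rightarrow> complex \<Rightarrow> complex mat) \<Rightarrow> point \<Rightarrow>
    (nat \<Rightarrow> complex) \<Rightarrow> (nat \<Rightarrow> complex) \<Rightarrow> complex" where
  "gram n \<Omega> x y z = (\<Sum>k\<in>{1..n+1}. \<Sum>l\<in>{1..n+1}. y k * pt_o \<Omega> k l x * z l)"

lemma gram_linear:
  "gram n \<Omega> x (\<lambda>k. y k + y' k) z = gram n \<Omega> x y z + gram n \<Omega> x y' z"
  "gram n \<Omega> x y (\<lambda>k. z k + z' k) = gram n \<Omega> x y z + gram n \<Omega> x y z'"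
  "gram n \<Omega> x (\<lambda>k. t * y k) z = t * gram n \<Omega> x y z"
  "gram n \<Omega> x y (\<lambda>k. t * z k) = t * gram n \<Omega> x y z"
  by (simp_all add: gram_def sum.distrib sum_distrib_left algebra_simps)

lemma gram_eq_ent:
  assumes S: "S \<in> carrier_mat (n + 1) (n + 1)" and O: "\<Omega> a b \<in> carrier_mat (n + 1) (n + 1)"
    and i: "i \<in> {1..n+1}" and j: "j \<in> {1..n+1}"
  shows "ent (S * \<Omega> a b * transpose_mat S) i j
    = gram n \<Omega> (a, b, S) (\<lambda>k. pt_s i k (a, b, S)) (\<lambda>k. pt_s j k (a, b, S))"
proof -
  have T: "transpose_mat S \<in> carrier_mat (n + 1) (n + 1)" using S by (simp only: transpose_carrier_mat)
  have "ent (S * \<Omega> a b * transpose_mat S) i j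
      = (\<Sum>l\<in>{1..n+1}. (\<Sum>k\<in>{1..n+1}. ent S i k * ent (\<Omega> a b) k l) * ent S j l)"
    unfolding ent_mult[OF mult_carrier_mat[OF S O] T i j]
    by (intro sum.cong refl) (simp only: ent_mult[OF S O i] ent_transpose[OF S _ j])
  also have "\<dots> = (\<Sum>l\<in>{1..n+1}. \<Sum>k\<in>{1..n+1}. ent S i k * ent (\<Omega> a b) k l * ent S j l)"
    by (simp only: sum_distrib_right)
  also have "\<dots> = (\<Sum>k\<in>{1..n+1}. \<Sum>l\<in>{1..n+1}. ent S i k * ent (\<Omega> a b) k l * ent S j l)"
    by (rule sum.swap)
  finally show ?thesis by (simp only: gram_def pt_simps prod.case)
qed

text \<open>Since \<Phi> \<Phi>^tr = 1, the matrix \<Omega> S^tr \<Phi>^tr is a right inverse of S.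
  This settles invertibility for points constructed from others, as in the torus action.\<close>

lemma invertible_of_gram:
  assumes S: "S \<in> carrier_mat (n + 1) (n + 1)" and O: "Om \<in> carrier_mat (n + 1) (n + 1)"
    and eq: "S * Om * transpose_mat S = Phi n"
  shows "invertible_mat S"
proof -
  let ?N = "n + 1"
  note P = Phi_carrier[of n]
  have PT: "transpose_mat (Phi n) \<in> carrier_mat ?N ?N" using P by (simp only: transpose_carrier_mat)
  have ST: "transpose_mat S \<in> carrier_mat ?N ?N" using S by (simp only: transpose_carrier_mat)
  have "Phi n * transpose_mat (Phi n) = 1\<^sub>m ?N"
  proof (rule mat_eqI_ent)
    fix i j assume i: "i \<in> {1..?N}" and j: "j \<in> {1..?N}"
    have "ent (Phi n * transpose_mat (Phi n)) i j = (\<Sum>k\<in>{1..?N}. ent (Phi n) i k * ent (Phi n) j k)"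
      unfolding ent_mult[OF P PT i j] by (intro sum.cong refl) (simp only: ent_transpose[OF P _ j])
    also have "\<dots> = (\<Sum>k\<in>{1..?N}. if k = n + 2 - i then (if i = j then 1 else 0) else 0)"
      using i j by (intro sum.cong refl) (auto simp: ent_Phi)
    also have "\<dots> = (if i = j then 1 else 0)" using i by (subst sum.delta) auto
    also have "\<dots> = ent (1\<^sub>m ?N) i j" using i j by (auto simp: ent_def)
    finally show "ent (Phi n * transpose_mat (Phi n)) i j = ent (1\<^sub>m ?N) i j" .
  qed (use mult_carrier_mat[OF P PT] in auto)
  then have "S * Om * transpose_mat S * transpose_mat (Phi n) = 1\<^sub>m ?N" by (simp only: eq)
  moreover have "S * Om * transpose_mat S * transpose_mat (Phi n)
      = S * (Om * transpose_mat S * transpose_mat (Phi n))"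
    using assoc_mult_mat[OF S O mult_carrier_mat[OF ST PT]]
      assoc_mult_mat[OF mult_carrier_mat[OF S O] ST PT] assoc_mult_mat[OF O ST PT] by simp
  ultimately have r: "S * (Om * transpose_mat S * transpose_mat (Phi n)) = 1\<^sub>m ?N" by simp
  have C: "Om * transpose_mat S * transpose_mat (Phi n) \<in> carrier_mat ?N ?N"
    by (rule mult_carrier_mat[OF mult_carrier_mat[OF O ST] PT])
  have l: "Om * transpose_mat S * transpose_mat (Phi n) * S = 1\<^sub>m ?N"
    by (rule mat_mult_left_right_inverse[OF S C r])
  show ?thesis
    unfolding invertible_mat_def inverts_mat_def square_mat.simps
    using S C l r by (intro conjI exI[of _ "Om * transpose_mat S * transpose_mat (Phi n)"]) auto
qed

definition weight_unit :: "nat \<Rightarrow> int" where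
  "weight_unit n = (if n = 2 then 2 else 1)"

text \<open>The diagonal of the Gauss-Manin matrix of H: that of -g_11 for n = 1, of -2 g_11 for n =
  2, of g_22 - g_11 for n \<ge> 3.\<close>

definition row_weight :: "nat \<Rightarrow> nat \<Rightarrow> int" where
  "row_weight n i = (if n = 2 then 2 * int i - 4 else if i = 2 \<or> i = n + 1 then 1
     else if i = 1 \<or> i = n then - 1 else 0)"

text \<open>In H(S) = A S - S B(H) the matrix A is diagonal, and B(H) = -h diag(1, ..., n+1). Here
  -h is the first diagonal entry of A, as forced by s_11 = 1; hence the term h j for column
  j.\<close>

definition entry_weight :: "nat \<Rightarrow> nat \<Rightarrow> nat \<Rightarrow> int" where
  "entry_weight n i j = row_weight n i + weight_unit n * int j"

lemma row_weight_reflect: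
  "n \<ge> 1 \<Longrightarrow> i + j = n + 2 \<Longrightarrow> i \<in> {1..n+1} \<Longrightarrow> row_weight n i + row_weight n j = 0"
  by (auto simp: row_weight_def)

lemma entry_weight_1_1: "n \<ge> 1 \<Longrightarrow> entry_weight n 1 1 = 0"
  by (auto simp: entry_weight_def row_weight_def weight_unit_def)

section \<open>Gram relations on the moduli space\<close>

locale dwork =
  fixes n :: nat and c :: complex and \<Omega> :: "complex \<Rightarrow> complex \<Rightarrow> complex mat"
    and opt :: field_option
  assumes n_pos: "n \<ge> 1" and c_nonzero: "c \<noteq> 0" and \<Omega>: "intersection_matrix n c \<Omega>"
begin

abbreviation X :: "point set" where "X \<equiv> moduli n \<Omega>"

abbreviation s :: "nat \<Rightarrow> nat \<Rightarrow> point \<Rightarrow> complex" where "s \<equiv> pt_s"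

abbreviation om :: "nat \<Rightarrow> nat \<Rightarrow> point \<Rightarrow> complex" where "om \<equiv> pt_o \<Omega>"

definition disc :: "point \<Rightarrow> complex" where
  "disc x = pt_a x ^ (n + 2) - pt_b x"

abbreviation form :: "point \<Rightarrow> (nat \<Rightarrow> complex) \<Rightarrow> (nat \<Rightarrow> complex) \<Rightarrow> complex" where
  "form \<equiv> gram n \<Omega>"

lemma moduli_iff:
  "(a, b, S) \<in> X \<longleftrightarrow> (a, b) \<in> base_points n \<and> S \<in> carrier_mat (n + 1) (n + 1) \<and>
     (\<forall>i\<in>{1..n+1}. \<forall>j\<in>{1..n+1}. i < j \<longrightarrow> ent S i j = 0) \<and> ent S 1 1 = 1 \<and>
     (\<forall>i\<in>{1..n+1}. \<forall>j\<in>{1..n+1}. form (a, b, S) (\<lambda>k. s i k (a, b, S)) (\<lambda>k. s j k (a, b, S))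
        = ent (Phi n) i j)" (is "?l \<longleftrightarrow> ?r")
proof -
  have "S * \<Omega> a b * transpose_mat S = Phi n \<longleftrightarrow>
     (\<forall>i\<in>{1..n+1}. \<forall>j\<in>{1..n+1}. form (a, b, S) (\<lambda>k. s i k (a, b, S)) (\<lambda>k. s j k (a, b, S))
        = ent (Phi n) i j)" (is "?A = Phi n \<longleftrightarrow> ?e")
    if "(a, b) \<in> base_points n" "S \<in> carrier_mat (n + 1) (n + 1)"
  proof
    note O = Omega_carrier[OF \<Omega> that(1)]
    assume A: "?A = Phi n"
    show ?e
    proof (intro ballI)
      fix i j assume "i \<in> {1..n+1}" "j \<in> {1..n+1}"
      from gram_eq_ent[where \<Omega> = \<Omega>, OF that(2) O this]
      show "form (a, b, S) (\<lambda>k. s i k (a, b, S)) (\<lambda>k. s j k (a, b, S)) = ent (Phi n) i j"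
        unfolding A by (rule sym)
    qed
  next
    note O = Omega_carrier[OF \<Omega> that(1)]
    assume e: ?e
    have A: "?A \<in> carrier_mat (n + 1) (n + 1)"
      by (rule mult_carrier_mat[OF mult_carrier_mat[OF that(2) O]]) (simp only: transpose_carrier_mat that(2))
    show "?A = Phi n"
      by (rule mat_eqI_ent[OF A Phi_carrier]) (simp only: gram_eq_ent[where \<Omega> = \<Omega>, OF that(2) O] e[rule_format])
  qed
  moreover have "invertible_mat S"
    if "(a, b) \<in> base_points n" "S \<in> carrier_mat (n + 1) (n + 1)" "S * \<Omega> a b * transpose_mat S = Phi n"
    using invertible_of_gram[OF that(2) Omega_carrier[OF \<Omega> that(1)] that(3)] .
  ultimately show ?thesis unfolding moduli_def base_points_def mem_Collect_eq prod.case by blast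
qed

lemma in_X:
  assumes "x \<in> X"
  shows "(pt_a x, pt_b x) \<in> base_points n"
    and "\<lbrakk>i \<in> {1..n+1}; j \<in> {1..n+1}; i < j\<rbrakk> \<Longrightarrow> s i j x = 0"
    and "s 1 1 x = 1"
    and "\<lbrakk>i \<in> {1..n+1}; j \<in> {1..n+1}\<rbrakk> \<Longrightarrow> form x (\<lambda>k. s i k x) (\<lambda>k. s j k x) = ent (Phi n) i j"
proof -
  obtain a b S where x: "x = (a, b, S)" by (cases x)
  note m = assms[unfolded x moduli_iff]
  show "(pt_a x, pt_b x) \<in> base_points n" using m by (simp add: pt_simps x)
  show "s i j x = 0" if "i \<in> {1..n+1}" "j \<in> {1..n+1}" "i < j"
    using m that by (simp add: pt_simps x)
  show "s 1 1 x = 1" using m by (simp add: pt_simps x)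
  show "form x (\<lambda>k. s i k x) (\<lambda>k. s j k x) = ent (Phi n) i j"
    if "i \<in> {1..n+1}" "j \<in> {1..n+1}"
    using m that unfolding x by blast
qed

lemma b_nonzero: "x \<in> X \<Longrightarrow> pt_b x \<noteq> 0" and disc_nonzero: "x \<in> X \<Longrightarrow> disc x \<noteq> 0"
  using in_X(1)[of x] by (auto simp: base_points_def disc_def)

lemma om_eq: "om i j x = ent (\<Omega> (pt_a x) (pt_b x)) i j"
  by (cases x) (simp add: pt_simps)

lemma om_zero:
  "x \<in> X \<Longrightarrow> i \<in> {1..n+1} \<Longrightarrow> j \<in> {1..n+1} \<Longrightarrow> i + j \<le> n + 1 \<Longrightarrow> om i j x = 0"
  unfolding om_eq by (rule Omega_zero[OF \<Omega> in_X(1)])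

lemma om_antidiagonal:
  "x \<in> X \<Longrightarrow> i \<in> {1..n+1} \<Longrightarrow>
    om i (n + 2 - i) x = (- 1) ^ (i - 1) * ((- of_nat (n + 2)) ^ n * c) * (1 / disc x)"
  unfolding om_eq disc_def by (rule Omega_antidiagonal[OF \<Omega> in_X(1)])

text \<open>The rows of \<open>exp(-t\<^sub>2 g) S\<close>, where \<open>g = E\<^sub>2\<^sub>1 - E\<^sub>n\<^sub>+\<^sub>1\<^sub>,\<^sub>n\<close> (just \<open>E\<^sub>2\<^sub>1\<close> for \<open>n = 1\<close>)
  is an infinitesimal isometry of \<open>\<Phi>\<close>. Its flow moves \<open>t\<^sub>2\<close>, so these entries are free of \<open>t\<^sub>2\<close>.\<close>

definition sig :: "nat \<Rightarrow> nat \<Rightarrow> point \<Rightarrow> complex" where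
  "sig i k x = s i k x
     + ((if i = 2 then - s 2 1 x else 0) + (if n = 2 \<and> i = 3 then - (s 2 1 x)\<^sup>2 / 2 else 0)) * s 1 k x
     + (if i = n + 1 \<and> n \<ge> 2 then s 2 1 x else 0) * s n k x"

text \<open>With the new rows written as s_i + p_i s_1 + q_i s_n, the claim reduces to finitely many
  entries of \<Phi>. For n = 2 one has g^2 = -E_31, whence the quadratic term in row 3; otherwise
  g^2 = 0.\<close>

lemma form_sig:
  assumes x: "x \<in> X" and i: "i \<in> {1..n+1}" and j: "j \<in> {1..n+1}"
  shows "form x (\<lambda>k. sig i k x) (\<lambda>k. sig j k x) = ent (Phi n) i j"
proof -
  define p where "p i = (if i = 2 then - s 2 1 x else 0)
      + (if n = 2 \<and> i = 3 then - (s 2 1 x)\<^sup>2 / 2 else 0)" for i :: nat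
  define q where "q i = (if i = n + 1 \<and> n \<ge> 2 then s 2 1 x else 0)" for i :: nat
  have sig: "sig i k x = s i k x + p i * s 1 k x + q i * s n k x" for i k
    by (simp add: sig_def p_def q_def)
  let ?E = "\<lambda>i j. if i + j = n + 2 then Phi_sign n i else 0"
  have E: "form x (\<lambda>k. s i k x) (\<lambda>k. s j k x) = ?E i j" if "i \<in> {1..n+1}" "j \<in> {1..n+1}" for i j
    unfolding in_X(4)[OF x that] by (rule ent_Phi[OF that])
  have 1: "1 \<in> {1..n+1}" and n: "n \<in> {1..n+1}" using n_pos by auto
  have "form x (\<lambda>k. sig i k x) (\<lambda>k. sig j k x)
     = ?E i j + p j * ?E i 1 + q j * ?E i n
       + p i * (?E 1 j + p j * ?E 1 1 + q j * ?E 1 n)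
       + q i * (?E n j + p j * ?E n 1 + q j * ?E n n)"
    unfolding sig gram_linear E[OF i j] E[OF i 1] E[OF i n] E[OF 1 j] E[OF 1 1] E[OF 1 n]
      E[OF n j] E[OF n 1] E[OF n n] by (simp add: algebra_simps)
  also have "\<dots> = ?E i j"
  proof -
    consider "n = 1" | "n = 2" | "n \<ge> 3" using n_pos by linarith
    then show ?thesis
    proof cases
      case 1
      then have "i = 1 \<or> i = 2" "j = 1 \<or> j = 2" using i j by auto
      then show ?thesis using 1 by (auto simp: p_def q_def Phi_sign_def half_dim_def)
    next
      case 2
      then have "i = 1 \<or> i = 2 \<or> i = 3" "j = 1 \<or> j = 2 \<or> j = 3" using i j by auto
      then show ?thesis using 2 by (auto simp: p_def q_def Phi_sign_def power2_eq_square)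
    next
      case 3
      \<comment> \<open>The indices 1, 2 lie in the upper half and n, n + 1 in the lower half, so
        the two cross terms have matching signs and cancel.\<close>
      have "half_dim n < n" "2 \<le> half_dim n" using half_dim_cases[of n] 3 by (auto split: if_splits)
      then have "Phi_sign n 2 = 1" "Phi_sign n 1 = 1" "Phi_sign n (n + 1) = Phi_sign n n"
        by (auto simp: Phi_sign_def)
      then show ?thesis using 3 i j by (auto simp: p_def q_def)
    qed
  qed
  finally show ?thesis by (simp only: ent_Phi[OF i j])
qed

lemma sig_upper:
  assumes "x \<in> X" "i \<in> {1..n+1}" "j \<in> {1..n+1}" "i < j"
  shows "sig i j x = 0"
proof -
  have "s i j x = 0" using assms in_X(2) by blast
  moreover have "s 1 j x = 0" using in_X(2)[OF assms(1), of 1 j] assms by auto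
  moreover have "i \<noteq> n + 1" using assms by auto
  ultimately show ?thesis by (simp add: sig_def)
qed

lemma sig_diag:
  assumes "x \<in> X" "i \<in> {1..n+1}"
  shows "sig i i x = s i i x"
proof -
  have "s 1 i x = 0" if "i \<noteq> 1" using in_X(2)[OF assms(1), of 1 i] assms(2) that by auto
  moreover have "s n (n + 1) x = 0" using in_X(2)[OF assms(1), of n "n + 1"] n_pos by auto
  ultimately show ?thesis by (auto simp: sig_def)
qed

text \<open>t_2 is the parameter of the flow, and exp(-t_2 g) moves the point to the slice t_2 =
  0.\<close>

lemma sig_2_1: "x \<in> X \<Longrightarrow> sig 2 1 x = 0"
  using in_X(3)[of x] n_pos by (auto simp: sig_def)

text \<open>\<Omega> vanishes above its antidiagonal and the new matrix above its diagonal. So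
  columns of row i before j = n + 2 - q do not meet row q, and column j meets only the diagonal
  entry of row q. Solved for the entry (i, j), this is the recursion behind
  \<open>H_sig\<close>.\<close>

lemma form_lower:
  assumes x: "x \<in> X" and i: "i \<in> {1..n+1}" and q: "q \<in> {1..n+1}" and j: "j \<in> {1..n+1}" and jq: "j + q = n + 2"
  shows "ent (Phi n) i q = sig i j x * om j q x * sig q q x
    + (\<Sum>k\<in>{j+1..n+1}. \<Sum>l\<in>{1..n+1}. sig i k x * om k l x * sig q l x)"
proof -
  let ?f = "\<lambda>k. \<Sum>l\<in>{1..n+1}. sig i k x * om k l x * sig q l x"
  have "ent (Phi n) i q = sum ?f {1..n+1}"
    using form_sig[OF x i q] by (simp only: gram_def)
  also have "sum ?f {1..n+1} = sum ?f {j..n+1}"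
  proof (rule sum.mono_neutral_right)
    show "\<forall>k\<in>{1..n+1} - {j..n+1}. ?f k = 0"
    proof (intro sum.neutral ballI)
      fix k l assume k: "k \<in> {1..n+1} - {j..n+1}" and l: "l \<in> {1..n+1}"
      show "sig i k x * om k l x * sig q l x = 0"
      proof (cases "l \<le> q")
        case True
        have "om k l x = 0" by (rule om_zero[OF x]) (use k l j jq True in auto)
        then show ?thesis by simp
      next
        case False
        then show ?thesis using sig_upper[OF x q l] by simp
      qed
    qed
  qed (use j in auto)
  also have "sum ?f {j..n+1} = ?f j + sum ?f {j+1..n+1}"
    using sum.atLeast_Suc_atMost[of j "n + 1" ?f] j by simp
  also have "?f j = (\<Sum>l\<in>{1..n+1}. if l = q then sig i j x * om j q x * sig q q x else 0)"
  proof (intro sum.cong refl)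
    fix l assume l: "l \<in> {1..n+1}"
    consider "l < q" | "l = q" | "q < l" by linarith
    then show "sig i j x * om j l x * sig q l x = (if l = q then sig i j x * om j q x * sig q q x else 0)"
    proof cases
      case 1
      have "om j l x = 0" by (rule om_zero[OF x]) (use 1 l j jq in auto)
      then show ?thesis using 1 by simp
    next
      case 3
      then show ?thesis using sig_upper[OF x q l] by simp
    qed simp
  qed
  also have "\<dots> = sig i j x * om j q x * sig q q x" using q by simp
  finally show ?thesis by simp
qed

lemma diag_relation:
  assumes x: "x \<in> X" and i: "i \<in> {1..n+1}" and q: "q \<in> {1..n+1}" and iq: "i + q = n + 2"
  shows "s i i x * om i q x * s q q x = Phi_sign n i"
proof -
  have "(\<Sum>k\<in>{i+1..n+1}. \<Sum>l\<in>{1..n+1}. sig i k x * om k l x * sig q l x) = 0"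
    using sig_upper[OF x i] by (intro sum.neutral ballI) auto
  then show ?thesis using form_lower[OF x i q i iq] ent_Phi[OF i q] iq
    by (simp add: sig_diag[OF x i] sig_diag[OF x q])
qed

lemma s_diag_nonzero:
  assumes "x \<in> X" "i \<in> {1..n+1}"
  shows "s i i x \<noteq> 0"
proof
  assume "s i i x = 0"
  moreover have "s i i x * om i (n + 2 - i) x * s (n + 2 - i) (n + 2 - i) x = Phi_sign n i"
    by (rule diag_relation) (use assms in auto)
  ultimately have "Phi_sign n i = 0" by simp
  then show False using Phi_sign_square[of n i] by simp
qed

end


text \<open>The map p multiplies weights by k. Used with k = h, as t_1 has weight 1 on the base and
  weight h on the moduli space.\<close>

lemma homogeneous_pullback:
  assumes "homogeneous U V r f"
    and "\<And>x. x \<in> X \<Longrightarrow> p x \<in> U"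
    and "\<And>g w. (g, w) \<in> V \<Longrightarrow> hom_on X W (k * w) (\<lambda>x. g (p x))"
  shows "hom_on X W (k * r) (\<lambda>x. f (p x))"
  using assms(1)
proof induction
  case (zero r)
  show ?case using hom_on_zero[of X W "k * r"] by simp
next
  case (const a)
  show ?case using hom_on_const[of X W a] by (rule hom_onI) (simp_all add: const_on_def assms(2))
next
  case (gen g w)
  then show ?case by (rule assms(3))
next
  case (add r f g)
  then show ?case using hom_on_add[OF add.IH] by simp
next
  case (mult r f s g)
  show ?case using hom_on_mult[OF mult.IH] by (simp add: distrib_left)
qed

section \<open>Weights and homogeneity on the moduli space\<close>

context dwork
begin

abbreviation W\<^sub>0 :: "((point \<Rightarrow> complex) \<times> int) set" where
  "W\<^sub>0 \<equiv> weighted_generators opt n \<Omega> (chart_indices n - {2})"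

abbreviation W :: "((point \<Rightarrow> complex) \<times> int) set" where
  "W \<equiv> weighted_generators opt n \<Omega> (chart_indices n)"

abbreviation H :: "int \<Rightarrow> (point \<Rightarrow> complex) \<Rightarrow> bool" where
  "H \<equiv> hom_on X W\<^sub>0"

abbreviation row :: "nat \<Rightarrow> nat" where "row j \<equiv> fst (chart_pos n j)"
abbreviation col :: "nat \<Rightarrow> nat" where "col j \<equiv> snd (chart_pos n j)"

section \<open>The chart coordinates and their weights\<close>

lemma reg_eq: "reg n \<Omega> f = restr X f"
  by (simp add: reg_def restr_def)

lemma coord_1: "coord n \<Omega> 1 = restr X pt_a"
  by (simp add: coord_def reg_eq pt_a_def)

lemma coord_last: "coord n \<Omega> (n + 2) = restr X pt_b"
  by (simp add: coord_def reg_eq pt_b_def)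

lemma coord_inner: "j \<in> inner_indices n \<Longrightarrow> coord n \<Omega> j = restr X (s (row j) (col j))"
  by (auto simp: coord_def reg_eq s_entry_def pt_s_def inner_indices_def)

lemma coord_u_eq: "coord_u n \<Omega> = restr X (s ((n + 2) div 2) ((n + 2) div 2))"
  by (simp add: coord_u_def reg_eq s_entry_def pt_s_def)

lemma coord_2: "coord n \<Omega> 2 = restr X (s 2 1)"
  using coord_inner[OF two_in_inner[OF n_pos]] chart_pos_2[OF n_pos] by simp

lemma s_entry_eq: "s_entry n \<Omega> i j = restr X (s i j)"
  by (simp add: s_entry_def reg_eq pt_s_def)

lemma position:
  assumes "j \<in> inner_indices n"
  shows "2 \<le> row j" "row j \<le> n + 1" "1 \<le> col j" "col j \<le> row j" "row j + col j \<le> 2 * half_dim n + 1"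
    "row j + col j \<le> n + 2"
proof -
  have "chart_pos n j \<in> set (chart_positions n)"
    using chart_pos_bij[OF n_pos] assms by (rule bij_betwE[THEN bspec])
  then have "(row j, col j) \<in> set (chart_positions n)" by simp
  from this[unfolded set_chart_positions[OF n_pos]]
  show "2 \<le> row j" "row j \<le> n + 1" "1 \<le> col j" "col j \<le> row j"
    "row j + col j \<le> 2 * half_dim n + 1" by blast+
  then show "row j + col j \<le> n + 2" using half_dim_cases[of n] by (auto split: if_splits)
qed

lemma position_index:
  assumes "2 \<le> i" "i \<le> n + 1" "1 \<le> k" "k \<le> i" "i + k \<le> 2 * half_dim n + 1"
  obtains j where "j \<in> inner_indices n" "row j = i" "col j = k"
proof -
  have "(i, k) \<in> set (chart_positions n)" using assms set_chart_positions[OF n_pos] by blast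
  then obtain j where "j \<in> inner_indices n" "chart_pos n j = (i, k)"
    using bij_betw_imp_surj_on[OF chart_pos_bij[OF n_pos]] by (metis imageE)
  then show ?thesis using that by simp
qed

lemma chart_pos_eqD:
  "i \<in> inner_indices n \<Longrightarrow> j \<in> inner_indices n \<Longrightarrow> row i = row j \<Longrightarrow> col i = col j \<Longrightarrow> i = j"
  using bij_betw_imp_inj_on[OF chart_pos_bij[OF n_pos]] by (auto simp: inj_on_def prod_eq_iff)

lemma position_2: "j \<in> inner_indices n \<Longrightarrow> row j = 2 \<Longrightarrow> col j = 1 \<Longrightarrow> j = 2"
  using chart_pos_eqD[OF _ two_in_inner[OF n_pos]] chart_pos_2[OF n_pos] by simp

lemma last_in_inner: "n \<ge> 3 \<Longrightarrow> moduli_dim n \<in> inner_indices n - {2}"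
  using moduli_dim_ge[of n] by (simp add: inner_indices_eq[OF n_pos])

lemma chart_weight_1: "chart_weight n 1 = weight_unit n"
  by (auto simp: chart_weight_def weight_unit_def)

lemma chart_weight_last: "chart_weight n (n + 2) = weight_unit n * int (n + 2)"
  using n_pos by (auto simp: chart_weight_def weight_unit_def)

lemma chart_weight_inner:
  assumes "j \<in> inner_indices n"
  shows "chart_weight n j = entry_weight n (row j) (col j)"
proof -
  consider "n = 1" | "n = 2" | "n \<ge> 3" using n_pos by linarith
  then show ?thesis
  proof cases
    case 1
    then have "j = 2" using assms by (simp add: inner_indices_eq)
    then show ?thesis using chart_pos_2[OF n_pos] 1
      by (simp add: chart_weight_def entry_weight_def row_weight_def weight_unit_def)
  next
    case 2
    then have "j = 2" using assms by (simp add: inner_indices_eq)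
    then show ?thesis using chart_pos_2[OF n_pos] 2
      by (simp add: chart_weight_def entry_weight_def row_weight_def weight_unit_def)
  next
    case 3
    have "j \<noteq> 1" "j \<noteq> n + 2" using assms by (auto simp: inner_indices_def)
    then show ?thesis using 3 position(1)[OF assms]
      by (simp add: chart_weight_def entry_weight_def row_weight_def weight_unit_def Let_def)
  qed
qed

lemma u_weight_eq: "even n \<Longrightarrow> u_weight n = entry_weight n ((n + 2) div 2) ((n + 2) div 2)"
proof -
  assume "even n"
  then obtain k where k: "n = 2 * k" by (auto elim: evenE)
  then have "k \<ge> 1" using n_pos by simp
  then show ?thesis
    by (auto simp: k u_weight_def entry_weight_def row_weight_def weight_unit_def)
qed

definition shifted :: "nat \<Rightarrow> bool" where
  "shifted j \<longleftrightarrow> opt = Option1 \<and> odd n \<and> n \<ge> 3 \<and> j = moduli_dim n"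

text \<open>The coordinate introduced in Option 1 is the entry (n+1, 1) of exp(-t_2 g) S, as row n +
  1 of that matrix is s_{n+1} + t_2 s_n for n \<ge> 3.\<close>

lemma chart_coord_eq:
  "chart_coord opt n \<Omega> j = (if shifted j then restr X (\<lambda>x. s (n + 1) 1 x + s 2 1 x * s n 1 x)
     else coord n \<Omega> j)"
proof (cases "shifted j")
  case True
  then have n: "odd n" "n \<ge> 3" "j = moduli_dim n" by (auto simp: shifted_def)
  have 1: "coord n \<Omega> (if n = 3 then 4 else j - 2) = restr X (s n 1)"
    using coord_inner[of "if n = 3 then 4 else moduli_dim n - 2"] chart_pos_last(2,3)[OF n(1,2)]
    unfolding n(3) by (simp only: fst_conv snd_conv Diff_iff)
  have 2: "coord n \<Omega> j = restr X (s (n + 1) 1)"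
    using coord_inner[of j] last_in_inner[OF n(2)] chart_pos_last(1)[OF n(1,2)] by (simp add: n(3))
  have "chart_coord opt n \<Omega> j
      = coord n \<Omega> j + coord n \<Omega> 2 * coord n \<Omega> (if n = 3 then 4 else j - 2)"
    using True by (simp add: chart_coord_def shifted_def)
  then show ?thesis using True unfolding 1 2 coord_2 restr_arith(1,2) by simp
qed (auto simp: chart_coord_def shifted_def)

lemma not_shifted: "\<not> shifted 1" "\<not> shifted 2" "\<not> shifted (n + 2)"
  using moduli_dim_ge[of n] by (auto simp: shifted_def)

text \<open>Option 2 keeps s_{n+1,1} as a coordinate, so there the entry (n+1, 1) of exp(-t_2 g) S
  does involve t_2 and is left out of \<open>H_sig\<close>. It comes last in the order of that
  recursion, so no other entry refers to it.\<close>

definition exceptional :: "nat \<Rightarrow> nat \<Rightarrow> bool" where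
  "exceptional i j \<longleftrightarrow> opt = Option2 \<and> odd n \<and> n \<ge> 3 \<and> i = n + 1 \<and> j = 1"

text \<open>In row 2 the chart has, besides t_2, only s_22, unchanged because s_12 = 0. In row n + 1
  it has at most s_{n+1,1}, for odd n, which is the replaced coordinate. The flow leaves the rows in
  between alone.\<close>

lemma chart_coord_sig:
  assumes j: "j \<in> inner_indices n - {2}" and "\<not> exceptional (row j) (col j)"
  shows "chart_coord opt n \<Omega> j = restr X (sig (row j) (col j))"
proof -
  have n: "n \<ge> 3" using j inner_indices_eq[OF n_pos] by (auto split: if_splits)
  have j': "j \<in> inner_indices n" using j by simp
  note pos = position[OF j']
  show ?thesis
  proof (cases "row j = n + 1")
    case True
    then have c: "col j = 1" "odd n" using pos half_dim_cases[of n] by (auto split: if_splits)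
    then have "j = moduli_dim n"
      using True chart_pos_eqD[OF j', of "moduli_dim n"] last_in_inner[OF n] chart_pos_last(1)[OF c(2) n] by simp
    moreover have "opt \<noteq> Option2"
      using assms(2) True c n by (simp add: exceptional_def)
    then have "opt = Option1" by (cases opt) simp_all
    ultimately have "shifted j" unfolding shifted_def using c n by blast
    then show ?thesis unfolding chart_coord_eq True c(1) using n by (simp add: sig_def[abs_def])
  next
    case False
    then have "\<not> shifted j" using chart_pos_last(1)[of n] by (auto simp: shifted_def)
    moreover have "restr X (s (row j) (col j)) = restr X (sig (row j) (col j))"
    proof (rule restr_cong)
      fix x assume x: "x \<in> X"
      have "col j \<noteq> 1" if "row j = 2" using position_2[OF j' that] j by auto
      then have "s 1 (col j) x = 0" if "row j = 2" using that in_X(2)[OF x, of 1 "col j"] pos by auto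
      then show "s (row j) (col j) x = sig (row j) (col j) x" using False n by (simp add: sig_def)
    qed
    ultimately show ?thesis unfolding chart_coord_eq using coord_inner[OF j'] by simp
  qed
qed

lemma finite_diag: "finite (diag_indices n)"
  using finite_inner_indices[OF n_pos] by (auto simp: diag_indices_def inner_indices_def)

lemma diag_indices_eq: "diag_indices n = {j \<in> inner_indices n. row j = col j}"
  by (auto simp: diag_indices_def inner_indices_def)

section \<open>Inverting the discriminant and the diagonal entries\<close>

definition diag_prod :: "point \<Rightarrow> complex" where
  "diag_prod x = (\<Prod>j\<in>diag_indices n. s (row j) (row j) x)"

lemma diag_prod_nonzero:
  assumes "x \<in> X"
  shows "diag_prod x \<noteq> 0"
  unfolding diag_prod_def prod_zero_iff[OF finite_diag]
proof
  assume "\<exists>j\<in>diag_indices n. s (row j) (row j) x = 0"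
  then obtain j where j: "j \<in> inner_indices n" "s (row j) (row j) x = 0"
    by (auto simp: diag_indices_eq)
  have "row j \<in> {1..n+1}" using position(1,2)[OF j(1)] by simp
  from s_diag_nonzero[OF assms this] j(2) show False by simp
qed

lemma inv_disc_eq: "inv_disc n \<Omega> = restr X (\<lambda>x. - 1 / (pt_b x * disc x * diag_prod x))"
  unfolding inv_disc_def reg_eq
proof (rule restr_cong)
  fix x assume x: "x \<in> X"
  have "(\<Prod>j\<in>diag_indices n. coord n \<Omega> j x) = diag_prod x"
    unfolding diag_prod_def
    by (intro prod.cong refl) (auto simp: diag_indices_eq coord_inner restr_in[OF x])
  moreover have "pt_b x * (pt_b x - pt_a x ^ (n + 2)) * diag_prod x = - (pt_b x * disc x * diag_prod x)"
    by (simp add: disc_def algebra_simps)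
  ultimately show "1 / (coord n \<Omega> (n + 2) x * (coord n \<Omega> (n + 2) x - coord n \<Omega> 1 x ^ (n + 2)) *
        (\<Prod>j\<in>diag_indices n. coord n \<Omega> j x)) = - 1 / (pt_b x * disc x * diag_prod x)"
    unfolding coord_1 coord_last restr_in[OF x] by simp
qed

lemma generator_cases:
  assumes "(g, w) \<in> weighted_generators opt n \<Omega> J"
  obtains j where "j \<in> J" "g = chart_coord opt n \<Omega> j" "w = chart_weight n j"
  | "even n" "g = coord_u n \<Omega>" "w = u_weight n"
  | "g = inv_disc n \<Omega>" "w = - (2 * chart_weight n (n + 2) + (\<Sum>j\<in>diag_indices n. chart_weight n j))"
  using assms unfolding weighted_generators_def by (auto split: if_splits)

lemma coord_outside: "x \<notin> X \<Longrightarrow> coord n \<Omega> j x = 0"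
  by (auto simp: coord_def reg_def s_entry_def)

lemma generators_outside:
  assumes "(g, w) \<in> W" "x \<notin> X"
  shows "g x = 0"
  using assms(1)
proof (cases rule: generator_cases)
  case (1 j)
  then show ?thesis using assms(2) coord_outside by (simp add: chart_coord_eq restr_def)
qed (use assms(2) in \<open>simp_all add: coord_u_eq inv_disc_eq restr_def\<close>)

lemma W0_subset: "W\<^sub>0 \<subseteq> W"
  unfolding weighted_generators_def by blast

lemma H_chart_coord:
  assumes "j \<in> chart_indices n - {2}"
  shows "H (chart_weight n j) (chart_coord opt n \<Omega> j)"
proof (rule hom_on_gen)
  show "(chart_coord opt n \<Omega> j, chart_weight n j) \<in> W\<^sub>0"
    using assms by (auto simp: weighted_generators_def)
  then show "chart_coord opt n \<Omega> j x = 0" if "x \<notin> X" for x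
    using that generators_outside W0_subset by blast
qed

lemma H_restrD: "H r (restr X f) \<Longrightarrow> H r f"
proof -
  have "restr X (restr X f) = restr X f" by (auto simp: restr_def)
  then show "H r (restr X f) \<Longrightarrow> H r f" by (simp only: hom_on_def)
qed

lemma H_a: "H (weight_unit n) pt_a"
proof (rule H_restrD)
  have "1 \<in> chart_indices n - {2}" using chart_indices_eq[OF n_pos] by simp
  from H_chart_coord[OF this]
  show "H (weight_unit n) (restr X pt_a)"
    by (simp only: chart_coord_eq not_shifted if_False coord_1 chart_weight_1)
qed

lemma H_b: "H (weight_unit n * int (n + 2)) pt_b"
proof (rule H_restrD)
  have "n + 2 \<in> chart_indices n - {2}" using chart_indices_eq[OF n_pos] n_pos by simp
  from H_chart_coord[OF this]
  show "H (weight_unit n * int (n + 2)) (restr X pt_b)"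
    by (simp only: chart_coord_eq not_shifted if_False coord_last chart_weight_last)
qed

lemma H_chart_sig:
  assumes "j \<in> inner_indices n - {2}" "\<not> exceptional (row j) (col j)"
  shows "H (entry_weight n (row j) (col j)) (sig (row j) (col j))"
proof (rule H_restrD)
  have "j \<in> chart_indices n - {2}" using assms(1) by (auto simp: inner_indices_def)
  from H_chart_coord[OF this]
  show "H (entry_weight n (row j) (col j)) (restr X (sig (row j) (col j)))"
    unfolding chart_coord_sig[OF assms] using chart_weight_inner[of j] assms(1) by simp
qed

lemma H_exceptional:
  assumes "exceptional i j"
  shows "H (entry_weight n i j) (s i j)"
proof (rule H_restrD)
  from assms have n: "odd n" "n \<ge> 3" "i = n + 1" "j = 1" "opt = Option2"
    by (auto simp: exceptional_def)
  note l = last_in_inner[OF n(2)]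
  have "H (chart_weight n (moduli_dim n)) (chart_coord opt n \<Omega> (moduli_dim n))"
    using l by (intro H_chart_coord) (auto simp: inner_indices_def)
  moreover have "\<not> shifted (moduli_dim n)" unfolding shifted_def using n(5) by simp
  ultimately have "H (chart_weight n (moduli_dim n)) (coord n \<Omega> (moduli_dim n))"
    by (simp only: chart_coord_eq if_False)
  then show "H (entry_weight n i j) (restr X (s i j))"
    using l coord_inner[of "moduli_dim n"] chart_weight_inner[of "moduli_dim n"] chart_pos_last(1)[OF n(1,2)]
    unfolding n(3,4) by simp
qed

lemma H_u:
  assumes "even n" "i = (n + 2) div 2"
  shows "H (entry_weight n i i) (s i i)"
proof (rule H_restrD)
  have "(coord_u n \<Omega>, u_weight n) \<in> W\<^sub>0" using assms by (auto simp: weighted_generators_def)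
  then have "H (u_weight n) (coord_u n \<Omega>)"
    by (rule hom_on_gen) (simp add: coord_u_eq restr_def)
  then show "H (entry_weight n i i) (restr X (s i i))"
    using assms by (simp add: coord_u_eq u_weight_eq)
qed

lemma diag_not_exceptional:
  assumes "j \<in> diag_indices n"
  shows "j \<in> inner_indices n - {2}" "\<not> exceptional (row j) (col j)"
  using assms chart_pos_2[OF n_pos] n_pos by (auto simp: diag_indices_eq exceptional_def)

lemma H_chart_diag:
  assumes "j \<in> diag_indices n"
  shows "H (chart_weight n j) (s (row j) (row j))"
proof -
  have j: "j \<in> inner_indices n" "row j = col j" using assms by (auto simp: diag_indices_eq)
  show ?thesis
    using H_chart_sig[OF diag_not_exceptional[OF assms]]
    by (rule hom_onI) (use j sig_diag[of _ "row j"] position[OF j(1)] in \<open>auto simp: chart_weight_inner\<close>)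
qed

lemma H_inv: "H (- (2 * (weight_unit n * int (n + 2)) + (\<Sum>j\<in>diag_indices n. chart_weight n j)))
    (\<lambda>x. - 1 / (pt_b x * disc x * diag_prod x))"
proof (rule H_restrD)
  have "(inv_disc n \<Omega>, - (2 * chart_weight n (n + 2) + (\<Sum>j\<in>diag_indices n. chart_weight n j))) \<in> W\<^sub>0"
    by (simp add: weighted_generators_def)
  then have "H (- (2 * chart_weight n (n + 2) + (\<Sum>j\<in>diag_indices n. chart_weight n j))) (inv_disc n \<Omega>)"
    by (rule hom_on_gen) (simp add: inv_disc_eq restr_def)
  then show "H (- (2 * (weight_unit n * int (n + 2)) + (\<Sum>j\<in>diag_indices n. chart_weight n j)))
      (restr X (\<lambda>x. - 1 / (pt_b x * disc x * diag_prod x)))"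
    by (simp only: inv_disc_eq chart_weight_last)
qed

lemma H_disc: "H (weight_unit n * int (n + 2)) disc"
proof -
  have "H (weight_unit n * int (n + 2)) (\<lambda>x. pt_a x ^ (n + 2))"
    by (rule hom_on_power'[OF H_a]) simp
  from hom_on_diff[OF this H_b] show ?thesis by (rule hom_onI) (simp_all add: disc_def)
qed

lemma H_diag_prod: "H (\<Sum>j\<in>diag_indices n. chart_weight n j) diag_prod"
  unfolding diag_prod_def[abs_def] by (rule hom_on_prod) (rule H_chart_diag)

text \<open>The generator inverts only the product of t_{n+2}, the discriminant and the diagonal
  coordinates, up to sign; multiplying the other factors back isolates a single inverse.\<close>

lemma H_inverse_disc: "H (- (weight_unit n * int (n + 2))) (\<lambda>x. 1 / disc x)"
proof -
  note hom_on_mult[OF hom_on_uminus[OF hom_on_mult[OF H_b H_diag_prod]] H_inv]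
  then show ?thesis
    by (rule hom_onI) (use b_nonzero diag_prod_nonzero in auto)
qed

lemma H_inverse_chart_diag:
  assumes "j \<in> diag_indices n"
  shows "H (- chart_weight n j) (\<lambda>x. 1 / s (row j) (row j) x)"
proof -
  let ?P = "\<lambda>x. \<Prod>i\<in>diag_indices n - {j}. s (row i) (row i) x"
  have P: "diag_prod x = s (row j) (row j) x * ?P x" for x
    unfolding diag_prod_def using finite_diag assms by (rule prod.remove)
  have w: "(\<Sum>i\<in>diag_indices n. chart_weight n i) = chart_weight n j + (\<Sum>i\<in>diag_indices n - {j}. chart_weight n i)"
    using finite_diag assms by (rule sum.remove)
  have "H (\<Sum>i\<in>diag_indices n - {j}. chart_weight n i) ?P"
    by (rule hom_on_prod) (auto intro: H_chart_diag)
  note hom_on_mult[OF hom_on_uminus[OF hom_on_mult[OF hom_on_mult[OF H_b H_disc] this]] H_inv]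
  then show ?thesis
  proof (rule hom_onI)
    fix x assume x: "x \<in> X"
    have "?P x \<noteq> 0" using diag_prod_nonzero[OF x] P by auto
    then show "- (pt_b x * disc x * ?P x) * (- 1 / (pt_b x * disc x * diag_prod x)) = 1 / s (row j) (row j) x"
      using b_nonzero[OF x] disc_nonzero[OF x] unfolding P by simp
  qed (simp add: w)
qed

lemma H_om:
  assumes "i \<in> {1..n+1}" "j \<in> {1..n+1}"
  shows "H (- weight_unit n * int (i + j)) (om i j)"
proof -
  let ?p = "\<lambda>x. (pt_a x, pt_b x)"
  let ?f = "restr (base_points n) (\<lambda>(a, b). ent (\<Omega> a b) i j)"
  have "H (weight_unit n * - int (i + j)) (\<lambda>x. ?f (?p x))"
  proof (rule homogeneous_pullback[where p = ?p and f = ?f and U = "base_points n" and V = "base_gens n"])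
    show "homogeneous (base_points n) (base_gens n) (- int (i + j)) ?f"
      using Omega_base_hom[OF \<Omega> assms] by (simp only: hom_on_def)
    fix g w assume "(g, w) \<in> base_gens n"
    then consider "g = restr (base_points n) (\<lambda>(a, b). a)" "w = 1"
      | "g = restr (base_points n) (\<lambda>(a, b). 1 / (a ^ (n + 2) - b))" "w = - int (n + 2)"
      by (auto simp: base_gens_def)
    then show "H (weight_unit n * w) (\<lambda>x. g (?p x))"
    proof cases
      case 1
      show ?thesis using H_a by (rule hom_onI) (simp_all add: 1 restr_in in_X)
    next
      case 2
      show ?thesis using H_inverse_disc
        by (rule hom_onI) (use in_X(1) in \<open>simp_all add: 2 restr_in disc_def algebra_simps\<close>)
    qed
  qed (rule in_X(1))
  then show ?thesis by (rule hom_onI) (simp_all add: restr_in in_X om_eq algebra_simps)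
qed

lemma diag_index:
  assumes "2 \<le> i" "2 * i < n + 2"
  obtains j where "j \<in> diag_indices n" "row j = i" "chart_weight n j = entry_weight n i i"
proof -
  have "i + i \<le> 2 * half_dim n + 1" using assms half_dim_cases[of n] by (auto split: if_splits)
  then obtain j where j: "j \<in> inner_indices n" "row j = i" "col j = i"
    using position_index[of i i] assms by auto
  show ?thesis by (rule that[of j]) (use j chart_weight_inner[OF j(1)] in \<open>auto simp: diag_indices_eq\<close>)
qed

lemma H_inverse_small_diag:
  assumes "1 \<le> i" "2 * i < n + 2"
  shows "H (- entry_weight n i i) (\<lambda>x. 1 / s i i x)"
proof (cases "i = 1")
  case True
  show ?thesis using hom_on_const[of X W\<^sub>0 1]
    by (rule hom_onI) (use True in_X(3) entry_weight_1_1[OF n_pos] in auto)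
next
  case False
  then obtain j where "j \<in> diag_indices n" "row j = i" "chart_weight n j = entry_weight n i i"
    using diag_index[of i] assms by auto
  with H_inverse_chart_diag[of j] show ?thesis by simp
qed

lemma row_weight_complement:
  "i \<in> {1..n+1} \<Longrightarrow> row_weight n (n + 2 - i) = - row_weight n i"
  using row_weight_reflect[OF n_pos, of i "n + 2 - i"] by auto

text \<open>Above the middle s_ii is a coordinate (or 1), in the middle it is u. Below the middle
  \<open>diag_relation\<close> makes it a constant times the discriminant over s_qq, with q = n + 2
  - i above the middle.\<close>

lemma H_diag:
  assumes i: "i \<in> {1..n+1}"
  shows "H (entry_weight n i i) (s i i)"
proof -
  consider "i = 1" | "2 \<le> i" "2 * i < n + 2" | "2 * i = n + 2" | "2 * i > n + 2" using i by fastforce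
  then show ?thesis
  proof cases
    case 1
    show ?thesis using hom_on_const[of X W\<^sub>0 1]
      by (rule hom_onI) (use 1 in_X(3) entry_weight_1_1[OF n_pos] in auto)
  next
    case 2
    then obtain j where "j \<in> diag_indices n" "row j = i" "chart_weight n j = entry_weight n i i"
      by (rule diag_index)
    with H_chart_diag[of j] show ?thesis by simp
  next
    case 3
    then have "even n" by presburger
    then show ?thesis using 3 by (intro H_u) auto
  next
    case 4
    define q where "q = n + 2 - i"
    define K where "K = (- 1) ^ (i - 1) * ((- of_nat (n + 2)) ^ n * c)"
    have q: "q \<in> {1..n+1}" "i + q = n + 2" "1 \<le> q" "2 * q < n + 2" using i 4 by (auto simp: q_def)
    define N :: complex where "N = of_nat (n + 2)"
    have "N \<noteq> 0" unfolding N_def of_nat_eq_0_iff by simp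
    then have K: "K \<noteq> 0" using c_nonzero unfolding K_def N_def[symmetric] by simp
    have "H (weight_unit n * int (n + 2) + - entry_weight n q q)
        (\<lambda>x. Phi_sign n i / K * (disc x * (1 / s q q x)))"
      by (intro hom_on_scale hom_on_mult H_disc H_inverse_small_diag q)
    then show ?thesis
    proof (rule hom_onI)
      fix x assume x: "x \<in> X"
      have "om i q x = K * (1 / disc x)"
        using om_antidiagonal[OF x i] by (simp only: K_def q_def)
      then have "s i i x * (K * (1 / disc x)) * s q q x = Phi_sign n i"
        using diag_relation[OF x i q(1,2)] by simp
      then show "Phi_sign n i / K * (disc x * (1 / s q q x)) = s i i x"
        using K disc_nonzero[OF x] s_diag_nonzero[OF x q(1)] by (simp add: field_simps)
    next
      have "row_weight n q = - row_weight n i" using row_weight_complement[OF i] by (simp add: q_def)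
      moreover have "int (n + 2) = int i + int q" using q(2) by simp
      ultimately show "weight_unit n * int (n + 2) + - entry_weight n q q = entry_weight n i i"
        by (simp only: entry_weight_def) (simp add: algebra_simps)
    qed
  qed
qed

text \<open>The relation s_ii \<Omega>_iq s_qq = \<plusminus>1 exhibits the inverse of s_ii as
  \<plusminus>\<Omega>_iq s_qq.\<close>

lemma H_inverse_diag:
  assumes i: "i \<in> {1..n+1}"
  shows "H (- entry_weight n i i) (\<lambda>x. 1 / s i i x)"
proof -
  define q where "q = n + 2 - i"
  have q: "q \<in> {1..n+1}" "i + q = n + 2" using i by (auto simp: q_def)
  have "H (- weight_unit n * int (i + q) + entry_weight n q q) (\<lambda>x. Phi_sign n i * (om i q x * s q q x))"
    by (intro hom_on_scale hom_on_mult H_om H_diag i q)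
  then show ?thesis
  proof (rule hom_onI)
    fix x assume x: "x \<in> X"
    have "Phi_sign n i * (om i q x * s q q x) * s i i x = Phi_sign n i * (s i i x * om i q x * s q q x)"
      by simp
    also have "\<dots> = 1" using diag_relation[OF x i q] by simp
    finally show "Phi_sign n i * (om i q x * s q q x) = 1 / s i i x"
      using s_diag_nonzero[OF x i] by (simp add: field_simps)
  next
    have "row_weight n q = - row_weight n i" using row_weight_complement[OF i] by (simp add: q_def)
    then show "- weight_unit n * int (i + q) + entry_weight n q q = - entry_weight n i i"
      by (simp add: entry_weight_def algebra_simps)
  qed
qed

section \<open>The entries of exp(-t_2 g) S are free of t_2\<close>

lemma H_gram_terms:
  assumes "\<And>k. k \<in> K \<Longrightarrow> k \<in> {1..n+1} \<and> H (entry_weight n i k) (sig i k)"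
    and "\<And>l. l \<in> L \<Longrightarrow> l \<in> {1..n+1} \<and> H (entry_weight n q l) (sig q l)"
  shows "H (row_weight n i + row_weight n q) (\<lambda>x. \<Sum>k\<in>K. \<Sum>l\<in>L. sig i k x * om k l x * sig q l x)"
proof (intro hom_on_sum)
  fix k l assume "k \<in> K" "l \<in> L"
  with assms have "H (entry_weight n i k) (sig i k)" "H (entry_weight n q l) (sig q l)"
    "k \<in> {1..n+1}" "l \<in> {1..n+1}" by blast+
  then have "H (entry_weight n i k + - weight_unit n * int (k + l) + entry_weight n q l)
      (\<lambda>x. sig i k x * om k l x * sig q l x)" by (intro hom_on_mult H_om)
  then show "H (row_weight n i + row_weight n q) (\<lambda>x. sig i k x * om k l x * sig q l x)"
    by (rule hom_onI) (simp_all add: entry_weight_def algebra_simps)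
qed

text \<open>This is \<open>form_lower\<close> where the entry of \<Phi> is zero. The coefficient
  \<Omega>_jq s_qq of the unknown is \<plusminus>1/s_jj by \<open>diag_relation\<close>, so dividing
  by it amounts to multiplying by \<plusminus>s_jj.\<close>

lemma sig_off_antidiagonal:
  assumes x: "x \<in> X" and i: "i \<in> {1..n+1}" and j: "j \<in> {1..n+1}" and q: "q \<in> {1..n+1}"
    and jq: "j + q = n + 2" and ij: "i \<noteq> j"
  shows "sig i j x = - Phi_sign n j * (s j j x
    * (\<Sum>k\<in>{j+1..n+1}. \<Sum>l\<in>{1..n+1}. sig i k x * om k l x * sig q l x))"
proof -
  let ?T = "\<Sum>k\<in>{j+1..n+1}. \<Sum>l\<in>{1..n+1}. sig i k x * om k l x * sig q l x"
  have "0 = sig i j x * om j q x * s q q x + ?T"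
    using form_lower[OF x i q j jq] ent_Phi[OF i q] ij jq by (simp add: sig_diag[OF x q])
  then have "sig i j x * (om j q x * s q q x) = - ?T"
    by (simp add: mult.assoc eq_neg_iff_add_eq_0)
  then have "Phi_sign n j * s j j x * (sig i j x * (om j q x * s q q x)) = Phi_sign n j * s j j x * - ?T"
    by simp
  moreover have "Phi_sign n j * s j j x * (sig i j x * (om j q x * s q q x))
      = Phi_sign n j * (s j j x * om j q x * s q q x) * sig i j x" by simp
  ultimately show ?thesis using diag_relation[OF x j q jq] by simp
qed

text \<open>In the relation of row i with itself the unknown entry (i, j) occurs twice, for (k, l) =
  (j, i) and (i, j). For even n the form is symmetric and the two add up, whence the 1/2. For odd n
  they would cancel, and there these entries belong to the chart.\<close>

lemma sig_even_antidiagonal: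
  assumes x: "x \<in> X" and i: "i \<in> {1..n+1}" and j: "j \<in> {1..n+1}" and ij: "j < i" "i + j = n + 2" and n: "even n"
  shows "sig i j x = - Phi_sign n j / 2 * (s j j x
    * (\<Sum>k\<in>{j+1..n+1}. \<Sum>l\<in>{j+1..n+1}. sig i k x * om k l x * sig i l x))"
proof -
  let ?T = "\<Sum>k\<in>{j+1..n+1}. \<Sum>l\<in>{j+1..n+1}. sig i k x * om k l x * sig i l x"
  have ji: "j + i = n + 2" using ij by simp
  have "(\<Sum>l\<in>{1..n+1}. sig i k x * om k l x * sig i l x)
      = (if k = i then sig i i x * om i j x * sig i j x else 0)
        + (\<Sum>l\<in>{j+1..n+1}. sig i k x * om k l x * sig i l x)" if k: "k \<in> {j+1..n+1}" for k
  proof -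
    let ?f = "\<lambda>l. sig i k x * om k l x * sig i l x"
    have k': "k \<in> {1..n+1}" using k by auto
    have z: "?f l = 0" if l: "l \<in> {1..n+1}" "l < j \<or> (l = j \<and> k \<noteq> i)" for l
    proof (cases "i < k")
      case True
      then show ?thesis using sig_upper[OF x i k'] by simp
    next
      case False
      have "om k l x = 0" by (rule om_zero[OF x k' l(1)]) (use False l ij in auto)
      then show ?thesis by simp
    qed
    have "sum ?f {1..n+1} = sum ?f {j..n+1}"
    proof (rule sum.mono_neutral_right)
      show "\<forall>l\<in>{1..n+1} - {j..n+1}. ?f l = 0" by (intro ballI z) auto
    qed (use j in auto)
    also have "\<dots> = ?f j + sum ?f {j+1..n+1}"
      using sum.atLeast_Suc_atMost[of j "n + 1" ?f] j by simp
    also have "?f j = (if k = i then sig i i x * om i j x * sig i j x else 0)"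
      using z[OF j] by auto
    finally show ?thesis .
  qed
  then have "(\<Sum>k\<in>{j+1..n+1}. \<Sum>l\<in>{1..n+1}. sig i k x * om k l x * sig i l x)
      = (\<Sum>k\<in>{j+1..n+1}. (if k = i then sig i i x * om i j x * sig i j x else 0)
        + (\<Sum>l\<in>{j+1..n+1}. sig i k x * om k l x * sig i l x))"
    by (rule sum.cong[OF refl])
  also have "\<dots> = sig i i x * om i j x * sig i j x + ?T"
    using i ij by (simp add: sum.distrib)
  finally have sums: "(\<Sum>k\<in>{j+1..n+1}. \<Sum>l\<in>{1..n+1}. sig i k x * om k l x * sig i l x)
      = sig i i x * om i j x * sig i j x + ?T" .
  have "ent (Phi n) i i = 0" using ent_Phi[OF i i] ij by simp
  then have "0 = sig i j x * om j i x * s i i x + (s i i x * om i j x * sig i j x + ?T)"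
    using form_lower[OF x i i j ji] unfolding sums sig_diag[OF x i] by (simp only:)
  moreover have "om i j x = om j i x"
  proof -
    have e: "even (i - 1) \<longleftrightarrow> even (j - 1)" using i j ij n by auto presburger+
    have "n + 2 - i = j" "n + 2 - j = i" using ij(2) by auto
    then have "om i j x = om i (n + 2 - i) x" "om j i x = om j (n + 2 - j) x" by simp_all
    then show ?thesis unfolding om_antidiagonal[OF x i] om_antidiagonal[OF x j]
      using e by (simp add: minus_one_power_iff)
  qed
  ultimately have "2 * (om j i x * s i i x) * sig i j x = - ?T"
    by (simp add: eq_neg_iff_add_eq_0 algebra_simps)
  then have "Phi_sign n j * s j j x * (2 * (om j i x * s i i x) * sig i j x) = Phi_sign n j * s j j x * - ?T"
    by simp
  moreover have "Phi_sign n j * s j j x * (2 * (om j i x * s i i x) * sig i j x)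
      = 2 * (Phi_sign n j * (s j j x * om j i x * s i i x)) * sig i j x" by simp
  ultimately have "2 * sig i j x = Phi_sign n j * s j j x * - ?T"
    unfolding diag_relation[OF x j i ji] Phi_sign_square by (simp only: mult_1_right)
  moreover have "u = - p / 2 * (v * t)" if "2 * u = p * v * - t" for u p v t :: complex
  proof -
    have "u = 2 * u / 2" by simp
    then show ?thesis unfolding that by simp
  qed
  ultimately show ?thesis by blast
qed

text \<open>Recursion over the rows from the top, and in each row from right to left; the measure
  encodes this order. The chart supplies the entries with i + j \<le> 2q + 1, q =
  \<open>half_dim n\<close>, the Gram relations the others. For i + j > n + 2 the relation is taken
  with row n + 2 - j, which lies above row i.\<close>

lemma H_sig:
  assumes "i \<in> {1..n+1}" "j \<in> {1..n+1}" "\<not> exceptional i j"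
  shows "H (entry_weight n i j) (sig i j)"
  using assms
proof (induction "i * (n + 2) + (n + 1 - j)" arbitrary: i j rule: less_induct)
  case less
  note i = less.prems(1) and j = less.prems(2)
  have IH1: "l \<in> {1..n+1} \<and> H (entry_weight n q l) (sig q l)"
    if "q \<in> {1..n+1}" "q < i" "l \<in> {1..n+1}" for q l
  proof -
    have "Suc q * (n + 2) \<le> i * (n + 2)" using that(2) by (intro mult_right_mono) auto
    then have "q * (n + 2) + (n + 1 - l) < i * (n + 2) + (n + 1 - j)" by simp
    moreover have "\<not> exceptional q l" using that i by (auto simp: exceptional_def)
    ultimately show ?thesis using less.hyps[of q l] that by blast
  qed
  have IH2: "k \<in> {1..n+1} \<and> H (entry_weight n i k) (sig i k)" if "k \<in> {j+1..n+1}" for k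
  proof -
    have "i * (n + 2) + (n + 1 - k) < i * (n + 2) + (n + 1 - j)" using that by auto
    moreover have "\<not> exceptional i k" using that j by (auto simp: exceptional_def)
    moreover have "k \<in> {1..n+1}" using that j by auto
    ultimately show ?thesis using less.hyps[of i k] i by blast
  qed
  consider "i < j" | "i = j" | "i = 2" "j = 1"
    | "j < i" "(i, j) \<noteq> (2, 1)" "i + j \<le> 2 * half_dim n + 1"
    | "j < i" "i + j = n + 2" "even n" | "j < i" "i + j > n + 2"
  proof -
    have "i + j > 2 * half_dim n + 1 \<Longrightarrow> i + j > n + 2 \<or> even n \<and> i + j = n + 2"
      using half_dim_cases[of n] by (auto split: if_splits)
    then show ?thesis using that by fastforce
  qed
  then show ?case
  proof cases
    case 1
    show ?thesis using hom_on_zero by (rule hom_onI) (use 1 sig_upper[OF _ i j] in auto)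
  next
    case 2
    show ?thesis using H_diag[OF i] by (rule hom_onI) (use 2 sig_diag[OF _ i] in auto)
  next
    case 3
    \<comment> \<open>The place of t_2 itself: the entry is zero by the choice of exp(-t_2
      g).\<close>
    show ?thesis using hom_on_zero by (rule hom_onI) (use 3 sig_2_1 in auto)
  next
    case 4
    then obtain t where t: "t \<in> inner_indices n" "row t = i" "col t = j"
      using position_index[of i j] i j by auto
    then have "t \<noteq> 2" using 4(2) chart_pos_2[OF n_pos] by auto
    then show ?thesis using H_chart_sig[of t] t less.prems(3) by simp
  next
    case 5
    have "H (entry_weight n j j + (row_weight n i + row_weight n i)) (\<lambda>x. - Phi_sign n j / 2 * (s j j x
        * (\<Sum>k\<in>{j+1..n+1}. \<Sum>l\<in>{j+1..n+1}. sig i k x * om k l x * sig i l x)))"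
      by (intro hom_on_scale hom_on_mult H_diag j H_gram_terms IH2)
    then show ?thesis
      by (rule hom_onI) (use 5 sig_even_antidiagonal[OF _ i j] row_weight_reflect[OF n_pos 5(2) i]
        in \<open>auto simp: entry_weight_def\<close>)
  next
    case 6
    define q where "q = n + 2 - j"
    have q: "q \<in> {1..n+1}" "j + q = n + 2" "q < i" using j 6 by (auto simp: q_def)
    have "H (entry_weight n j j + (row_weight n i + row_weight n q)) (\<lambda>x. - Phi_sign n j * (s j j x
        * (\<Sum>k\<in>{j+1..n+1}. \<Sum>l\<in>{1..n+1}. sig i k x * om k l x * sig q l x)))"
      by (intro hom_on_scale hom_on_mult H_diag j H_gram_terms IH2 IH1 q)
    then show ?thesis
      by (rule hom_onI) (use 6 sig_off_antidiagonal[OF _ i j q(1,2)] row_weight_reflect[OF n_pos q(2) j]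
        in \<open>auto simp: entry_weight_def\<close>)
  qed
qed

end


section \<open>The torus action and the Euler operator\<close>

context dwork
begin

text \<open>The field H integrated to an action of the multiplicative group: row i of S is scaled by
  z to its row weight, column j by z^(h j).\<close>

definition act :: "complex \<Rightarrow> point \<Rightarrow> point" where
  "act z x = (z powi weight_unit n * pt_a x, z powi (weight_unit n * int (n + 2)) * pt_b x,
     mat1 (n + 1) (\<lambda>i j. z powi entry_weight n i j * s i j x))"

lemma pt_act:
  "pt_a (act z x) = z powi weight_unit n * pt_a x"
  "pt_b (act z x) = z powi (weight_unit n * int (n + 2)) * pt_b x"
  "i \<in> {1..n+1} \<Longrightarrow> j \<in> {1..n+1} \<Longrightarrow> s i j (act z x) = z powi entry_weight n i j * s i j x"
  by (simp add: act_def pt_a_def, simp add: act_def pt_b_def,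
    simp only: act_def pt_s_def prod.case ent_mat1)

lemma power_weight_unit: "(z powi weight_unit n) ^ k = z powi (weight_unit n * int k)" for z :: complex
  by (rule power_int_power')

lemma disc_act: "disc (act z x) = z powi (weight_unit n * int (n + 2)) * disc x"
  unfolding disc_def pt_act power_mult_distrib power_weight_unit by (simp add: algebra_simps)

lemma act_base:
  assumes "z \<noteq> 0" "x \<in> X"
  shows "(pt_a (act z x), pt_b (act z x)) \<in> base_points n"
proof -
  have "disc (act z x) \<noteq> 0" "pt_b (act z x) \<noteq> 0"
    using assms disc_nonzero b_nonzero by (auto simp: disc_act pt_act)
  then show ?thesis by (simp add: base_points_def disc_def)
qed

text \<open>Homogeneity of \<Omega> on the base, evaluated for the scaling by u = z^h.\<close>

lemma om_act:
  assumes z: "z \<noteq> 0" and x: "x \<in> X" and i: "i \<in> {1..n+1}" and j: "j \<in> {1..n+1}"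
  shows "om i j (act z x) = z powi (- weight_unit n * int (i + j)) * om i j x"
proof -
  define u where "u = z powi weight_unit n"
  have u: "u \<noteq> 0" using z by (simp add: u_def)
  let ?g = "\<lambda>(a, b). (u * a, u ^ (n + 2) * b)"
  let ?f = "restr (base_points n) (\<lambda>(a, b). ent (\<Omega> a b) i j)"
  have g: "?g p \<in> base_points n" if "p \<in> base_points n" for p
  proof -
    obtain a b where p: "p = (a, b)" by (cases p)
    have "(u * a) ^ (n + 2) - u ^ (n + 2) * b = u ^ (n + 2) * (a ^ (n + 2) - b)"
      unfolding power_mult_distrib by (simp only: right_diff_distrib)
    then show ?thesis using that u unfolding p base_points_def mem_Collect_eq prod.case by simp
  qed
  let ?p = "(pt_a x, pt_b x)"
  have p: "?p \<in> base_points n" by (rule in_X(1)[OF x])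
  have "?f (?g ?p) = u powi (- int (i + j)) * ?f ?p"
  proof (rule homogeneous_scaling[OF _ u p g])
    show "homogeneous (base_points n) (base_gens n) (- int (i + j)) ?f"
      using Omega_base_hom[OF \<Omega> i j] by (simp only: hom_on_def)
    fix h w q assume h: "(h, w) \<in> base_gens n" and q: "q \<in> base_points n"
    obtain a b where ab: "q = (a, b)" by (cases q)
    have d: "(u * a) ^ (n + 2) - u ^ (n + 2) * b = u ^ (n + 2) * (a ^ (n + 2) - b)"
      unfolding power_mult_distrib by (simp only: right_diff_distrib)
    from h consider "h = restr (base_points n) (\<lambda>(a, b). a)" "w = 1"
      | "h = restr (base_points n) (\<lambda>(a, b). 1 / (a ^ (n + 2) - b))" "w = - int (n + 2)"
      by (auto simp: base_gens_def)
    then show "h (?g q) = u powi w * h q"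
    proof cases
      case 1
      then show ?thesis using q g[OF q] by (simp add: restr_in ab)
    next
      case 2
      have "h (?g q) = 1 / ((u * a) ^ (n + 2) - u ^ (n + 2) * b)"
        using g[OF q] unfolding 2 by (simp only: restr_in ab prod.case)
      also have "\<dots> = inverse (u ^ (n + 2)) * (1 / (a ^ (n + 2) - b))"
        unfolding d by (simp only: divide_inverse inverse_mult_distrib mult_1_left)
      also have "inverse (u ^ (n + 2)) = u powi w"
        unfolding 2(2) power_int_minus power_int_of_nat ..
      finally show ?thesis using q unfolding 2(1) by (simp only: restr_in ab prod.case)
    qed
  qed
  moreover have "?g ?p = (pt_a (act z x), pt_b (act z x))"
    by (simp only: prod.case pt_act u_def power_weight_unit)
  moreover have "u powi (- int (i + j)) = z powi (- weight_unit n * int (i + j))"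
    unfolding u_def power_int_mult[symmetric] by (simp add: algebra_simps)
  ultimately show ?thesis
    using p act_base[OF z x] by (simp only: restr_in prod.case om_eq)
qed

text \<open>The Gram entry (i, j) is multiplied by z to the sum of the two row weights. For i + j =
  n + 2 that sum is zero; otherwise the entry of \<Phi> is zero.\<close>

lemma act_in_X:
  assumes z: "z \<noteq> 0" and x: "x \<in> X"
  shows "act z x \<in> X"
proof -
  let ?S = "mat1 (n + 1) (\<lambda>i j. z powi entry_weight n i j * s i j x)"
  let ?a = "z powi weight_unit n * pt_a x" and ?b = "z powi (weight_unit n * int (n + 2)) * pt_b x"
  have e: "act z x = (?a, ?b, ?S)" by (simp add: act_def)
  have S: "ent ?S i j = z powi entry_weight n i j * s i j x"
    if "i \<in> {1..n+1}" "j \<in> {1..n+1}" for i j using that by (rule ent_mat1)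
  have gr: "form (act z x) (\<lambda>k. s i k (act z x)) (\<lambda>k. s j k (act z x)) = ent (Phi n) i j"
    if i: "i \<in> {1..n+1}" and j: "j \<in> {1..n+1}" for i j
  proof -
    have "s i k (act z x) * om k l (act z x) * s j l (act z x)
        = z powi (row_weight n i + row_weight n j) * (s i k x * om k l x * s j l x)"
      if k: "k \<in> {1..n+1}" and l: "l \<in> {1..n+1}" for k l
    proof -
      have "row_weight n i + row_weight n j
          = entry_weight n i k + - weight_unit n * int (k + l) + entry_weight n j l"
        by (simp add: entry_weight_def algebra_simps)
      then have "z powi (row_weight n i + row_weight n j)
          = z powi entry_weight n i k * z powi (- weight_unit n * int (k + l)) * z powi entry_weight n j l"
        using z by (simp only: power_int_add simp_thms)
      then show ?thesis unfolding pt_act(3)[OF i k] pt_act(3)[OF j l] om_act[OF z x k l]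
        by (simp only: mult_ac)
    qed
    then have "form (act z x) (\<lambda>k. s i k (act z x)) (\<lambda>k. s j k (act z x))
        = z powi (row_weight n i + row_weight n j) * form x (\<lambda>k. s i k x) (\<lambda>k. s j k x)"
      unfolding gram_def sum_distrib_left by (intro sum.cong refl) blast
    also have "\<dots> = ent (Phi n) i j"
      using row_weight_reflect[OF n_pos _ i, of j] unfolding in_X(4)[OF x i j] ent_Phi[OF i j] by simp
    finally show ?thesis .
  qed
  show ?thesis
    unfolding e moduli_iff
  proof (intro conjI ballI impI)
    show "(?a, ?b) \<in> base_points n" using act_base[OF z x] by (simp only: pt_act)
    show "?S \<in> carrier_mat (n + 1) (n + 1)" by (simp add: mat1_def)
    show "ent ?S i j = 0" if "i \<in> {1..n+1}" "j \<in> {1..n+1}" "i < j" for i j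
      using S[OF that(1,2)] in_X(2)[OF x that] by simp
    show "ent ?S 1 1 = 1"
      using S[of 1 1] in_X(3)[OF x] entry_weight_1_1[OF n_pos] by simp
    show "form (?a, ?b, ?S) (\<lambda>k. s i k (?a, ?b, ?S)) (\<lambda>k. s j k (?a, ?b, ?S)) = ent (Phi n) i j"
      if "i \<in> {1..n+1}" "j \<in> {1..n+1}" for i j
      using gr[OF that] by (simp only: e)
  qed
qed

lemma inner_act:
  assumes "j \<in> inner_indices n"
  shows "s (row j) (col j) (act z x) = z powi chart_weight n j * s (row j) (col j) x"
  unfolding chart_weight_inner[OF assms] by (rule pt_act(3)) (use position[OF assms] in auto)

lemma generators_act:
  assumes g: "(g, w) \<in> W" and z: "z \<noteq> 0" and x: "x \<in> X"
  shows "g (act z x) = z powi w * g x"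
  using g
proof (cases rule: generator_cases)
  case (1 j)
  note ax = act_in_X[OF z x]
  show ?thesis
  proof (cases "shifted j")
    case True
    then have n: "odd n" "n \<ge> 3" "j = moduli_dim n" by (simp_all add: shifted_def)
    have j: "j \<in> inner_indices n" using last_in_inner[OF n(2)] n by simp
    have w: "w = entry_weight n (n + 1) 1"
      using chart_weight_inner[OF j] chart_pos_last(1)[OF n(1,2)] unfolding 1(3) n(3) by simp
    \<comment> \<open>The two summands of the replaced coordinate have equal weight, so it is an
      eigenfunction of the action like the others.\<close>
    have "entry_weight n (n + 1) 1 = entry_weight n 2 1 + entry_weight n n 1"
      using n by (simp add: entry_weight_def row_weight_def weight_unit_def)
    then have "z powi w = z powi entry_weight n 2 1 * z powi entry_weight n n 1"
      unfolding w using z by (simp add: power_int_add)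
    moreover have "s (n + 1) 1 (act z x) = z powi w * s (n + 1) 1 x" unfolding w by (rule pt_act(3)) auto
    moreover have "s 2 1 (act z x) = z powi entry_weight n 2 1 * s 2 1 x" by (rule pt_act(3)) (use n in auto)
    moreover have "s n 1 (act z x) = z powi entry_weight n n 1 * s n 1 x" by (rule pt_act(3)) (use n in auto)
    moreover have "p * q * u + p * v * (q * y) = p * q * (u + v * y)" for p q u v y :: complex
      by (simp add: algebra_simps)
    ultimately show ?thesis
      unfolding 1(2) chart_coord_eq using True by (simp only: restr_in[OF x] restr_in[OF ax] if_True)
  next
    case False
    have "j = 1 \<or> j = n + 2 \<or> j \<in> inner_indices n" using 1(1) chart_indices_eq[OF n_pos] by auto
    then show ?thesis
    proof (elim disjE)
      assume j: "j = 1"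
      show ?thesis using False
        by (simp only: 1(2,3) j chart_coord_eq if_False coord_1 chart_weight_1 restr_in[OF x] restr_in[OF ax] pt_act)
    next
      assume j: "j = n + 2"
      show ?thesis using False
        by (simp only: 1(2,3) j chart_coord_eq if_False coord_last chart_weight_last restr_in[OF x] restr_in[OF ax] pt_act)
    next
      assume j: "j \<in> inner_indices n"
      show ?thesis using False
        by (simp only: 1(2,3) chart_coord_eq if_False coord_inner[OF j] restr_in[OF x] restr_in[OF ax] inner_act[OF j])
    qed
  qed
next
  case 2
  have "(n + 2) div 2 \<in> {1..n+1}" using n_pos by auto
  from pt_act(3)[OF this this] show ?thesis
    by (simp only: 2(2,3) coord_u_eq restr_in[OF x] restr_in[OF act_in_X[OF z x]] u_weight_eq[OF 2(1)])
next
  case 3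
  let ?w = "weight_unit n * int (n + 2)"
  have "diag_prod (act z x) = z powi (\<Sum>j\<in>diag_indices n. chart_weight n j) * diag_prod x"
  proof -
    have "s (row j) (row j) (act z x) = z powi chart_weight n j * s (row j) (row j) x"
      if "j \<in> diag_indices n" for j
      using inner_act[of j] that by (simp add: diag_indices_eq)
    moreover have "(\<Prod>j\<in>J. z powi chart_weight n j) = z powi (\<Sum>j\<in>J. chart_weight n j)" for J
      using z by (induction J rule: infinite_finite_induct) (simp_all add: power_int_add)
    ultimately show ?thesis by (simp add: diag_prod_def prod.distrib)
  qed
  moreover have "z powi w = inverse (z powi ?w * z powi ?w * z powi (\<Sum>j\<in>diag_indices n. chart_weight n j))"
  proof -
    have "z powi (- (2 * k + l)) = inverse (z powi k * z powi k * z powi l)" for k l :: int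
      unfolding power_int_minus mult_2 power_int_add[OF disjI1[OF z]] ..
    then show ?thesis unfolding 3(2) chart_weight_last .
  qed
  moreover have "- 1 / (p * u * (p * v) * (q * y)) = inverse (p * p * q) * (- 1 / (u * v * y))"
    for p q u v y :: complex by (simp add: divide_inverse mult_ac)
  ultimately show ?thesis
    unfolding 3(1) inv_disc_eq restr_in[OF x] restr_in[OF act_in_X[OF z x]] disc_act pt_act
    by (simp only:)
qed

lemma homogeneous_act:
  assumes "homogeneous X W r f" "z \<noteq> 0" "x \<in> X"
  shows "f (act z x) = z powi r * f x"
  by (rule homogeneous_scaling[OF assms act_in_X[OF assms(2)] generators_act[OF _ assms(2)]])

section \<open>Modular forms of positive weight\<close>

lemma homogeneous_W0_iff: "homogeneous X W\<^sub>0 r f \<longleftrightarrow> H r f \<and> (\<forall>x. x \<notin> X \<longrightarrow> f x = 0)"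
  by (rule homogeneous_iff_hom_on) (use generators_outside W0_subset in blast)

text \<open>An element of the left side is a polynomial in the generators without t_2, and
  separately a homogeneous expression in all generators. The torus action merges the two: it is a
  homogeneous expression in the generators without t_2.\<close>

lemma positive_modular_part_eq:
  assumes "r > 0"
  shows "positive_modular_part opt n \<Omega> r = {f. homogeneous X W\<^sub>0 (int r) f}"
proof -
  have "homogeneous X W\<^sub>0 (int r) f"
    if "f \<in> generated_algebra X (fst ` W\<^sub>0)" "homogeneous X W (int r) f" for f
    by (rule homogeneous_component[OF W0_subset that, where act = act])
      (use act_in_X generators_act generators_outside in blast)+
  moreover have "f \<in> generated_algebra X (fst ` W\<^sub>0)" "homogeneous X W (int r) f"
    if "homogeneous X W\<^sub>0 (int r) f" for f
    using homogeneous_in_generated_algebra[OF that] homogeneous_mono[OF that W0_subset] by auto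
  ultimately show ?thesis
    using assms unfolding positive_modular_part_def modular_forms_def quasi_modular_part_def by auto
qed

section \<open>The graded pieces and the Euler operator\<close>

abbreviation M :: "nat \<Rightarrow> (point \<Rightarrow> complex) set" where
  "M \<equiv> positive_modular_part opt n \<Omega>"

lemma M_0: "M 0 = range (const_on X)"
  by (simp add: positive_modular_part_def)

lemma M_homogeneous: "f \<in> M r \<Longrightarrow> homogeneous X W\<^sub>0 (int r) f"
proof (cases "r = 0")
  case True
  then show "f \<in> M r \<Longrightarrow> ?thesis" by (auto simp: M_0 intro: homogeneous.const)
qed (simp add: positive_modular_part_eq)

lemma M_add: "f \<in> M r \<Longrightarrow> g \<in> M r \<Longrightarrow> (\<lambda>x. f x + g x) \<in> M r"
proof (cases "r = 0")
  case True
  have "(\<lambda>x. const_on X a x + const_on X b x) = const_on X (a + b)" for a b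
    by (auto simp: const_on_def)
  then show "f \<in> M r \<Longrightarrow> g \<in> M r \<Longrightarrow> ?thesis" using True by (auto simp: M_0)
next
  case False
  then show "f \<in> M r \<Longrightarrow> g \<in> M r \<Longrightarrow> ?thesis"
    using homogeneous.add[of X W\<^sub>0 "int r" f g] by (simp add: positive_modular_part_eq plus_fun_def)
qed

lemma M_mult: "f \<in> M r \<Longrightarrow> g \<in> M k \<Longrightarrow> (\<lambda>x. f x * g x) \<in> M (r + k)"
proof (cases "r + k = 0")
  case True
  have "(\<lambda>x. const_on X a x * const_on X b x) = const_on X (a * b)" for a b
    by (auto simp: const_on_def)
  then show "f \<in> M r \<Longrightarrow> g \<in> M k \<Longrightarrow> ?thesis" using True by (auto simp: M_0)
next
  case False
  assume "f \<in> M r" "g \<in> M k"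
  from homogeneous.mult[OF M_homogeneous[OF this(1)] M_homogeneous[OF this(2)]] False
  show ?thesis by (simp add: positive_modular_part_eq times_fun_def)
qed

lemma M_outside: "f \<in> M r \<Longrightarrow> x \<notin> X \<Longrightarrow> f x = 0"
  using M_homogeneous homogeneous_W0_iff by blast

lemma M_scale: "f \<in> M r \<Longrightarrow> (\<lambda>x. a * f x) \<in> M r"
proof -
  assume f: "f \<in> M r"
  have "const_on X a \<in> M 0" by (simp add: M_0)
  from M_mult[OF this f] have "(\<lambda>x. const_on X a x * f x) \<in> M r" by simp
  moreover have "const_on X a x * f x = a * f x" for x
    using M_outside[OF f] by (cases "x \<in> X") (simp_all add: const_on_def)
  ultimately show ?thesis by simp
qed

lemma M_zero: "(\<lambda>x. 0) \<in> M r"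
proof (cases "r = 0")
  case True
  have "(\<lambda>x. 0) = const_on X 0" by (auto simp: const_on_def)
  then show ?thesis using True by (simp add: M_0)
next
  case False
  then show ?thesis using homogeneous.zero[of X W\<^sub>0 "int r"]
    by (simp add: positive_modular_part_eq zero_fun_def)
qed

text \<open>A function carries no record of its weights, yet the derivation needs the factor r on
  each component. Differentiating along the torus orbit at z = 1 produces it without choosing a
  decomposition.\<close>

definition has_euler :: "(point \<Rightarrow> complex) \<Rightarrow> (point \<Rightarrow> complex) \<Rightarrow> bool" where
  "has_euler f e \<longleftrightarrow> (\<forall>x\<in>X. ((\<lambda>z. f (act z x)) has_field_derivative e x) (at 1)) \<and>
     (\<forall>x. x \<notin> X \<longrightarrow> e x = 0)"

definition euler :: "(point \<Rightarrow> complex) \<Rightarrow> point \<Rightarrow> complex" where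
  "euler f = (THE e. has_euler f e)"

lemma act_1:
  assumes "homogeneous X W\<^sub>0 r f" "x \<in> X"
  shows "f (act 1 x) = f x"
  using homogeneous_act[OF homogeneous_mono[OF assms(1) W0_subset] _ assms(2), of 1] by simp

lemma euler_eq: "has_euler f e \<Longrightarrow> euler f = e"
  unfolding euler_def
proof (rule the_equality)
  fix e' assume e: "has_euler f e" and e': "has_euler f e'"
  show "e' = e"
  proof
    fix x show "e' x = e x"
    proof (cases "x \<in> X")
      case True
      then show ?thesis using DERIV_unique e e' unfolding has_euler_def by blast
    next
      case False
      then show ?thesis using e e' unfolding has_euler_def by metis
    qed
  qed
qed

lemma has_euler_homogeneous:
  assumes f: "f \<in> M r"
  shows "has_euler f (\<lambda>x. of_nat r * f x)"
  unfolding has_euler_def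
proof (intro conjI ballI allI impI)
  note h = M_homogeneous[OF f]
  fix x assume x: "x \<in> X"
  have "((\<lambda>z. z ^ r * f x) has_field_derivative of_nat r * f x) (at 1)"
    by (auto intro!: derivative_eq_intros)
  moreover have "\<forall>\<^sub>F z in nhds 1. f (act z x) = z ^ r * f x"
  proof (rule eventually_mono)
    show "\<forall>\<^sub>F z in nhds 1. z \<in> - {0 :: complex}" by (rule eventually_nhds_in_open) auto
    show "f (act z x) = z ^ r * f x" if "z \<in> - {0}" for z
      using homogeneous_act[OF homogeneous_mono[OF h W0_subset] _ x, of z] that by simp
  qed
  ultimately show "((\<lambda>z. f (act z x)) has_field_derivative of_nat r * f x) (at 1)"
    using DERIV_cong_ev[OF refl _ refl, of "\<lambda>z. f (act z x)" "\<lambda>z. z ^ r * f x" 1 "of_nat r * f x"] by blast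
next
  fix x assume "x \<notin> X"
  then show "of_nat r * f x = 0" using M_outside[OF f] by simp
qed

lemma has_euler_add: "has_euler f e \<Longrightarrow> has_euler g e' \<Longrightarrow> has_euler (\<lambda>x. f x + g x) (\<lambda>x. e x + e' x)"
  by (auto simp: has_euler_def intro!: DERIV_add)

lemma has_euler_scale: "has_euler f e \<Longrightarrow> has_euler (\<lambda>x. a * f x) (\<lambda>x. a * e x)"
  by (auto simp: has_euler_def intro!: DERIV_cmult)

lemma has_euler_mult:
  assumes "has_euler f e" "has_euler g e'" "\<And>x. x \<in> X \<Longrightarrow> f (act 1 x) = f x" "\<And>x. x \<in> X \<Longrightarrow> g (act 1 x) = g x"
  shows "has_euler (\<lambda>x. f x * g x) (\<lambda>x. e x * g x + f x * e' x)"
  unfolding has_euler_def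
proof (intro conjI ballI allI impI)
  fix x assume x: "x \<in> X"
  have "((\<lambda>z. f (act z x) * g (act z x)) has_field_derivative e x * g (act 1 x) + e' x * f (act 1 x)) (at 1)"
    using assms(1,2) x by (intro DERIV_mult) (auto simp: has_euler_def)
  then show "((\<lambda>z. f (act z x) * g (act z x)) has_field_derivative e x * g x + f x * e' x) (at 1)"
    by (simp add: assms(3,4)[OF x] mult.commute)
qed (use assms(1,2) in \<open>auto simp: has_euler_def\<close>)

end


section \<open>Derivations of the algebra of regular functions\<close>

context dwork
begin

abbreviation A :: "(point \<Rightarrow> complex) set" where "A \<equiv> regular_functions n \<Omega>"

lemma regular_outside:
  assumes "f \<in> A" "x \<notin> X"
  shows "f x = 0"
  using assms(1) unfolding regular_functions_def
proof induction
  case (gen g)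
  then show ?case using assms(2)
    by (auto simp: coord_outside coord_u_eq inv_disc_eq restr_def split: if_splits)
qed (use assms(2) in \<open>auto simp: const_on_def\<close>)

lemma regular_restr: "f \<in> A \<Longrightarrow> restr X f = f"
  by (rule restr_id) (rule regular_outside)

lemma regular_const: "const_on X a \<in> A"
  unfolding regular_functions_def by (rule generated_algebra.const)

lemma regular_add: "f \<in> A \<Longrightarrow> g \<in> A \<Longrightarrow> f + g \<in> A"
  and regular_mult: "f \<in> A \<Longrightarrow> g \<in> A \<Longrightarrow> f * g \<in> A"
  unfolding regular_functions_def by (rule generated_algebra.add generated_algebra.mult; assumption)+

lemma regular_scale:
  assumes "f \<in> A"
  shows "(\<lambda>x. a * f x) \<in> A"
proof -
  have "(\<lambda>x. a * f x) = const_on X a * f"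
    using regular_outside[OF assms] by (auto simp: const_on_def)
  then show ?thesis using regular_mult[OF regular_const assms] by simp
qed

lemma subalgebra_regular: "subalgebra A"
  unfolding subalgebra_def
  using regular_add regular_mult regular_scale by (simp add: plus_fun_def times_fun_def)

lemma regular_coord: "j \<in> chart_indices n \<Longrightarrow> coord n \<Omega> j \<in> A"
  unfolding regular_functions_def by (rule generated_algebra.gen) simp

lemma regular_generator:
  assumes "(g, w) \<in> W"
  shows "g \<in> A"
  using assms
proof (cases rule: generator_cases)
  case (1 j)
  show ?thesis
  proof (cases "shifted j")
    case True
    then have n: "odd n" "n \<ge> 3" "j = moduli_dim n" by (simp_all add: shifted_def)
    let ?k = "if n = 3 then 4 else moduli_dim n - 2"
    have k: "?k \<in> chart_indices n" "2 \<in> chart_indices n"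
      using chart_pos_last(3)[OF n(1,2)] two_in_inner[OF n_pos] unfolding inner_indices_def by blast+
    have "chart_coord opt n \<Omega> j = coord n \<Omega> j + coord n \<Omega> 2 * coord n \<Omega> ?k"
      using True n unfolding chart_coord_def shifted_def by simp
    then show ?thesis
      unfolding 1(2) using regular_add[OF regular_coord[OF 1(1)] regular_mult[OF regular_coord regular_coord]] k
      by simp
  next
    case False
    then show ?thesis unfolding 1(2) chart_coord_eq using regular_coord[OF 1(1)] by simp
  qed
qed (unfold regular_functions_def, rule generated_algebra.gen, simp, rule generated_algebra.gen, simp)

lemma homogeneous_regular:
  assumes "homogeneous X W r f"
  shows "f \<in> A"
  using assms
proof induction
  case (zero r)
  have "(0 :: point \<Rightarrow> complex) = const_on X 0" by (auto simp: const_on_def)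
  then show ?case using regular_const by metis
qed (rule regular_const regular_generator regular_add regular_mult; assumption)+

lemma H_regular: "H r f \<Longrightarrow> restr X f \<in> A"
  unfolding hom_on_def using homogeneous_regular homogeneous_mono[OF _ W0_subset] by blast

lemma derivation_const:
  assumes "derivation_on A E"
  shows "E (const_on X a) = (\<lambda>x. 0)"
proof -
  note d = derivation_onD[OF assms]
  have "E (const_on X 1) x = 0" for x
  proof (cases "x \<in> X")
    case True
    have "const_on X 1 = (\<lambda>x. const_on X 1 x * const_on X 1 x)" by (auto simp: const_on_def)
    then have "E (const_on X 1) x = E (const_on X 1) x * const_on X 1 x + const_on X 1 x * E (const_on X 1) x"
      using d(4)[OF regular_const regular_const, of 1 1] by metis
    then show ?thesis using True by (simp add: const_on_def)
  next
    case False
    then show ?thesis using regular_outside d(1)[OF regular_const] by blast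
  qed
  moreover have "const_on X a = (\<lambda>x. a * const_on X 1 x)" by (auto simp: const_on_def)
  ultimately show ?thesis using d(3)[OF regular_const, of a 1] by simp
qed

lemma derivation_restr_add:
  assumes "derivation_on A E" "restr X f \<in> A" "restr X g \<in> A"
  shows "E (restr X (\<lambda>x. f x + g x)) x = E (restr X f) x + E (restr X g) x"
  using derivation_onD(2)[OF assms] unfolding restr_arith(1) plus_fun_def by simp

lemma derivation_restr_mult:
  assumes "derivation_on A E" "restr X f \<in> A" "restr X g \<in> A" "x \<in> X"
  shows "E (restr X (\<lambda>x. f x * g x)) x = E (restr X f) x * g x + f x * E (restr X g) x"
  using derivation_onD(4)[OF assms(1-3)] unfolding restr_arith(2) times_fun_def
  by (simp add: restr_in[OF assms(4)])

end

text \<open>A condition on \<open>E f + \<lambda> r t\<^sub>2 f\<close>, for \<open>f\<close> of weight \<open>r\<close>, propagates from the chart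
  coordinates to all modular forms, as \<open>f \<mapsto> E f + \<lambda> r t\<^sub>2 f\<close> obeys the product rule.\<close>

locale dwork_derivation = dwork +
  fixes E :: vfield and I :: "int \<Rightarrow> (point \<Rightarrow> complex) \<Rightarrow> bool" and lam :: complex
  assumes E: "derivation_on A E"
    and I_cong: "I r f \<Longrightarrow> (\<And>x. x \<in> X \<Longrightarrow> f x = g x) \<Longrightarrow> r = r' \<Longrightarrow> I r' g"
    and I_add: "I r f \<Longrightarrow> I r g \<Longrightarrow> I r (\<lambda>x. f x + g x)"
    and I_mult: "H r f \<Longrightarrow> I r' g \<Longrightarrow> I (r + r') (\<lambda>x. f x * g x)"
    and I_zero: "I r (\<lambda>x. 0)"
    and I_chart: "j \<in> chart_indices n - {2} \<Longrightarrow> I (chart_weight n j) (\<lambda>x. E (chart_coord opt n \<Omega> j) x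
        + lam * of_int (chart_weight n j) * s 2 1 x * chart_coord opt n \<Omega> j x)"
begin

text \<open>There are two instances. For D, \<open>I r f\<close> says that f is modular of weight r
  + 2, with \<open>lam\<close> = 1/h. For \<partial>/\<partial>t_2 it says that f vanishes on the
  moduli space, with \<open>lam\<close> = 0.\<close>

definition Q :: "int \<Rightarrow> (point \<Rightarrow> complex) \<Rightarrow> bool" where
  "Q r f \<longleftrightarrow> H r f \<and> I r (\<lambda>x. E (restr X f) x + lam * of_int r * s 2 1 x * f x)"

lemma Q_cong: "Q r f \<Longrightarrow> (\<And>x. x \<in> X \<Longrightarrow> f x = g x) \<Longrightarrow> r = r' \<Longrightarrow> Q r' g"
proof -
  assume Q: "Q r f" and e: "\<And>x. x \<in> X \<Longrightarrow> f x = g x" and r: "r = r'"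
  have "restr X f = restr X g" by (rule restr_cong) (rule e)
  then show "Q r' g" using Q e r unfolding Q_def
    by (auto intro: hom_onI[of X W\<^sub>0 r f g] I_cong)
qed

lemma Q_add:
  assumes "Q r f" "Q r g"
  shows "Q r (\<lambda>x. f x + g x)"
proof -
  have h: "H r f" "H r g" using assms by (simp_all add: Q_def)
  have "I r (\<lambda>x. (E (restr X f) x + lam * of_int r * s 2 1 x * f x)
      + (E (restr X g) x + lam * of_int r * s 2 1 x * g x))"
    by (rule I_add) (use assms in \<open>simp_all add: Q_def\<close>)
  then have "I r (\<lambda>x. E (restr X (\<lambda>x. f x + g x)) x + lam * of_int r * s 2 1 x * (f x + g x))"
    by (rule I_cong) (simp_all add: derivation_restr_add[OF E H_regular[OF h(1)] H_regular[OF h(2)]] algebra_simps)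
  then show ?thesis unfolding Q_def using hom_on_add[OF h] by blast
qed

lemma Q_mult:
  assumes "Q r f" "Q r' g"
  shows "Q (r + r') (\<lambda>x. f x * g x)"
proof -
  have h: "H r f" "H r' g" using assms by (simp_all add: Q_def)
  have "I (r' + r) (\<lambda>x. g x * (E (restr X f) x + lam * of_int r * s 2 1 x * f x))"
    by (rule I_mult[OF h(2)]) (use assms in \<open>simp add: Q_def\<close>)
  then have 1: "I (r + r') (\<lambda>x. g x * (E (restr X f) x + lam * of_int r * s 2 1 x * f x))"
    by (simp only: add.commute)
  have 2: "I (r + r') (\<lambda>x. f x * (E (restr X g) x + lam * of_int r' * s 2 1 x * g x))"
    by (rule I_mult[OF h(1)]) (use assms in \<open>simp add: Q_def\<close>)
  have "I (r + r') (\<lambda>x. E (restr X (\<lambda>x. f x * g x)) x + lam * of_int (r + r') * s 2 1 x * (f x * g x))"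
    by (rule I_cong[OF I_add[OF 1 2]])
      (simp_all add: derivation_restr_mult[OF E H_regular[OF h(1)] H_regular[OF h(2)]] algebra_simps)
  then show ?thesis unfolding Q_def using hom_on_mult[OF h] by blast
qed

lemma Q_const: "Q 0 (\<lambda>x. a)"
  unfolding Q_def restr_arith(3) derivation_const[OF E] using hom_on_const I_zero by simp

lemma Q_zero: "Q r (\<lambda>x. 0)"
  unfolding Q_def restr_arith(3) derivation_const[OF E] using hom_on_zero I_zero by simp

lemma Q_scale: "Q r f \<Longrightarrow> Q r (\<lambda>x. a * f x)"
  using Q_mult[OF Q_const[of a]] by simp

lemma Q_power: "Q r f \<Longrightarrow> Q (int k * r) (\<lambda>x. f x ^ k)"
proof (induction k)
  case (Suc k)
  show ?case using Q_mult[OF Suc.prems Suc.IH[OF Suc.prems]] by (simp add: distrib_right)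
qed (use Q_const[of 1] in simp)

lemma Q_prod: "(\<And>i. i \<in> J \<Longrightarrow> Q (r i) (f i)) \<Longrightarrow> Q (\<Sum>i\<in>J. r i) (\<lambda>x. \<Prod>i\<in>J. f i x)"
proof (induction J rule: infinite_finite_induct)
  case (insert i J)
  show ?case using Q_mult[of "r i" "f i" "sum r J"] insert by simp
qed (use Q_const[of 1] in simp_all)

text \<open>The twisted derivative of 1/f is -1/f^2 times that of f, and -1/f^2 is modular.\<close>

lemma Q_inverse:
  assumes f: "Q r f" and h: "H (- r) (\<lambda>x. 1 / f x)" and nz: "\<And>x. x \<in> X \<Longrightarrow> f x \<noteq> 0"
  shows "Q (- r) (\<lambda>x. 1 / f x)"
proof -
  let ?g = "\<lambda>x. 1 / f x"
  have hf: "H r f" using f by (simp add: Q_def)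
  have "H (- r + - r) (\<lambda>x. (- 1) * (?g x * ?g x))" by (intro hom_on_scale hom_on_mult h)
  then have "I (- r + - r + r) (\<lambda>x. (- 1) * (?g x * ?g x) * (E (restr X f) x + lam * of_int r * s 2 1 x * f x))"
    by (rule I_mult) (use f in \<open>simp add: Q_def\<close>)
  then have "I (- r) (\<lambda>x. E (restr X ?g) x + lam * of_int (- r) * s 2 1 x * ?g x)"
  proof (rule I_cong)
    fix x assume x: "x \<in> X"
    have "restr X (\<lambda>x. f x * ?g x) = const_on X 1"
      using nz by (auto simp: restr_def const_on_def)
    then have "0 = E (restr X f) x * ?g x + f x * E (restr X ?g) x"
      using derivation_restr_mult[OF E H_regular[OF hf] H_regular[OF h] x] derivation_const[OF E] by simp
    then have "E (restr X ?g) x = - (?g x * ?g x * E (restr X f) x)"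
      using nz[OF x] by (simp add: field_simps eq_neg_iff_add_eq_0)
    then show "(- 1) * (?g x * ?g x) * (E (restr X f) x + lam * of_int r * s 2 1 x * f x)
        = E (restr X ?g) x + lam * of_int (- r) * s 2 1 x * ?g x"
      using nz[OF x] by (simp add: field_simps)
  qed simp
  then show ?thesis unfolding Q_def using h by blast
qed

text \<open>Serves u, which is not among the chart coordinates but has a multiple of the
  discriminant as its square. The twisted derivative of f is that of f^2 divided by 2 f.\<close>

lemma Q_sqrt:
  assumes f: "Q (2 * r) (\<lambda>x. f x * f x)" and h: "H r f" "H (- r) (\<lambda>x. 1 / f x)"
    and nz: "\<And>x. x \<in> X \<Longrightarrow> f x \<noteq> 0"
  shows "Q r f"
proof -
  have "I (- r + 2 * r) (\<lambda>x. 1 / 2 * (1 / f x) * (E (restr X (\<lambda>x. f x * f x)) x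
      + lam * of_int (2 * r) * s 2 1 x * (f x * f x)))"
    by (intro I_mult hom_on_scale h(2)) (use f in \<open>simp only: Q_def\<close>)
  then have "I r (\<lambda>x. E (restr X f) x + lam * of_int r * s 2 1 x * f x)"
  proof (rule I_cong)
    fix x assume x: "x \<in> X"
    show "1 / 2 * (1 / f x) * (E (restr X (\<lambda>x. f x * f x)) x + lam * of_int (2 * r) * s 2 1 x * (f x * f x))
        = E (restr X f) x + lam * of_int r * s 2 1 x * f x"
      using nz[OF x] derivation_restr_mult[OF E H_regular[OF h(1)] H_regular[OF h(1)] x]
      by (simp add: field_simps)
  qed simp
  then show ?thesis unfolding Q_def using h by blast
qed

lemma Q_chart:
  assumes "j \<in> chart_indices n - {2}"
  shows "Q (chart_weight n j) (chart_coord opt n \<Omega> j)"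
proof -
  have "(chart_coord opt n \<Omega> j, chart_weight n j) \<in> W"
    using assms by (auto simp: weighted_generators_def)
  then have "restr X (chart_coord opt n \<Omega> j) = chart_coord opt n \<Omega> j"
    using regular_restr regular_generator by blast
  then show ?thesis unfolding Q_def using H_chart_coord[OF assms] I_chart[OF assms] by simp
qed

lemma Q_restrD: "Q r (restr X f) \<Longrightarrow> Q r f"
  using Q_cong[of r "restr X f" f r] by (simp add: restr_in)

lemma Q_a: "Q (weight_unit n) pt_a"
proof (rule Q_restrD)
  have "1 \<in> chart_indices n - {2}" using chart_indices_eq[OF n_pos] by simp
  from Q_chart[OF this] show "Q (weight_unit n) (restr X pt_a)"
    by (simp only: chart_coord_eq not_shifted if_False coord_1 chart_weight_1)
qed

lemma Q_b: "Q (weight_unit n * int (n + 2)) pt_b"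
proof (rule Q_restrD)
  have "n + 2 \<in> chart_indices n - {2}" using chart_indices_eq[OF n_pos] n_pos by simp
  from Q_chart[OF this] show "Q (weight_unit n * int (n + 2)) (restr X pt_b)"
    by (simp only: chart_coord_eq not_shifted if_False coord_last chart_weight_last)
qed

lemma Q_disc: "Q (weight_unit n * int (n + 2)) disc"
proof -
  have "Q (weight_unit n * int (n + 2)) (\<lambda>x. pt_a x ^ (n + 2))"
    by (rule Q_cong[OF Q_power[OF Q_a, of "n + 2"]]) simp_all
  from Q_add[OF this Q_scale[OF Q_b, of "- 1"]] show ?thesis
    by (rule Q_cong) (simp_all add: disc_def)
qed

lemma Q_chart_diag:
  assumes "j \<in> diag_indices n"
  shows "Q (chart_weight n j) (s (row j) (row j))"
proof -
  note d = diag_not_exceptional[OF assms]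
  have j: "j \<in> inner_indices n" "row j = col j" "j \<in> chart_indices n - {2}"
    using d(1) assms by (auto simp: diag_indices_eq inner_indices_def)
  have "row j \<in> {1..n+1}" using position[OF j(1)] by auto
  from Q_chart[OF j(3)] show ?thesis unfolding chart_coord_sig[OF d]
    by (rule Q_cong) (use j(2) sig_diag[OF _ \<open>row j \<in> {1..n+1}\<close>] in \<open>simp_all add: restr_in\<close>)
qed

lemma Q_u:
  assumes "even n"
  shows "Q (u_weight n) (coord_u n \<Omega>)"
proof -
  define i where "i = (n + 2) div 2"
  define K where "K = (- 1) ^ (i - 1) * ((- of_nat (n + 2)) ^ n * c)"
  have i: "i \<in> {1..n+1}" "i + i = n + 2" using assms n_pos by (auto simp: i_def)
  define N :: complex where "N = of_nat (n + 2)"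
  have "N \<noteq> 0" unfolding N_def of_nat_eq_0_iff by simp
  then have K: "K \<noteq> 0" using c_nonzero unfolding K_def N_def[symmetric] by simp
  have "Q (entry_weight n i i) (s i i)"
  proof (rule Q_sqrt[OF _ H_diag[OF i(1)] H_inverse_diag[OF i(1)] s_diag_nonzero[OF _ i(1)]])
    show "Q (2 * entry_weight n i i) (\<lambda>x. s i i x * s i i x)"
    proof (rule Q_cong[OF Q_scale[OF Q_disc, of "Phi_sign n i / K"]])
      fix x assume x: "x \<in> X"
      have e: "n + 2 - i = i" using i(2) by auto
      have "om i i x = K * (1 / disc x)"
        using om_antidiagonal[OF x i(1)] unfolding e K_def[symmetric] .
      then have "s i i x * (K * (1 / disc x)) * s i i x = Phi_sign n i"
        using diag_relation[OF x i(1) i(1) i(2)] by simp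
      then show "Phi_sign n i / K * disc x = s i i x * s i i x"
        using K disc_nonzero[OF x] by (simp add: field_simps)
    next
      have "row_weight n i = 0" using row_weight_reflect[OF n_pos i(2) i(1)] by simp
      moreover have "int (n + 2) = 2 * int i" using i(2) by simp
      ultimately show "weight_unit n * int (n + 2) = 2 * entry_weight n i i"
        by (simp only: entry_weight_def) simp
    qed
  qed
  then show ?thesis unfolding u_weight_eq[OF assms] coord_u_eq i_def[symmetric]
    by (rule Q_cong) (simp_all add: restr_in)
qed

lemma Q_inv_disc:
  "Q (- (2 * chart_weight n (n + 2) + (\<Sum>j\<in>diag_indices n. chart_weight n j))) (inv_disc n \<Omega>)"
proof -
  let ?w = "weight_unit n * int (n + 2)" and ?d = "\<Sum>j\<in>diag_indices n. chart_weight n j"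
  have "Q ?d diag_prod" unfolding diag_prod_def[abs_def] by (rule Q_prod) (rule Q_chart_diag)
  then have q: "Q (?w + ?w + ?d) (\<lambda>x. (- 1) * (pt_b x * disc x * diag_prod x))"
    by (intro Q_scale Q_mult Q_b Q_disc)
  have "Q (- (?w + ?w + ?d)) (\<lambda>x. 1 / ((- 1) * (pt_b x * disc x * diag_prod x)))"
  proof (rule Q_inverse[OF q])
    show "H (- (?w + ?w + ?d)) (\<lambda>x. 1 / ((- 1) * (pt_b x * disc x * diag_prod x)))"
      using H_inv by (rule hom_onI) simp_all
  qed (use b_nonzero disc_nonzero diag_prod_nonzero in auto)
  then show ?thesis unfolding chart_weight_last inv_disc_eq
    by (rule Q_cong) (simp_all add: restr_in)
qed

lemma Q_homogeneous:
  assumes "homogeneous X W\<^sub>0 r f"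
  shows "Q r f"
  using assms
proof induction
  case (zero r)
  show ?case using Q_zero by (simp add: zero_fun_def)
next
  case (const a)
  show ?case by (rule Q_cong[OF Q_const]) (simp_all add: const_on_def)
next
  case (gen g w)
  then show ?case
  proof (cases rule: generator_cases)
    case (1 j)
    then show ?thesis using Q_chart by blast
  next
    case 2
    then show ?thesis using Q_u by blast
  next
    case 3
    then show ?thesis using Q_inv_disc by blast
  qed
next
  case (add r f g)
  then show ?case using Q_add[OF add.IH] by (simp add: plus_fun_def)
next
  case (mult r f r' g)
  then show ?case using Q_mult[OF mult.IH] by (simp add: times_fun_def)
qed

lemma Q_H: "H r f \<Longrightarrow> I r (\<lambda>x. E (restr X f) x + lam * of_int r * s 2 1 x * f x)"
  using Q_restrD[OF Q_homogeneous] unfolding hom_on_def Q_def by blast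

end


section \<open>The vector fields\<close>

lemma derivation_on_linear:
  assumes A: "subalgebra A" and F: "derivation_on A F" and G: "derivation_on A G"
  shows "derivation_on A (\<lambda>f x. u * F f x + v * G f x)"
  unfolding derivation_on_def
proof (intro conjI ballI allI)
  note F = derivation_onD[OF F] and G = derivation_onD[OF G]
  fix f assume f: "f \<in> A"
  show "(\<lambda>x. u * F f x + v * G f x) \<in> A"
    by (intro subalgebraD[OF A] F(1) G(1) f)
  show "(\<lambda>x. u * F (\<lambda>x. a * f x) x + v * G (\<lambda>x. a * f x) x) = (\<lambda>x. a * (u * F f x + v * G f x))" for a
    unfolding F(3)[OF f] G(3)[OF f] by (simp add: algebra_simps)
  fix g assume g: "g \<in> A"
  show "(\<lambda>x. u * F (f + g) x + v * G (f + g) x) = (\<lambda>x. u * F f x + v * G f x) + (\<lambda>x. u * F g x + v * G g x)"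
    unfolding plus_fun_def F(2)[OF f g] G(2)[OF f g] by (simp add: algebra_simps)
  show "(\<lambda>x. u * F (f * g) x + v * G (f * g) x)
      = (\<lambda>x. u * F f x + v * G f x) * g + f * (\<lambda>x. u * F g x + v * G g x)"
    unfolding plus_fun_def times_fun_def F(4)[OF f g] G(4)[OF f g] by (simp add: algebra_simps)
qed

context dwork
begin

text \<open>The reciprocal 1/h of the weight of t_1.\<close>

definition kap :: complex where
  "kap = (if n = 2 then 1 / 2 else 1)"

lemma kap_weight_unit: "kap * of_int (weight_unit n) = 1"
  by (simp add: kap_def weight_unit_def)

section \<open>Vector fields in terms of their Gauss-Manin matrices\<close>

lemma gauss_manin_entry:
  assumes G: "gauss_manin_matrix n \<Omega> E B" and x: "x \<in> X"
    and i: "i \<in> {1..n+1}" and j: "j \<in> {1..n+1}"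
    and \<tau>: "\<tau> = - E (coord n \<Omega> (n + 2)) x / (of_nat (n + 2) * pt_b x)"
    and \<theta>: "\<theta> = E (coord n \<Omega> 1) x + pt_a x * \<tau>"
  shows "E (s_entry n \<Omega> i j) x = (\<Sum>k\<in>{1..n+1}. ent (B x) i k * s k j x)
    - (of_nat j * \<tau> * s i j x + (if j \<ge> 2 then \<theta> * s i (j - 1) x else 0)
       - of_nat (Stirling (n + 2) j) * pt_a x ^ j * \<theta> / disc x * s i (n + 1) x)"
proof -
  obtain a b S where abS: "x = (a, b, S)" by (cases x)
  have S: "S \<in> carrier_mat (n + 1) (n + 1)" using x unfolding abS moduli_iff by blast
  have nz: "b * (a ^ (n + 2) - b) \<noteq> 0"
    using in_X(1)[OF x] by (simp add: abS pt_simps base_points_def)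
  let ?F = "gm_form n a b (E (coord n \<Omega> 1) x) (E (coord n \<Omega> (n + 2)) x)"
  have B: "B x \<in> carrier_mat (n + 1) (n + 1)"
    and eq: "mat1 (n + 1) (\<lambda>i j. E (s_entry n \<Omega> i j) x) = B x * S - S * ?F"
    using G x unfolding gauss_manin_matrix_def abS by blast+
  have "E (s_entry n \<Omega> i j) x = ent (B x * S - S * ?F) i j"
    unfolding eq[symmetric] ent_mat1[OF i j] ..
  also have "\<dots> = (\<Sum>k\<in>{1..n+1}. ent (B x) i k * ent S k j) - (\<Sum>k\<in>{1..n+1}. ent S i k * ent ?F k j)"
    unfolding ent_minus[OF mult_carrier_mat[OF B S] mult_carrier_mat[OF S gm_form_carrier] i j]
      ent_mult[OF B S i j] ent_mult[OF S gm_form_carrier i j] ..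
  also have "(\<Sum>k\<in>{1..n+1}. ent S i k * ent ?F k j) = of_nat j * \<tau> * ent S i j
      + (if j \<ge> 2 then \<theta> * ent S i (j - 1) else 0)
      - of_nat (Stirling (n + 2) j) * a ^ j * \<theta> / (a ^ (n + 2) - b) * ent S i (n + 1)"
    by (rule sum_mult_gm_form[OF j nz]) (use \<tau> \<theta> in \<open>simp_all only: abS pt_simps prod.case\<close>)
  finally show ?thesis by (simp only: abS pt_simps disc_def prod.case)
qed

lemma derivation_upper_entry:
  assumes "derivation_on A E" "i \<in> {1..n+1}" "j \<in> {1..n+1}" "i < j"
  shows "E (s_entry n \<Omega> i j) = (\<lambda>x. 0)"
proof -
  have "s_entry n \<Omega> i j = const_on X 0"
    unfolding s_entry_eq using in_X(2)[OF _ assms(2-4)] by (auto simp: restr_def const_on_def)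
  then show ?thesis using derivation_const[OF assms(1)] by simp
qed

lemma derivation_corner_entry:
  assumes "derivation_on A E"
  shows "E (s_entry n \<Omega> 1 1) = (\<lambda>x. 0)"
proof -
  have "s_entry n \<Omega> 1 1 = const_on X 1"
    unfolding s_entry_eq using in_X(3) by (auto simp: restr_def const_on_def)
  then show ?thesis using derivation_const[OF assms] by simp
qed

text \<open>The entries (1,1) and (1,2) of S are the constants 1 and 0. Their derivatives vanish,
  which turns E(S) = A S - S B(E) into equations for \<tau> and \<theta>: the first row of A
  determines E on t_1 and t_{n+2}.\<close>

lemma gauss_manin_base:
  assumes E: "derivation_on A E" and G: "gauss_manin_matrix n \<Omega> E B" and x: "x \<in> X"
    and \<tau>: "\<tau> = - E (coord n \<Omega> (n + 2)) x / (of_nat (n + 2) * pt_b x)"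
    and \<theta>: "\<theta> = E (coord n \<Omega> 1) x + pt_a x * \<tau>"
  shows "\<tau> = (\<Sum>k\<in>{1..n+1}. ent (B x) 1 k * s k 1 x)"
    and "\<theta> = (\<Sum>k\<in>{1..n+1}. ent (B x) 1 k * s k 2 x)"
    and "E (coord n \<Omega> (n + 2)) x = - of_nat (n + 2) * \<tau> * pt_b x"
    and "E (coord n \<Omega> 1) x = \<theta> - pt_a x * \<tau>"
proof -
  have i: "1 \<in> {1..n+1}" "2 \<in> {1..n+1}" "n + 1 \<in> {1..n+1}" using n_pos by auto
  have s: "s 1 1 x = 1" "s 1 2 x = 0" "s 1 (n + 1) x = 0"
    using in_X(3)[OF x] in_X(2)[OF x i(1)] i n_pos by auto
  show "\<tau> = (\<Sum>k\<in>{1..n+1}. ent (B x) 1 k * s k 1 x)"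
    using gauss_manin_entry[OF G x i(1,1) \<tau> \<theta>] unfolding derivation_corner_entry[OF E] s by simp
  show "\<theta> = (\<Sum>k\<in>{1..n+1}. ent (B x) 1 k * s k 2 x)"
    using gauss_manin_entry[OF G x i(1,2) \<tau> \<theta>] derivation_upper_entry[OF E i(1,2)]
    by (simp add: s s[simplified])
  define N :: complex where "N = of_nat (n + 2)"
  have "N \<noteq> 0" unfolding N_def of_nat_eq_0_iff by simp
  then show "E (coord n \<Omega> (n + 2)) x = - of_nat (n + 2) * \<tau> * pt_b x"
    unfolding \<tau> N_def[symmetric] using b_nonzero[OF x] by simp
  show "E (coord n \<Omega> 1) x = \<theta> - pt_a x * \<tau>" by (simp add: \<theta>)
qed

text \<open>The eigenvalue on t_j of a field with Gauss-Manin matrix diag(\<delta>). Here \<tau> =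
  \<delta>_1 and \<theta> = 0, so column k of S contributes -k \<delta>_1.\<close>

definition diag_field_weight :: "nat \<Rightarrow> (nat \<Rightarrow> complex) \<Rightarrow> complex" where
  "diag_field_weight j \<delta> = (if j = 1 then - \<delta> 1 else if j = n + 2 then - of_nat (n + 2) * \<delta> 1
     else \<delta> (row j) - of_nat (col j) * \<delta> 1)"

lemma lie_field_coord:
  assumes L: "lie_vector_field n \<Omega> g E" and g: "g \<in> carrier_mat (n + 1) (n + 1)"
    and \<delta>: "\<And>i k. i \<in> {1..n+1} \<Longrightarrow> k \<in> {1..n+1} \<Longrightarrow> ent g k i = (if k = i then \<delta> i else 0)"
    and j: "j \<in> chart_indices n" and x: "x \<in> X"
  shows "E (coord n \<Omega> j) x = diag_field_weight j \<delta> * coord n \<Omega> j x"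
proof -
  have E: "derivation_on A E" and G: "gauss_manin_matrix n \<Omega> E (\<lambda>x. transpose_mat g)"
    using L by (simp_all add: lie_vector_field_def vector_field_def)
  define \<tau> where "\<tau> = - E (coord n \<Omega> (n + 2)) x / (of_nat (n + 2) * pt_b x)"
  define \<theta> where "\<theta> = E (coord n \<Omega> 1) x + pt_a x * \<tau>"
  have row: "(\<Sum>k\<in>{1..n+1}. ent (transpose_mat g) i k * s k l x) = \<delta> i * s i l x"
    if i: "i \<in> {1..n+1}" for i l
  proof -
    have "(\<Sum>k\<in>{1..n+1}. ent (transpose_mat g) i k * s k l x)
        = (\<Sum>k\<in>{1..n+1}. if k = i then \<delta> i * s i l x else 0)"
    proof (rule sum.cong[OF refl])
      fix k assume k: "k \<in> {1..n+1}"
      show "ent (transpose_mat g) i k * s k l x = (if k = i then \<delta> i * s i l x else 0)"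
        unfolding ent_transpose[OF g i k] \<delta>[OF i k] by simp
    qed
    also have "\<dots> = \<delta> i * s i l x" using i by simp
    finally show ?thesis .
  qed
  have 1: "1 \<in> {1..n+1}" "2 \<in> {1..n+1}" using n_pos by auto
  have s: "s 1 1 x = 1" "s 1 2 x = 0" using in_X(3)[OF x] in_X(2)[OF x 1] by auto
  note base = gauss_manin_base[OF E G x \<tau>_def \<theta>_def]
  have \<tau>: "\<tau> = \<delta> 1" using base(1) unfolding row[OF 1(1)] s by simp
  have \<theta>: "\<theta> = 0" using base(2) unfolding row[OF 1(1)] s by simp
  have "j = 1 \<or> j = n + 2 \<or> j \<in> inner_indices n" using j chart_indices_eq[OF n_pos] by auto
  then show ?thesis
  proof (elim disjE)
    assume j: "j = 1"
    show ?thesis using base(4) unfolding j \<tau> \<theta>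
      by (simp add: diag_field_weight_def coord_1[simplified] restr_in[OF x])
  next
    assume j: "j = n + 2"
    show ?thesis using base(3) unfolding j \<tau> diag_field_weight_def coord_last restr_in[OF x] by simp
  next
    assume j: "j \<in> inner_indices n"
    have r: "row j \<in> {1..n+1}" "col j \<in> {1..n+1}" using position[OF j] by auto
    have n: "j \<noteq> 1" "j \<noteq> n + 2" using j by (auto simp: inner_indices_def)
    have "E (s_entry n \<Omega> (row j) (col j)) x
        = \<delta> (row j) * s (row j) (col j) x - of_nat (col j) * \<delta> 1 * s (row j) (col j) x"
      using gauss_manin_entry[OF G x r \<tau>_def \<theta>_def] unfolding row[OF r(1)] \<tau> \<theta> by simp
    then show ?thesis using n
      unfolding s_entry_eq coord_inner[OF j] diag_field_weight_def restr_in[OF x]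
      by (simp add: algebra_simps)
  qed
qed

lemma matrix_unit_diff:
  "matrix_unit k p p' - matrix_unit k q q' \<in> carrier_mat k k"
  "i \<in> {1..k} \<Longrightarrow> j \<in> {1..k} \<Longrightarrow> ent (matrix_unit k p p' - matrix_unit k q q') i j
    = (if i = p \<and> j = p' then 1 else 0) - (if i = q \<and> j = q' then 1 else 0)"
proof -
  have c: "matrix_unit k p q \<in> carrier_mat k k" for p q by (simp add: matrix_unit_def mat1_def)
  show "matrix_unit k p p' - matrix_unit k q q' \<in> carrier_mat k k"
    using minus_carrier_mat[OF c] by simp
  show "ent (matrix_unit k p p' - matrix_unit k q q') i j
      = (if i = p \<and> j = p' then 1 else 0) - (if i = q \<and> j = q' then 1 else 0)"
    if "i \<in> {1..k}" "j \<in> {1..k}"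
    unfolding ent_minus[OF c c that] by (simp only: matrix_unit_def ent_mat1[OF that])
qed

text \<open>The eigenvalues of the diagonal fields combine to the row weight plus h times the
  column, because -h is the first diagonal entry.\<close>

lemma radial_field:
  assumes "radial_vector_field n \<Omega> Z"
  shows "derivation_on A Z"
    and "\<And>j x. j \<in> chart_indices n \<Longrightarrow> x \<in> X \<Longrightarrow> Z (coord n \<Omega> j) x = of_int (chart_weight n j) * coord n \<Omega> j x"
proof -
  obtain R11 where L11: "lie_vector_field n \<Omega> (g11 n) R11"
    and Z: "if n = 1 then Z = (\<lambda>f. - R11 f)
         else if n = 2 then Z = (\<lambda>f. - (2 * R11 f))
         else \<exists>R22. lie_vector_field n \<Omega> (g22 n) R22 \<and> Z = (\<lambda>f. R22 f - R11 f)"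
    using assms unfolding radial_vector_field_def by blast
  define d11 where "d11 i = (if i = 1 then 1 else 0) - (if i = n + 1 then 1 else 0 :: complex)" for i :: nat
  define d22 where "d22 i = (if i = 2 then 1 else 0) - (if i = n then 1 else 0 :: complex)" for i :: nat
  have R11: "R11 (coord n \<Omega> j) x = diag_field_weight j d11 * coord n \<Omega> j x"
    if "j \<in> chart_indices n" "x \<in> X" for j x
    using that by (intro lie_field_coord[OF L11]) (auto simp: g11_def matrix_unit_diff d11_def)
  have D11: "derivation_on A R11" using L11 by (simp add: lie_vector_field_def vector_field_def)
  note lin = derivation_on_linear[OF subalgebra_regular]
  have idx: "j = 1 \<or> j = n + 2 \<or> j \<in> inner_indices n - {1, n + 2}" if "j \<in> chart_indices n" for j
    using that by (auto simp: inner_indices_def)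
  have w: "of_int (chart_weight n j) = (if j = 1 then of_int (weight_unit n)
      else if j = n + 2 then of_int (weight_unit n) * of_nat (n + 2)
      else of_int (row_weight n (row j)) + of_int (weight_unit n) * (of_nat (col j) :: complex))"
    if "j \<in> chart_indices n" for j
    using idx[OF that] chart_weight_1 chart_weight_last chart_weight_inner[of j] n_pos
    by (auto simp: entry_weight_def)
  consider "n = 1" | "n = 2" | "n \<ge> 3" using n_pos by linarith
  then have "derivation_on A Z \<and> (\<forall>j\<in>chart_indices n. \<forall>x\<in>X. Z (coord n \<Omega> j) x = of_int (chart_weight n j) * coord n \<Omega> j x)"
  proof cases
    case 1
    have Z: "Z = (\<lambda>f x. (- 1) * R11 f x + 0 * R11 f x)" using Z 1 by (simp add: fun_eq_iff)
    have "Z (coord n \<Omega> j) x = of_int (chart_weight n j) * coord n \<Omega> j x"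
      if j: "j \<in> chart_indices n" and x: "x \<in> X" for j x
    proof -
      have "row j = 2" if "j \<in> inner_indices n" using position[OF that] 1 by auto
      then have "- diag_field_weight j d11 = of_int (chart_weight n j)"
        unfolding w[OF j] diag_field_weight_def d11_def row_weight_def weight_unit_def
        using idx[OF j] 1 by auto
      from this[symmetric] show ?thesis unfolding Z R11[OF j x] by simp
    qed
    moreover have "derivation_on A Z" unfolding Z by (rule lin[OF D11 D11])
    ultimately show ?thesis by blast
  next
    case 2
    have Z: "Z = (\<lambda>f x. (- 2) * R11 f x + 0 * R11 f x)" using Z 2 by (simp add: fun_eq_iff)
    have "Z (coord n \<Omega> j) x = of_int (chart_weight n j) * coord n \<Omega> j x"
      if j: "j \<in> chart_indices n" and x: "x \<in> X" for j x
    proof -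
      have "row j = 2" if "j \<in> inner_indices n"
        using that 2 chart_pos_2[OF n_pos] by (simp add: inner_indices_eq)
      then have "(- 2) * diag_field_weight j d11 = of_int (chart_weight n j)"
        unfolding w[OF j] diag_field_weight_def d11_def row_weight_def weight_unit_def
        using idx[OF j] 2 by auto
      from this[symmetric] show ?thesis unfolding Z R11[OF j x] by simp
    qed
    moreover have "derivation_on A Z" unfolding Z by (rule lin[OF D11 D11])
    ultimately show ?thesis by blast
  next
    case 3
    then obtain R22 where L22: "lie_vector_field n \<Omega> (g22 n) R22" and Z': "Z = (\<lambda>f. R22 f - R11 f)"
      using Z by (auto split: if_splits)
    have Z: "Z = (\<lambda>f x. 1 * R22 f x + (- 1) * R11 f x)" using Z' by (simp add: fun_eq_iff)
    have R22: "R22 (coord n \<Omega> j) x = diag_field_weight j d22 * coord n \<Omega> j x"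
      if "j \<in> chart_indices n" "x \<in> X" for j x
      using that by (intro lie_field_coord[OF L22]) (auto simp: g22_def matrix_unit_diff d22_def)
    have D22: "derivation_on A R22" using L22 by (simp add: lie_vector_field_def vector_field_def)
    have "Z (coord n \<Omega> j) x = of_int (chart_weight n j) * coord n \<Omega> j x"
      if j: "j \<in> chart_indices n" and x: "x \<in> X" for j x
    proof -
      have "row j \<noteq> 1" if "j \<in> inner_indices n" using position[OF that] by auto
      then have "diag_field_weight j d22 - diag_field_weight j d11 = of_int (chart_weight n j)"
        unfolding w[OF j] diag_field_weight_def d11_def d22_def row_weight_def weight_unit_def
        using idx[OF j] 3 by auto
      from this[symmetric] show ?thesis unfolding Z R11[OF j x] R22[OF j x] by (simp add: left_diff_distrib)
    qed
    moreover have "derivation_on A Z" unfolding Z by (rule lin[OF D22 D11])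
    ultimately show ?thesis by blast
  qed
  then show "derivation_on A Z"
    "\<And>j x. j \<in> chart_indices n \<Longrightarrow> x \<in> X \<Longrightarrow> Z (coord n \<Omega> j) x = of_int (chart_weight n j) * coord n \<Omega> j x"
    by blast+
qed

end


section \<open>The modular vector field\<close>

lemma row_weight_simps:
  assumes "n \<ge> 3"
  shows "weight_unit n = 1" "row_weight n 2 = 1" "row_weight n n = - 1" "row_weight n (n + 1) = 1"
  using assms by (auto simp: weight_unit_def row_weight_def)

locale modular_field = dwork +
  fixes R :: vfield and Y :: "nat \<Rightarrow> point \<Rightarrow> complex"
  assumes R: "derivation_on A R" and gm: "gauss_manin_matrix n \<Omega> R (yukawa_matrix n Y)"
begin

text \<open>The superdiagonal of the Gauss-Manin matrix of R. For n = 1 the first clause prevails,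
  as the single entry is 1.\<close>

definition yuk :: "nat \<Rightarrow> point \<Rightarrow> complex" where
  "yuk i x = (if i = 1 then 1 else if i = n then - 1 else Y (i - 1) x)"

lemma yukawa_row:
  assumes i: "i \<in> {1..n+1}"
  shows "(\<Sum>k\<in>{1..n+1}. ent (yukawa_matrix n Y x) i k * s k j x)
    = (if i \<le> n then yuk i x * s (i + 1) j x else 0)"
proof -
  have "(\<Sum>k\<in>{1..n+1}. ent (yukawa_matrix n Y x) i k * s k j x)
      = (\<Sum>k\<in>{1..n+1}. if k = i + 1 then yuk i x * s (i + 1) j x else 0)"
  proof (rule sum.cong[OF refl])
    fix k assume k: "k \<in> {1..n+1}"
    show "ent (yukawa_matrix n Y x) i k * s k j x = (if k = i + 1 then yuk i x * s (i + 1) j x else 0)"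
      unfolding yukawa_matrix_def ent_mat1[OF i k] by (simp add: yuk_def)
  qed
  also have "\<dots> = (if i \<le> n then yuk i x * s (i + 1) j x else 0)"
    using i by auto
  finally show ?thesis .
qed

text \<open>The contribution of the last row of B when \<theta> = s_22. It multiplies s_{i,n+1},
  which is nonzero only for i = n + 1.\<close>

definition corner :: "nat \<Rightarrow> point \<Rightarrow> complex" where
  "corner j x = of_nat (Stirling (n + 2) j) * pt_a x ^ j * s 2 2 x / disc x"

text \<open>The first row of the Gauss-Manin matrix of R is (0, 1, 0, ..., 0), whence \<tau> = s_21
  = t_2 and \<theta> = s_22.\<close>

lemma R_base:
  assumes x: "x \<in> X"
  shows "R (coord n \<Omega> (n + 2)) x = - of_nat (n + 2) * s 2 1 x * pt_b x"
    and "R (coord n \<Omega> 1) x = s 2 2 x - pt_a x * s 2 1 x"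
    and "\<lbrakk>i \<in> {1..n+1}; j \<in> {1..n+1}\<rbrakk> \<Longrightarrow> R (s_entry n \<Omega> i j) x
      = (if i \<le> n then yuk i x * s (i + 1) j x else 0)
        - (of_nat j * s 2 1 x * s i j x + (if j \<ge> 2 then s 2 2 x * s i (j - 1) x else 0)
           - corner j x * s i (n + 1) x)"
proof -
  define \<tau> where "\<tau> = - R (coord n \<Omega> (n + 2)) x / (of_nat (n + 2) * pt_b x)"
  define \<theta> where "\<theta> = R (coord n \<Omega> 1) x + pt_a x * \<tau>"
  have 1: "1 \<in> {1..n+1}" using n_pos by auto
  note base = gauss_manin_base[OF R gm x \<tau>_def \<theta>_def, unfolded yukawa_row[OF 1]]
  have y1: "yuk 1 x = 1" by (simp add: yuk_def)
  have \<tau>: "\<tau> = s 2 1 x" and \<theta>: "\<theta> = s 2 2 x" using base(1,2) y1 n_pos by (simp_all add: numeral_2_eq_2)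
  show "R (coord n \<Omega> (n + 2)) x = - of_nat (n + 2) * s 2 1 x * pt_b x" using base(3) unfolding \<tau> .
  show "R (coord n \<Omega> 1) x = s 2 2 x - pt_a x * s 2 1 x" using base(4) unfolding \<tau> \<theta> .
  show "R (s_entry n \<Omega> i j) x
      = (if i \<le> n then yuk i x * s (i + 1) j x else 0)
        - (of_nat j * s 2 1 x * s i j x + (if j \<ge> 2 then s 2 2 x * s i (j - 1) x else 0)
           - corner j x * s i (n + 1) x)"
    if "i \<in> {1..n+1}" "j \<in> {1..n+1}"
    using gauss_manin_entry[OF gm x that \<tau>_def \<theta>_def] unfolding yukawa_row[OF that(1)] \<tau> \<theta> corner_def .
qed

lemma R_entry:
  assumes x: "x \<in> X" and i: "i \<in> {1..n}" and j: "j \<in> {1..n+1}"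
  shows "R (s_entry n \<Omega> i j) x = yuk i x * s (i + 1) j x - of_nat j * s 2 1 x * s i j x
    - (if j \<ge> 2 then s 2 2 x * s i (j - 1) x else 0)"
proof -
  have "s i (n + 1) x = 0" using in_X(2)[OF x, of i "n + 1"] i by auto
  then show ?thesis using R_base(3)[OF x, of i j] i j by simp
qed

text \<open>The derivative of the zero entry (i, i + 1) of S is zero; this expresses the Yukawa
  entries through diagonal entries and thereby makes them modular.\<close>

lemma yuk_relation:
  assumes x: "x \<in> X" and i: "2 \<le> i" "i + 1 \<le> n"
  shows "yuk i x = s 2 2 x * s i i x * (1 / s (i + 1) (i + 1) x)"
proof -
  have ij: "i \<in> {1..n}" "i \<in> {1..n+1}" "i + 1 \<in> {1..n+1}" using i by auto
  have "s i (i + 1) x = 0" using in_X(2)[OF x ij(2,3)] by simp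
  then have "yuk i x * s (i + 1) (i + 1) x = s 2 2 x * s i i x"
    using R_entry[OF x ij(1,3)] derivation_upper_entry[OF R ij(2,3)] i by simp
  then show ?thesis using s_diag_nonzero[OF x ij(3)] by (simp add: field_simps)
qed

lemma H_yuk:
  assumes "2 \<le> i" "i + 1 \<le> n"
  shows "H (entry_weight n 2 2 + entry_weight n i i - entry_weight n (i + 1) (i + 1)) (yuk i)"
proof -
  have "H (entry_weight n 2 2 + entry_weight n i i + - entry_weight n (i + 1) (i + 1))
      (\<lambda>x. s 2 2 x * s i i x * (1 / s (i + 1) (i + 1) x))"
    by (intro hom_on_mult H_diag H_inverse_diag) (use assms in auto)
  then show ?thesis by (rule hom_onI) (use yuk_relation[OF _ assms] in simp_all)
qed

text \<open>R t_1 = s_22 - t_1 t_2, so this says that R raises the weight of t_1 by 2.\<close>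

lemma corner_weight: "entry_weight n 2 2 = weight_unit n + 2"
  using n_pos by (auto simp: entry_weight_def row_weight_def weight_unit_def)

lemma H_corner:
  "H (weight_unit n * int j + weight_unit n + 2) (\<lambda>x. corner j x * s (n + 1) (n + 1) x)"
proof -
  have "H (weight_unit n * int j + entry_weight n 2 2 + - (weight_unit n * int (n + 2)) + entry_weight n (n + 1) (n + 1))
      (\<lambda>x. of_nat (Stirling (n + 2) j) * (pt_a x ^ j * s 2 2 x * (1 / disc x) * s (n + 1) (n + 1) x))"
  proof (intro hom_on_scale hom_on_mult H_diag H_inverse_disc)
    show "H (weight_unit n * int j) (\<lambda>x. pt_a x ^ j)" by (rule hom_on_power'[OF H_a]) simp
  qed (use n_pos in auto)
  then show ?thesis
  proof (rule hom_onI)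
    have "row_weight n (n + 1) = weight_unit n"
      using n_pos by (auto simp: row_weight_def weight_unit_def)
    then show "weight_unit n * int j + entry_weight n 2 2 + - (weight_unit n * int (n + 2)) + entry_weight n (n + 1) (n + 1)
        = weight_unit n * int j + weight_unit n + 2"
      unfolding corner_weight by (simp add: entry_weight_def algebra_simps)
  qed (simp add: corner_def)
qed

lemma sig_eq_s:
  assumes "n \<ge> 3" "x \<in> X" "3 \<le> i" "i \<le> n"
  shows "sig i k x = s i k x"
  using assms by (simp add: sig_def)

lemma sig_last:
  assumes "n \<ge> 3"
  shows "sig (n + 1) k x = s (n + 1) k x + s 2 1 x * s n k x"
  using assms by (simp add: sig_def)

lemma H_s:
  assumes "n \<ge> 3" "3 \<le> i" "i \<le> n" "k \<in> {1..n+1}"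
  shows "H (entry_weight n i k) (s i k)"
proof -
  have "\<not> exceptional i k" using assms by (auto simp: exceptional_def)
  then have "H (entry_weight n i k) (sig i k)" using assms by (intro H_sig) auto
  then show ?thesis by (rule hom_onI) (use sig_eq_s assms in auto)
qed

text \<open>For n = 1 row 2 is the last one and \<open>corner\<close> gives the modular part; for n
  \<ge> 3 that part is Y_1 s_31. For n = 2 one has R t_2 = -s_31 - t_2^2, and s_31 differs from the
  entry of exp(-t_2 g) S by -t_2^2/2, which leaves the coefficient 1/2.\<close>

lemma R_t2: "\<exists>p. H 4 p \<and> (\<forall>x\<in>X. R (coord n \<Omega> 2) x = p x - kap * (s 2 1 x)\<^sup>2)"
proof -
  have R2: "R (coord n \<Omega> 2) = R (s_entry n \<Omega> 2 1)" by (simp only: coord_2 s_entry_eq)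
  consider "n = 1" | "n = 2" | "n \<ge> 3" using n_pos by linarith
  then show ?thesis
  proof cases
    case 1
    have "R (coord n \<Omega> 2) x = corner 1 x * s (n + 1) (n + 1) x - kap * (s 2 1 x)\<^sup>2" if "x \<in> X" for x
    proof -
      have k: "kap = 1" unfolding kap_def using 1 by simp
      have e: "s 2 (n + 1) x = s (n + 1) (n + 1) x" "\<not> 2 \<le> n" "2 \<in> {1..n+1}" "1 \<in> {1..n+1}"
        using 1 by (auto simp: numeral_2_eq_2)
      show ?thesis unfolding R2 R_base(3)[OF that e(3,4)] e(1) k using e(2)
        by (simp add: power2_eq_square)
    qed
    moreover have "H 4 (\<lambda>x. corner 1 x * s (n + 1) (n + 1) x)"
      by (rule hom_onI[OF H_corner]) (use 1 in \<open>simp_all add: weight_unit_def\<close>)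
    ultimately show ?thesis by blast
  next
    case 2
    have "R (coord n \<Omega> 2) x = - sig 3 1 x - kap * (s 2 1 x)\<^sup>2" if x: "x \<in> X" for x
    proof -
      have k: "kap = 1 / 2" unfolding kap_def using 2 by simp
      have y: "yuk 2 x = - 1" unfolding yuk_def using 2 by simp
      have i: "2 \<in> {1..n}" "1 \<in> {1..n+1}" using 2 by auto
      have "sig 3 1 x = s 3 1 x + (s 2 1 x)\<^sup>2 / 2"
        unfolding sig_def using 2 in_X(3)[OF x] by (simp add: power2_eq_square field_simps)
      then show ?thesis unfolding R2 R_entry[OF x i] y k by (simp add: power2_eq_square)
    qed
    moreover have "H 4 (\<lambda>x. - sig 3 1 x)"
    proof (rule hom_on_uminus)
      have "H (entry_weight n 3 1) (sig 3 1)"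
      proof (rule H_sig)
        show "\<not> exceptional 3 1" unfolding exceptional_def using 2 by simp
      qed (use 2 in auto)
      then show "H 4 (sig 3 1)"
        by (rule hom_onI) (use 2 in \<open>simp_all add: entry_weight_def row_weight_def weight_unit_def\<close>)
    qed
    ultimately show ?thesis by blast
  next
    case 3
    have "R (coord n \<Omega> 2) x = yuk 2 x * s 3 1 x - kap * (s 2 1 x)\<^sup>2" if "x \<in> X" for x
      using R_entry[OF that, of 2 1] 3 unfolding R2 by (simp add: kap_def power2_eq_square)
    moreover have "H 4 (\<lambda>x. yuk 2 x * s 3 1 x)"
    proof (rule hom_on_mult'[OF H_yuk H_s])
      show "4 = entry_weight n 2 2 + entry_weight n 2 2 - entry_weight n (2 + 1) (2 + 1) + entry_weight n 3 1"
        using 3 by (simp add: entry_weight_def row_weight_simps)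
    qed (use 3 in auto)
    ultimately show ?thesis by blast
  qed
qed

text \<open>q is the coefficient of t_2 in R t_j. The value -(w_j/h) t_j is demanded where R itself
  is the field, and for n = 2, where the commutator of Option 2 enters with factor 2. For other n in
  Option 2 the commutator removes q whatever it is.\<close>

definition affine :: "nat \<Rightarrow> (point \<Rightarrow> complex) \<Rightarrow> (point \<Rightarrow> complex) \<Rightarrow> bool" where
  "affine j p q \<longleftrightarrow> H (chart_weight n j + 2) p \<and> H (chart_weight n j) q \<and>
     (\<forall>x\<in>X. R (chart_coord opt n \<Omega> j) x = p x + q x * s 2 1 x) \<and>
     (opt = Option1 \<or> n = 2 \<longrightarrow>
       (\<forall>x\<in>X. q x = - kap * of_int (chart_weight n j) * chart_coord opt n \<Omega> j x))"

lemma affine_1: "affine 1 (s 2 2) (\<lambda>x. - pt_a x)"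
proof -
  have c: "chart_coord opt n \<Omega> 1 = coord n \<Omega> 1" using not_shifted by (simp only: chart_coord_eq if_False)
  have "2 \<in> {1..n+1}" using n_pos by auto
  from H_diag[OF this] have "H (weight_unit n + 2) (s 2 2)" by (simp only: corner_weight)
  moreover have "- pt_a x = - kap * of_int (weight_unit n) * coord n \<Omega> 1 x" if "x \<in> X" for x
    using kap_weight_unit by (simp add: coord_1[simplified] restr_in[OF that])
  ultimately show ?thesis
    unfolding affine_def chart_weight_1 c using hom_on_uminus[OF H_a] R_base(2) by simp
qed

lemma affine_last: "affine (n + 2) (\<lambda>x. 0) (\<lambda>x. - of_nat (n + 2) * pt_b x)"
proof -
  have c: "chart_coord opt n \<Omega> (n + 2) = coord n \<Omega> (n + 2)" using not_shifted by (simp only: chart_coord_eq if_False)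
  have "- of_nat (n + 2) * pt_b x = - kap * of_int (weight_unit n * int (n + 2)) * coord n \<Omega> (n + 2) x"
    if "x \<in> X" for x
  proof -
    have "kap * of_int (weight_unit n * int (n + 2)) = of_nat (n + 2)"
      unfolding of_int_mult mult.assoc[symmetric] kap_weight_unit by simp
    then show ?thesis unfolding coord_last restr_in[OF that] by (metis mult_minus_left)
  qed
  moreover have "R (coord n \<Omega> (n + 2)) x = 0 + - of_nat (n + 2) * pt_b x * s 2 1 x" if "x \<in> X" for x
    unfolding R_base(1)[OF that] by (simp only: add_0_left mult_ac)
  ultimately show ?thesis
    unfolding affine_def chart_weight_last c using hom_on_zero hom_on_scale[OF H_b] by blast
qed

lemma kap_3: "n \<ge> 3 \<Longrightarrow> kap = 1" by (simp add: kap_def)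

lemma affineI:
  assumes n: "n \<ge> 3" and j: "j \<in> inner_indices n - {2}" and ns: "\<not> shifted j"
    and p: "H (entry_weight n (row j) (col j) + 2) p" and q: "H (entry_weight n (row j) (col j)) q"
    and R: "\<And>x. x \<in> X \<Longrightarrow> R (s_entry n \<Omega> (row j) (col j)) x = p x + q x * s 2 1 x"
    and qe: "opt = Option1 \<Longrightarrow> (\<And>x. x \<in> X \<Longrightarrow> q x = - of_int (entry_weight n (row j) (col j)) * s (row j) (col j) x)"
  shows "affine j p q"
proof -
  have j': "j \<in> inner_indices n" using j by simp
  have c: "chart_coord opt n \<Omega> j = s_entry n \<Omega> (row j) (col j)"
    using ns by (simp only: chart_coord_eq if_False coord_inner[OF j'] s_entry_eq)
  have "q x = - kap * of_int (entry_weight n (row j) (col j)) * s_entry n \<Omega> (row j) (col j) x"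
    if "x \<in> X" "opt = Option1" for x
    using qe[OF that(2,1)] unfolding s_entry_eq restr_in[OF that(1)] kap_3[OF n] by simp
  then show ?thesis unfolding affine_def chart_weight_inner[OF j'] c using p q R n by auto
qed

lemma affine_inner:
  assumes j: "j \<in> inner_indices n - {2}"
  shows "\<exists>p q. affine j p q"
proof -
  have n: "n \<ge> 3" using j inner_indices_eq[OF n_pos] by (auto split: if_splits)
  have j': "j \<in> inner_indices n" using j by simp
  define i where "i = row j"
  define k where "k = col j"
  note pos = position[OF j', folded i_def k_def]
  have k: "k \<in> {1..n+1}" using pos by auto
  have two: "row j = 2 \<Longrightarrow> col j = 1 \<Longrightarrow> False" using position_2[OF j'] j by auto
  note w = row_weight_simps[OF n]
  have last: "i = n + 1 \<longleftrightarrow> odd n \<and> j = moduli_dim n"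
  proof
    assume i: "i = n + 1"
    then have kk: "k = 1" "odd n" using pos half_dim_cases[of n] by (auto split: if_splits)
    then show "odd n \<and> j = moduli_dim n"
      using i chart_pos_eqD[OF j', of "moduli_dim n"] last_in_inner[OF n] chart_pos_last(1)[OF kk(2) n]
      by (simp add: i_def k_def)
  next
    assume "odd n \<and> j = moduli_dim n"
    then show "i = n + 1" using chart_pos_last(1)[of n] n by (simp add: i_def)
  qed
  have prev: "H (entry_weight n i k + 2) (\<lambda>x. if k \<ge> 2 then s 2 2 x * s i (k - 1) x else 0)"
    if i3: "3 \<le> i" "i \<le> n"
  proof (cases "k \<ge> 2")
    case True
    have "H (entry_weight n i k + 2) (\<lambda>x. s 2 2 x * s i (k - 1) x)"
    proof (rule hom_on_mult'[OF H_diag H_s])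
      show "entry_weight n i k + 2 = entry_weight n 2 2 + entry_weight n i (k - 1)"
        using True by (simp add: entry_weight_def w of_nat_diff)
    qed (use n i3 True k in auto)
    then show ?thesis using True by simp
  qed (simp add: hom_on_zero)
  consider "i = 2" | "3 \<le> i" "i + 1 \<le> n" | "i = n" | "i = n + 1" using pos n by linarith
  then show ?thesis
  proof cases
    case 1
    then have "k \<noteq> 1" using two by (auto simp: i_def k_def)
    then have k2: "k = 2" using pos 1 by linarith
    have ns: "\<not> shifted j" using last 1 n by (auto simp: shifted_def)
    have rc: "row j = 2" "col j = 2" using 1 k2 by (simp_all add: i_def k_def)
    \<comment> \<open>The coefficient is 3 = 2 + 1: the column index 2, and one more from the shift
      term s_22 s_21.\<close>
    have "affine j (\<lambda>x. yuk 2 x * s 3 2 x) (\<lambda>x. - 3 * s 2 2 x)"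
    proof (rule affineI[OF n j ns], unfold rc)
      show "H (entry_weight n 2 2 + 2) (\<lambda>x. yuk 2 x * s 3 2 x)"
        by (rule hom_on_mult'[OF H_yuk H_s]) (use n in \<open>auto simp: entry_weight_def w w(4)[simplified]\<close>)
      show "H (entry_weight n 2 2) (\<lambda>x. - 3 * s 2 2 x)"
        by (intro hom_on_scale H_diag) (use n in auto)
      fix x assume x: "x \<in> X"
      show "R (s_entry n \<Omega> 2 2) x = yuk 2 x * s 3 2 x + - 3 * s 2 2 x * s 2 1 x"
        using R_entry[OF x, of 2 2] n by (simp add: algebra_simps numeral_3_eq_3)
      show "- 3 * s 2 2 x = - of_int (entry_weight n 2 2) * s 2 2 x"
        by (simp add: entry_weight_def w w(4)[simplified])
    qed
    then show ?thesis by blast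
  next
    case 2
    have ns: "\<not> shifted j" using last 2 n by (auto simp: shifted_def)
    have rw: "row_weight n i = 0" using 2 by (simp add: row_weight_def)
    have "affine j (\<lambda>x. yuk i x * s (i + 1) k x - (if k \<ge> 2 then s 2 2 x * s i (k - 1) x else 0))
        (\<lambda>x. - of_nat k * s i k x)"
    proof (rule affineI[OF n j ns, folded i_def k_def])
      show "H (entry_weight n i k + 2) (\<lambda>x. yuk i x * s (i + 1) k x - (if k \<ge> 2 then s 2 2 x * s i (k - 1) x else 0))"
      proof (rule hom_on_diff[OF hom_on_mult'[OF H_yuk H_s] prev])
        show "entry_weight n i k + 2
          = entry_weight n 2 2 + entry_weight n i i - entry_weight n (i + 1) (i + 1) + entry_weight n (i + 1) k"
          by (simp add: entry_weight_def w algebra_simps)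
      qed (use n 2 k in auto)
      show "H (entry_weight n i k) (\<lambda>x. - of_nat k * s i k x)"
        by (intro hom_on_scale H_s n) (use 2 k in auto)
      fix x assume x: "x \<in> X"
      have "i \<in> {1..n}" using 2 by auto
      from R_entry[OF x this k]
      show "R (s_entry n \<Omega> i k) x = yuk i x * s (i + 1) k x - (if k \<ge> 2 then s 2 2 x * s i (k - 1) x else 0)
          + - of_nat k * s i k x * s 2 1 x"
        by (simp add: algebra_simps)
      show "- of_nat k * s i k x = - of_int (entry_weight n i k) * s i k x"
        by (simp add: entry_weight_def w rw)
    qed
    then show ?thesis by blast
  next
    case 3
    have ns: "\<not> shifted j" using last 3 n by (auto simp: shifted_def)
    have nn: "n \<in> {1..n}" using n by auto
    have y: "yuk n x = - 1" for x using n by (simp add: yuk_def)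
    show ?thesis
    proof (cases "exceptional (n + 1) k")
      case True
      have opt: "opt \<noteq> Option1" and k1: "k = 1" using True by (auto simp: exceptional_def)
      \<comment> \<open>Since s_{n+1,1} is a coordinate here, R s_{n,1} retains the term -s_{n,1}
        t_2 although s_{n,1} has weight 0.\<close>
      have "affine j (\<lambda>x. - s (n + 1) 1 x) (\<lambda>x. - s n 1 x)"
      proof (rule affineI[OF n j ns, folded i_def k_def], unfold 3 k1)
        show "H (entry_weight n n 1 + 2) (\<lambda>x. - s (n + 1) 1 x)"
          using hom_on_uminus[OF H_exceptional[OF True]] by (rule hom_onI) (simp_all add: k1 entry_weight_def w w(4)[simplified])
        show "H (entry_weight n n 1) (\<lambda>x. - s n 1 x)"
          by (intro hom_on_uminus H_s n) (use n in auto)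
        fix x assume x: "x \<in> X"
        show "R (s_entry n \<Omega> n 1) x = - s (n + 1) 1 x + - s n 1 x * s 2 1 x"
          using R_entry[OF x nn, of 1] by (simp add: y)
      qed (use opt in auto)
      then show ?thesis by blast
    next
      case False
      \<comment> \<open>Writing s_{n+1,k} as the entry of exp(-t_2 g) S minus t_2 s_{n,k} lowers the
        coefficient from k to k - 1, the weight of s_{n,k}.\<close>
      have "affine j (\<lambda>x. - sig (n + 1) k x - (if k \<ge> 2 then s 2 2 x * s n (k - 1) x else 0))
          (\<lambda>x. - (of_nat k - 1) * s n k x)"
      proof (rule affineI[OF n j ns, folded i_def k_def], unfold 3)
        have "H (entry_weight n n k + 2) (\<lambda>x. - sig (n + 1) k x)"
        proof (rule hom_onI[OF hom_on_uminus[OF H_sig[OF _ k False]]])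
          show "entry_weight n (n + 1) k = entry_weight n n k + 2" by (simp add: entry_weight_def w w(4)[simplified])
        qed (use n in auto)
        then show "H (entry_weight n n k + 2)
            (\<lambda>x. - sig (n + 1) k x - (if k \<ge> 2 then s 2 2 x * s n (k - 1) x else 0))"
          using prev n unfolding 3 by (intro hom_on_diff) auto
        show "H (entry_weight n n k) (\<lambda>x. - (of_nat k - 1) * s n k x)"
          by (intro hom_on_scale H_s n) (use n k in auto)
        fix x assume x: "x \<in> X"
        show "R (s_entry n \<Omega> n k) x = - sig (n + 1) k x - (if k \<ge> 2 then s 2 2 x * s n (k - 1) x else 0)
            + - (of_nat k - 1) * s n k x * s 2 1 x"
          using R_entry[OF x nn k] unfolding sig_last[OF n] y by (simp add: algebra_simps)
        show "- (of_nat k - 1) * s n k x = - of_int (entry_weight n n k) * s n k x"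
          by (simp add: entry_weight_def w w(4)[simplified])
      qed
      then show ?thesis by blast
    qed
  next
    case 4
    then have odd: "odd n" and d: "j = moduli_dim n" using last by auto
    have k1: "k = 1" using 4 pos by auto
    have rc: "row j = n + 1" "col j = 1" using 4 k1 by (simp_all add: i_def k_def)
    let ?C = "\<lambda>x. corner 1 x * s (n + 1) (n + 1) x"
    have C: "H 4 ?C" using H_corner[of 1] by (simp add: w)
    have RS: "R (s_entry n \<Omega> (n + 1) 1) x = ?C x - s 2 1 x * s (n + 1) 1 x" if "x \<in> X" for x
      using R_base(3)[OF that, of "n + 1" 1] by simp
    show ?thesis
    proof (cases "opt = Option1")
      case False
      then have "opt = Option2" by (cases opt) simp_all
      then have e: "exceptional (n + 1) 1" unfolding exceptional_def using n odd by simp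
      have ns: "\<not> shifted j" using False by (simp add: shifted_def)
      \<comment> \<open>The coefficient is 1 while the weight is 2, the second coordinate on which R
        alone fails.\<close>
      have "affine j ?C (\<lambda>x. - s (n + 1) 1 x)"
      proof (rule affineI[OF n j ns], unfold rc)
        show "H (entry_weight n (n + 1) 1 + 2) ?C" using C by (simp add: entry_weight_def w w(4)[simplified])
        show "H (entry_weight n (n + 1) 1) (\<lambda>x. - s (n + 1) 1 x)"
          by (rule hom_on_uminus[OF H_exceptional[OF e]])
        show "R (s_entry n \<Omega> (n + 1) 1) x = ?C x + - s (n + 1) 1 x * s 2 1 x" if "x \<in> X" for x
          using RS[OF that] by simp
      qed (use False in auto)
      then show ?thesis by blast
    next
      case True
      have sh: "shifted j" unfolding shifted_def using True n odd d by blast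
      have ne: "\<not> exceptional (n + 1) 1" unfolding exceptional_def using True by auto
      let ?p = "\<lambda>x. ?C x + yuk 2 x * s 3 1 x * s n 1 x"
      have cc: "chart_coord opt n \<Omega> j = restr X (sig (n + 1) 1)"
        using chart_coord_sig[OF j] ne by (simp add: rc)
      have wj: "chart_weight n j = 2" unfolding chart_weight_inner[OF j'] rc by (simp add: entry_weight_def w w(4)[simplified])
      have "H 4 (\<lambda>x. yuk 2 x * s 3 1 x * s n 1 x)"
      proof (rule hom_on_mult'[OF hom_on_mult[OF H_yuk H_s] H_s])
        show "4 = entry_weight n 2 2 + entry_weight n 2 2 - entry_weight n (2 + 1) (2 + 1)
            + entry_weight n 3 1 + entry_weight n n 1"
          by (simp add: entry_weight_def w w(4)[simplified])
      qed (use n in auto)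
      then have p: "H 4 ?p" by (intro hom_on_add C)
      have q: "H 2 (\<lambda>x. - 2 * sig (n + 1) 1 x)"
      proof (rule hom_on_scale)
        have "H (entry_weight n (n + 1) 1) (sig (n + 1) 1)" by (rule H_sig[OF _ _ ne]) auto
        then show "H 2 (sig (n + 1) 1)"
          by (rule hom_onI) (simp_all add: entry_weight_def w w(4)[simplified])
      qed
      \<comment> \<open>Up to modular terms R(t_2 s_{n,1}) is -t_2 s_{n+1,1} - 2 t_2^2 s_{n,1}.
        Together with -t_2 s_{n+1,1} from R s_{n+1,1} it becomes -2 t_2 times the new
        coordinate.\<close>
      have "R (chart_coord opt n \<Omega> j) x = ?p x + - 2 * sig (n + 1) 1 x * s 2 1 x" if x: "x \<in> X" for x
      proof -
        have reg: "restr X (s (n + 1) 1) \<in> A" "restr X (s 2 1) \<in> A" "restr X (s n 1) \<in> A"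
        proof -
          have *: "restr X (s (row l) (col l)) \<in> A" if "l \<in> inner_indices n" for l
            using regular_coord[of l] coord_inner[OF that] that by (auto simp: inner_indices_def)
          show "restr X (s (n + 1) 1) \<in> A" using *[OF j'] rc by simp
          show "restr X (s 2 1) \<in> A" using *[OF two_in_inner[OF n_pos]] chart_pos_2[OF n_pos] by simp
          show "restr X (s n 1) \<in> A" using * chart_pos_last(2,3)[OF odd n] by (metis DiffD1 fst_conv snd_conv)
        qed
        have reg': "restr X (\<lambda>x. s 2 1 x * s n 1 x) \<in> A"
          unfolding restr_arith(2) by (rule regular_mult[OF reg(2,3)])
        have "R (chart_coord opt n \<Omega> j) x = R (restr X (s (n + 1) 1)) x
            + (R (restr X (s 2 1)) x * s n 1 x + s 2 1 x * R (restr X (s n 1)) x)"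
          using sh unfolding chart_coord_eq derivation_restr_mult[OF R reg(2,3) x, symmetric]
            derivation_restr_add[OF R reg(1) reg', symmetric] by simp
        also have "R (restr X (s (n + 1) 1)) x = ?C x - s 2 1 x * s (n + 1) 1 x"
          using RS[OF x] by (simp add: s_entry_eq)
        also have "R (restr X (s 2 1)) x = yuk 2 x * s 3 1 x - s 2 1 x * s 2 1 x"
          using R_entry[OF x, of 2 1] n by (simp add: s_entry_eq)
        also have "R (restr X (s n 1)) x = - s (n + 1) 1 x - s 2 1 x * s n 1 x"
          using R_entry[OF x, of n 1] n by (simp add: s_entry_eq yuk_def)
        finally show ?thesis unfolding sig_last[OF n] by (simp add: algebra_simps)
      qed
      moreover have "- 2 * sig (n + 1) 1 x = - kap * of_int (chart_weight n j) * chart_coord opt n \<Omega> j x"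
        if "x \<in> X" for x
        unfolding wj cc restr_in[OF that] kap_3[OF n] by simp
      ultimately have "affine j ?p (\<lambda>x. - 2 * sig (n + 1) 1 x)"
        unfolding affine_def wj using p q by simp
      then show ?thesis by blast
    qed
  qed
qed

lemma affine_chart:
  assumes "j \<in> chart_indices n - {2}"
  shows "\<exists>p q. affine j p q"
proof -
  have "j = 1 \<or> j = n + 2 \<or> j \<in> inner_indices n - {2}"
    using assms chart_indices_eq[OF n_pos] by blast
  then show ?thesis using affine_1 affine_last affine_inner by metis
qed

end


section \<open>The canonical Rankin-Cohen structure\<close>

lemma derivation_on_commutator:
  assumes A: "subalgebra A" and F: "derivation_on A F" and G: "derivation_on A G"
  shows "derivation_on A (\<lambda>f x. F (G f) x - G (F f) x)"
  unfolding derivation_on_def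
proof (intro conjI ballI allI)
  note F = derivation_onD[OF F] and G = derivation_onD[OF G] and A = subalgebraD[OF A]
  have diff: "(\<lambda>x. f x - g x) \<in> A" if "f \<in> A" "g \<in> A" for f g
    using A(1)[OF that(1) A(3)[OF that(2), of "- 1"]] by simp
  fix f assume f: "f \<in> A"
  show "(\<lambda>x. F (G f) x - G (F f) x) \<in> A"
    by (intro diff F(1) G(1) f)
  show "(\<lambda>x. F (G (\<lambda>x. a * f x)) x - G (F (\<lambda>x. a * f x)) x) = (\<lambda>x. a * (F (G f) x - G (F f) x))" for a
    unfolding F(3)[OF f] G(3)[OF f] F(3)[OF G(1)[OF f]] G(3)[OF F(1)[OF f]] by (simp add: algebra_simps)
  fix g assume g: "g \<in> A"
  show "(\<lambda>x. F (G (f + g)) x - G (F (f + g)) x)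
      = (\<lambda>x. F (G f) x - G (F f) x) + (\<lambda>x. F (G g) x - G (F g) x)"
    unfolding plus_fun_def F(2)[OF f g] G(2)[OF f g] F(2)[OF G(1)[OF f] G(1)[OF g]]
      G(2)[OF F(1)[OF f] F(1)[OF g]] by (simp add: algebra_simps)
  have 1: "F (\<lambda>x. G f x * g x + f x * G g x)
      = (\<lambda>x. (F (G f) x * g x + G f x * F g x) + (F f x * G g x + f x * F (G g) x))"
    unfolding F(2)[OF A(2)[OF G(1)[OF f] g] A(2)[OF f G(1)[OF g]]] F(4)[OF G(1)[OF f] g] F(4)[OF f G(1)[OF g]] ..
  have 2: "G (\<lambda>x. F f x * g x + f x * F g x)
      = (\<lambda>x. (G (F f) x * g x + F f x * G g x) + (G f x * F g x + f x * G (F g) x))"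
    unfolding G(2)[OF A(2)[OF F(1)[OF f] g] A(2)[OF f F(1)[OF g]]] G(4)[OF F(1)[OF f] g] G(4)[OF f F(1)[OF g]] ..
  show "(\<lambda>x. F (G (f * g)) x - G (F (f * g)) x)
      = (\<lambda>x. F (G f) x - G (F f) x) * g + f * (\<lambda>x. F (G g) x - G (F g) x)"
    unfolding plus_fun_def times_fun_def F(4)[OF f g] G(4)[OF f g] 1 2 by (simp add: algebra_simps)
qed

lemma derivation_on_mult:
  assumes A: "subalgebra A" and F: "derivation_on A F" and t: "t \<in> A"
  shows "derivation_on A (\<lambda>f x. t x * F f x)"
  unfolding derivation_on_def
proof (intro conjI ballI allI)
  note F = derivation_onD[OF F]
  fix f assume f: "f \<in> A"
  show "(\<lambda>x. t x * F f x) \<in> A" by (intro subalgebraD(2)[OF A] t F(1) f)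
  show "(\<lambda>x. t x * F (\<lambda>x. a * f x) x) = (\<lambda>x. a * (t x * F f x))" for a
    unfolding F(3)[OF f] by (simp add: algebra_simps)
  fix g assume g: "g \<in> A"
  show "(\<lambda>x. t x * F (f + g) x) = (\<lambda>x. t x * F f x) + (\<lambda>x. t x * F g x)"
    unfolding plus_fun_def F(2)[OF f g] by (simp add: algebra_simps)
  show "(\<lambda>x. t x * F (f * g) x) = (\<lambda>x. t x * F f x) * g + f * (\<lambda>x. t x * F g x)"
    unfolding plus_fun_def times_fun_def F(4)[OF f g] by (simp add: algebra_simps)
qed

lemma derivation_on_cong:
  assumes "subalgebra A" "derivation_on A F" "\<And>f. f \<in> A \<Longrightarrow> D f = F f"
  shows "derivation_on A D"
  using assms(2) unfolding derivation_on_def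
  by (simp add: assms(3) subalgebraD[OF assms(1)] plus_fun_def times_fun_def)

text \<open>What both options achieve. One constant \<open>kap\<close> governs both relations; this
  is what frees \<Lambda> of t_2.\<close>

locale ramanujan_field = dwork +
  fixes D :: vfield
  assumes D: "derivation_on A D"
    and D_chart: "j \<in> chart_indices n - {2} \<Longrightarrow> \<exists>p. H (chart_weight n j + 2) p \<and>
      (\<forall>x\<in>X. D (chart_coord opt n \<Omega> j) x
        + kap * of_int (chart_weight n j) * s 2 1 x * chart_coord opt n \<Omega> j x = p x)"
    and D_t2: "\<exists>p. H 4 p \<and> (\<forall>x\<in>X. D (coord n \<Omega> 2) x = p x - kap * (s 2 1 x)\<^sup>2)"
begin

lemma H_D:
  assumes "H r f"
  shows "H (r + 2) (\<lambda>x. D (restr X f) x + kap * of_int r * s 2 1 x * f x)"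
proof -
  interpret dwork_derivation n c \<Omega> opt D "\<lambda>r. H (r + 2)" kap
  proof
    show "H (r' + 2) g" if "H (r + 2) f" "\<And>x. x \<in> X \<Longrightarrow> f x = g x" "r = r'" for r f g r'
      using that(1) by (rule hom_onI) (use that in auto)
    show "H (r + r' + 2) (\<lambda>x. f x * g x)" if "H r f" "H (r' + 2) g" for r f r' g
      by (rule hom_on_mult'[OF that]) simp
    show "H (chart_weight n j + 2) (\<lambda>x. D (chart_coord opt n \<Omega> j) x
        + kap * of_int (chart_weight n j) * s 2 1 x * chart_coord opt n \<Omega> j x)"
      if j: "j \<in> chart_indices n - {2}" for j
    proof -
      obtain p where p: "H (chart_weight n j + 2) p" "\<forall>x\<in>X. D (chart_coord opt n \<Omega> j) x
          + kap * of_int (chart_weight n j) * s 2 1 x * chart_coord opt n \<Omega> j x = p x"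
        using D_chart[OF j] by blast
      show ?thesis using p(1) by (rule hom_onI) (use p(2) in auto)
    qed
  qed (rule D hom_on_add hom_on_zero; assumption)+
  show ?thesis by (rule Q_H[OF assms])
qed

definition \<phi> :: "point \<Rightarrow> complex" where
  "\<phi> = (\<lambda>x. - kap * coord n \<Omega> 2 x)"

text \<open>With the Euler operator in place of the factor r this is one map on all functions, not
  one for each weight.\<close>

definition d :: vfield where
  "d f = (\<lambda>x. D f x - \<phi> x * euler f x)"

definition L :: "point \<Rightarrow> complex" where
  "L = (\<lambda>x. D \<phi> x - (\<phi> x)\<^sup>2)"

lemma t2_regular: "coord n \<Omega> 2 \<in> A"
  using two_in_inner[OF n_pos] by (intro regular_coord) (simp add: inner_indices_def)

lemma \<phi>_regular: "\<phi> \<in> A"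
  unfolding \<phi>_def by (rule regular_scale[OF t2_regular])

lemma M_regular: "f \<in> M r \<Longrightarrow> f \<in> A"
  using homogeneous_regular[OF homogeneous_mono[OF M_homogeneous W0_subset]] .

lemma d_M: "f \<in> M r \<Longrightarrow> d f = (\<lambda>x. D f x - of_nat r * \<phi> x * f x)"
  unfolding d_def euler_eq[OF has_euler_homogeneous] by (simp add: mult_ac)

lemma M_I:
  assumes "H (int r) f" "r > 0" "\<And>x. x \<notin> X \<Longrightarrow> f x = 0"
  shows "f \<in> M r"
  using assms by (simp add: positive_modular_part_eq homogeneous_W0_iff)

lemma d_mem:
  assumes f: "f \<in> M r"
  shows "d f \<in> M (r + 2)"
proof (rule M_I)
  have h: "H (int r) f" using M_homogeneous[OF f] homogeneous_W0_iff by blast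
  show "H (int (r + 2)) (d f)"
  proof (rule hom_onI[OF H_D[OF h]])
    fix x assume x: "x \<in> X"
    show "D (restr X f) x + kap * of_int (int r) * s 2 1 x * f x = d f x"
      unfolding d_M[OF f] \<phi>_def coord_2 regular_restr[OF M_regular[OF f]] restr_in[OF x] by simp
  qed simp
  show "d f x = 0" if "x \<notin> X" for x
    unfolding d_M[OF f] \<phi>_def
    using coord_outside[OF that] regular_outside[OF derivation_onD(1)[OF D M_regular[OF f]] that] by simp
qed simp

text \<open>D \<phi> contributes \<open>kap\<close>^2 t_2^2, which is the square of \<phi>; what
  remains is -\<open>kap\<close> times the modular part of D t_2.\<close>

lemma L_mem: "L \<in> M 4"
proof (rule M_I)
  obtain p where p: "H 4 p" "\<And>x. x \<in> X \<Longrightarrow> D (coord n \<Omega> 2) x = p x - kap * (s 2 1 x)\<^sup>2"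
    using D_t2 by blast
  have D\<phi>: "D \<phi> = (\<lambda>x. - kap * D (coord n \<Omega> 2) x)"
    unfolding \<phi>_def by (rule derivation_onD(3)[OF D t2_regular])
  have "H 4 (\<lambda>x. - kap * p x)" by (rule hom_on_scale[OF p(1)])
  then show "H (int 4) L"
  proof (rule hom_onI)
    fix x assume x: "x \<in> X"
    have "L x = - kap * (p x - kap * (s 2 1 x)\<^sup>2) - (- kap * s 2 1 x)\<^sup>2"
      unfolding L_def D\<phi> p(2)[OF x] unfolding \<phi>_def coord_2 restr_in[OF x] ..
    then show "- kap * p x = L x" by (simp add: power2_eq_square algebra_simps)
  qed simp
  show "L x = 0" if "x \<notin> X" for x
    using regular_outside[OF derivation_onD(1)[OF D \<phi>_regular] that] coord_outside[OF that]
    by (simp add: L_def \<phi>_def)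
qed simp

sublocale rankin_cohen M A D d \<phi> L
proof
  show "M r \<subseteq> A" for r using M_regular by blast
  show "D f = (\<lambda>x. d f x + of_nat r * \<phi> x * f x)" if "f \<in> M r" for f r
    unfolding d_M[OF that] by simp
  show "D \<phi> = (\<lambda>x. (\<phi> x)\<^sup>2 + L x)" by (simp add: L_def)
qed (fact D subalgebra_regular \<phi>_regular L_mem | rule M_add M_scale M_mult d_mem; assumption)+

lemma graded_sum_facts:
  assumes h: "\<And>r. h r \<in> M r"
  shows "(\<lambda>x. \<Sum>r\<le>(N::nat). h r x) \<in> A"
    and "has_euler (\<lambda>x. \<Sum>r\<le>N. h r x) (\<lambda>x. \<Sum>r\<le>N. of_nat r * h r x)"
    and "d (\<lambda>x. \<Sum>r\<le>N. h r x) = (\<lambda>x. \<Sum>r\<le>N. d (h r) x)"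
    and "x \<in> X \<Longrightarrow> (\<Sum>r\<le>N. h r (act 1 x)) = (\<Sum>r\<le>N. h r x)"
proof -
  have reg: "(\<lambda>x. \<Sum>r\<le>N. h r x) \<in> A" for N
    by (rule subalgebra_sum[OF subalgebra_regular M_regular[OF h]])
  have eul: "has_euler (\<lambda>x. \<Sum>r\<le>N. h r x) (\<lambda>x. \<Sum>r\<le>N. of_nat r * h r x)" for N
  proof (induction N)
    case 0
    show ?case using has_euler_homogeneous[OF h, of 0] by simp
  next
    case (Suc N)
    show ?case unfolding sum.atMost_Suc by (rule has_euler_add[OF Suc has_euler_homogeneous[OF h]])
  qed
  show "(\<lambda>x. \<Sum>r\<le>N. h r x) \<in> A" by (rule reg)
  show "has_euler (\<lambda>x. \<Sum>r\<le>N. h r x) (\<lambda>x. \<Sum>r\<le>N. of_nat r * h r x)" by (rule eul)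
  show "d (\<lambda>x. \<Sum>r\<le>N. h r x) = (\<lambda>x. \<Sum>r\<le>N. d (h r) x)"
    unfolding d_def euler_eq[OF eul] euler_eq[OF has_euler_homogeneous[OF h]]
      derivation_on_sum[OF D subalgebra_regular M_regular[OF h]]
    by (simp add: sum_subtractf sum_distrib_left)
  show "(\<Sum>r\<le>N. h r (act 1 x)) = (\<Sum>r\<le>N. h r x)" if "x \<in> X"
    by (intro sum.cong refl act_1[OF M_homogeneous[OF h] that])
qed

lemma graded_sum_element:
  assumes "f \<in> graded_sum M"
  shows "f \<in> A" and "has_euler f (euler f)" and "x \<in> X \<Longrightarrow> f (act 1 x) = f x"
    and "d f \<in> graded_sum M"
proof -
  obtain N h where h: "\<And>r. h r \<in> M r" and f: "f = (\<lambda>x. \<Sum>r\<le>N. h r x)"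
    using assms unfolding graded_sum_def by blast
  note facts = graded_sum_facts[of h, OF h]
  show "f \<in> A" unfolding f by (rule facts(1))
  show "has_euler f (euler f)" unfolding f euler_eq[OF facts(2)] by (rule facts(2))
  show "f (act 1 x) = f x" if "x \<in> X" unfolding f by (rule facts(4)[OF that])
  \<comment> \<open>d raises weights by 2, so the component of weight r of d f comes from weight r -
    2; the components of weights 0 and 1 are zero.\<close>
  define k where "k r = (if r \<ge> 2 then d (h (r - 2)) else (\<lambda>x. 0))" for r :: nat
  have "k r \<in> M r" for r
  proof (cases "r \<ge> 2")
    case True
    then have "r - 2 + 2 = r" by simp
    then show ?thesis using d_mem[OF h, of "r - 2"] True unfolding k_def by (simp only: if_True)
  next
    case False
    then show ?thesis using M_zero unfolding k_def by (simp only: if_False)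
  qed
  moreover have "d f = (\<lambda>x. \<Sum>r\<le>N + 2. k r x)"
  proof
    fix x
    have "(\<Sum>r\<le>N + 2. k r x) = (\<Sum>r\<in>{2..N + 2}. k r x)"
      by (rule sum.mono_neutral_right) (auto simp: k_def)
    also have "\<dots> = (\<Sum>r\<le>N. d (h r) x)"
      by (rule sum.reindex_bij_witness[where i = "\<lambda>r. r + 2" and j = "\<lambda>r. r - 2"]) (auto simp: k_def)
    finally show "d f x = (\<Sum>r\<le>N + 2. k r x)" unfolding f facts(3) by simp
  qed
  ultimately show "d f \<in> graded_sum M" unfolding graded_sum_def by blast
qed

lemma d_derivation: "derivation_on (graded_sum M) d"
  unfolding derivation_on_def
proof (intro conjI ballI allI)
  note D = derivation_onD[OF D]
  fix f assume f: "f \<in> graded_sum M"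
  note f = graded_sum_element[OF f]
  show "d f \<in> graded_sum M" by (rule f(4))
  show "d (\<lambda>x. a * f x) = (\<lambda>x. a * d f x)" for a
    unfolding d_def euler_eq[OF has_euler_scale[OF f(2)]] D(3)[OF f(1)] by (simp add: algebra_simps)
  fix g assume g: "g \<in> graded_sum M"
  note g = graded_sum_element[OF g]
  show "d (f + g) = d f + d g"
    unfolding d_def plus_fun_def euler_eq[OF has_euler_add[OF f(2) g(2)]] D(2)[OF f(1) g(1)]
    by (simp add: algebra_simps)
  have "has_euler (\<lambda>x. f x * g x) (\<lambda>x. euler f x * g x + f x * euler g x)"
    by (rule has_euler_mult[OF f(2) g(2)]) (rule f(3) g(3), assumption)+
  then have euler: "euler (\<lambda>x. f x * g x) = (\<lambda>x. euler f x * g x + f x * euler g x)"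
    by (rule euler_eq)
  show "d (f * g) = d f * g + f * d g"
    unfolding d_def plus_fun_def times_fun_def euler D(4)[OF f(1) g(1)]
    by (simp add: algebra_simps)
qed

lemma canonical: "canonical_rankin_cohen (positive_modular_part opt n \<Omega>) (rc_bracket D)"
  by (rule canonical_rankin_cohen[OF d_derivation])

end

section \<open>The two options\<close>

context modular_field
begin

lemma canonical_option1:
  assumes "opt = Option1"
  shows "canonical_rankin_cohen (positive_modular_part opt n \<Omega>) (rc_bracket R)"
proof -
  interpret ramanujan_field n c \<Omega> opt R
  proof
    show "\<exists>p. H (chart_weight n j + 2) p \<and> (\<forall>x\<in>X. R (chart_coord opt n \<Omega> j) x
        + kap * of_int (chart_weight n j) * s 2 1 x * chart_coord opt n \<Omega> j x = p x)"
      if j: "j \<in> chart_indices n - {2}" for j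
    proof -
      obtain p q where a: "affine j p q" using affine_chart[OF j] by blast
      then have p: "H (chart_weight n j + 2) p"
        and R: "\<And>x. x \<in> X \<Longrightarrow> R (chart_coord opt n \<Omega> j) x = p x + q x * s 2 1 x"
        and q: "\<And>x. x \<in> X \<Longrightarrow> q x = - kap * of_int (chart_weight n j) * chart_coord opt n \<Omega> j x"
        unfolding affine_def using assms by blast+
      have "R (chart_coord opt n \<Omega> j) x
          + kap * of_int (chart_weight n j) * s 2 1 x * chart_coord opt n \<Omega> j x = p x" if "x \<in> X" for x
        unfolding R[OF that] q[OF that] by simp
      then show ?thesis using p by blast
    qed
  qed (fact R R_t2)+
  show ?thesis by (rule canonical)
qed

text \<open>Let c be the factor of \<partial>/\<partial>t_2, so c = h. If R t_j = p + q t_2 with p,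
  q modular, the commutator has the value -c q on t_j, and D t_j = p + (1 - c) q t_2 - w_j t_2 t_j.
  For c = 1 the term with q disappears; for n = 2 it is (w_j/2) t_2 t_j and leaves the coefficient
  -w_j/2 = -w_j/h.\<close>

lemma canonical_option2:
  assumes opt: "opt = Option2" and P: "partial_derivative n \<Omega> 2 P" and Z: "radial_vector_field n \<Omega> Z"
    and D: "\<And>f. f \<in> A \<Longrightarrow> F f = R f + coord n \<Omega> 2 *
             (lie_bracket R (\<lambda>h. (1 + (if n = 2 then 1 else 0)) * P h) f - Z f)"
  shows "canonical_rankin_cohen (positive_modular_part opt n \<Omega>) (rc_bracket F)"
proof -
  define cc :: complex where "cc = (if n = 2 then 2 else 1)"
  have kc: "cc * kap = 1" by (simp add: cc_def kap_def)
  have PD: "derivation_on A P" and P_coord: "\<And>i. i \<in> chart_indices n \<Longrightarrow>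
      P (coord n \<Omega> i) = const_on X (if i = 2 then 1 else 0)"
    using P by (auto simp: partial_derivative_def vector_field_def)
  note Z = radial_field[OF Z]
  have ns: "chart_coord opt n \<Omega> j = coord n \<Omega> j" for j
  proof -
    have "\<not> shifted j" unfolding shifted_def using opt by simp
    then show ?thesis by (simp only: chart_coord_eq if_False)
  qed
  have T: "coord n \<Omega> 2 \<in> A" "2 \<in> chart_indices n"
    using two_in_inner[OF n_pos] regular_coord by (simp_all add: inner_indices_def)
  have scal: "(1 + (if n = 2 then 1 else 0)) * P h = (\<lambda>x. cc * P h x)" for h
    by (rule ext) (simp add: cc_def)
  have F: "F f = (\<lambda>x. 1 * R f x + 1 * (coord n \<Omega> 2 x
      * (cc * (R (P f) x - P (R f) x) + (- 1) * Z f x)))" if f: "f \<in> A" for f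
    unfolding D[OF f] lie_bracket_def scal derivation_onD(3)[OF R derivation_onD(1)[OF PD f]]
    by (rule ext) (simp add: algebra_simps)
  have FD: "derivation_on A F"
    by (rule derivation_on_cong[OF subalgebra_regular _ F])
      (intro derivation_on_linear derivation_on_mult derivation_on_commutator subalgebra_regular R PD Z T)
  \<comment> \<open>Modular functions do not depend on t_2. This holds for the chart coordinates by
    definition and passes to u and to inverses by the propagation principle.\<close>
  have PH: "P (restr X f) x = 0" if "H r f" "x \<in> X" for r f x
  proof -
    interpret PK: dwork_derivation n c \<Omega> opt P "\<lambda>r f. \<forall>x\<in>X. f x = 0" 0
    proof
      show "\<forall>x\<in>X. P (chart_coord opt n \<Omega> j) x
          + 0 * of_int (chart_weight n j) * s 2 1 x * chart_coord opt n \<Omega> j x = 0"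
        if "j \<in> chart_indices n - {2}" for j
        unfolding ns using P_coord[of j] that by (simp add: const_on_def)
    qed (use PD in auto)
    show ?thesis using PK.Q_H[OF that(1)] that(2) by simp
  qed
  have t2: "P (restr X (s 2 1)) x = 1" if "x \<in> X" for x
    using P_coord[OF T(2)] that by (simp add: coord_2 const_on_def)
  have t2A: "restr X (s 2 1) \<in> A" using T(1) by (simp add: coord_2)
  interpret ramanujan_field n c \<Omega> opt F
  proof
    show "derivation_on A F" by (rule FD)
    show "\<exists>p. H (chart_weight n j + 2) p \<and> (\<forall>x\<in>X. F (chart_coord opt n \<Omega> j) x
        + kap * of_int (chart_weight n j) * s 2 1 x * chart_coord opt n \<Omega> j x = p x)"
      if j: "j \<in> chart_indices n - {2}" for j
    proof -
      let ?g = "coord n \<Omega> j" and ?w = "of_int (chart_weight n j) :: complex"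
      have j': "j \<in> chart_indices n" "j \<noteq> 2" using j by auto
      have g: "?g \<in> A" by (rule regular_coord[OF j'(1)])
      obtain p q where a: "affine j p q" using affine_chart[OF j] by blast
      then have p: "H (chart_weight n j + 2) p" and q: "H (chart_weight n j) q"
        and Rg: "\<And>x. x \<in> X \<Longrightarrow> R ?g x = p x + q x * s 2 1 x"
        and qe: "\<And>x. n = 2 \<Longrightarrow> x \<in> X \<Longrightarrow> q x = - kap * ?w * ?g x"
        unfolding affine_def ns by blast+
      have "restr X (R ?g) = restr X (\<lambda>x. p x + q x * s 2 1 x)" by (rule restr_cong) (rule Rg)
      then have "R ?g = restr X (\<lambda>x. p x + q x * s 2 1 x)"
        using regular_restr[OF derivation_onD(1)[OF R g]] by simp
      moreover have "restr X (\<lambda>x. q x * s 2 1 x) \<in> A"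
        unfolding restr_arith(2) by (rule regular_mult[OF H_regular[OF q] t2A])
      ultimately have PR: "P (R ?g) x = q x" if x: "x \<in> X" for x
        using derivation_restr_add[OF PD H_regular[OF p], of "\<lambda>x. q x * s 2 1 x" x]
          derivation_restr_mult[OF PD H_regular[OF q] t2A x] PH[OF p x] PH[OF q x] t2[OF x] by simp
      have RP: "R (P ?g) x = 0" for x
        using P_coord[OF j'(1)] j'(2) derivation_const[OF R] by simp
      have "F ?g x + kap * ?w * s 2 1 x * ?g x = p x" if x: "x \<in> X" for x
      proof -
        have "F ?g x + kap * ?w * s 2 1 x * ?g x
            = p x + s 2 1 x * ((1 - cc) * q x + (kap - 1) * (?w * ?g x))"
          unfolding F[OF g] Rg[OF x] PR[OF x] RP Z(2)[OF j'(1) x] coord_2 restr_in[OF x]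
          by (simp add: algebra_simps)
        also have "(1 - cc) * q x + (kap - 1) * (?w * ?g x) = 0"
        proof (cases "n = 2")
          case True
          show ?thesis unfolding qe[OF True x] cc_def kap_def using True by simp
        next
          case False
          then show ?thesis by (simp add: cc_def kap_def)
        qed
        finally show ?thesis by simp
      qed
      then show ?thesis unfolding ns using p by blast
    qed
    show "\<exists>p. H 4 p \<and> (\<forall>x\<in>X. F (coord n \<Omega> 2) x = p x - kap * (s 2 1 x)\<^sup>2)"
    proof -
      obtain p where p: "H 4 p" "\<And>x. x \<in> X \<Longrightarrow> R (coord n \<Omega> 2) x = p x - kap * (s 2 1 x)\<^sup>2"
        using R_t2 by blast
      have Rt: "R (coord n \<Omega> 2) = restr X (\<lambda>x. p x + (- kap) * (s 2 1 x * s 2 1 x))"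
      proof -
        have "restr X (R (coord n \<Omega> 2)) = restr X (\<lambda>x. p x + (- kap) * (s 2 1 x * s 2 1 x))"
          by (rule restr_cong) (simp add: p(2) power2_eq_square)
        then show ?thesis using regular_restr[OF derivation_onD(1)[OF R T(1)]] by simp
      qed
      have tt: "restr X (\<lambda>x. s 2 1 x * s 2 1 x) \<in> A"
        unfolding restr_arith(2) by (rule regular_mult[OF t2A t2A])
      have ktt: "restr X (\<lambda>x. (- kap) * (s 2 1 x * s 2 1 x)) \<in> A"
        unfolding restr_arith(4) by (rule regular_scale[OF tt])
      have PR: "P (R (coord n \<Omega> 2)) x = - 2 * kap * s 2 1 x" if x: "x \<in> X" for x
      proof -
        have "P (R (coord n \<Omega> 2)) x = P (restr X p) x + P (restr X (\<lambda>x. (- kap) * (s 2 1 x * s 2 1 x))) x"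
          unfolding Rt by (rule derivation_restr_add[OF PD H_regular[OF p(1)] ktt])
        also have "P (restr X (\<lambda>x. (- kap) * (s 2 1 x * s 2 1 x))) x = - kap * P (restr X (\<lambda>x. s 2 1 x * s 2 1 x)) x"
          unfolding restr_arith(4) derivation_onD(3)[OF PD tt] ..
        also have "P (restr X (\<lambda>x. s 2 1 x * s 2 1 x)) x = 2 * s 2 1 x"
          using derivation_restr_mult[OF PD t2A t2A x] t2[OF x] by simp
        finally show ?thesis using PH[OF p(1) x] by simp
      qed
      have RP: "R (P (coord n \<Omega> 2)) x = 0" for x
        using P_coord[OF T(2)] derivation_const[OF R] by simp
      have w2: "chart_weight n 2 = 2"
        using chart_weight_inner[OF two_in_inner[OF n_pos]] chart_pos_2[OF n_pos]
        by (simp add: entry_weight_def row_weight_def weight_unit_def)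
      \<comment> \<open>The commutator gives 2 c \<open>kap\<close> t_2 = 2 t_2 and H gives 2 t_2,
        so the correction vanishes on t_2 and D t_2 = R t_2.\<close>
      have "F (coord n \<Omega> 2) x = p x - kap * (s 2 1 x)\<^sup>2" if x: "x \<in> X" for x
      proof -
        have "F (coord n \<Omega> 2) x = p x - kap * (s 2 1 x)\<^sup>2 + 2 * (cc * kap - 1) * (s 2 1 x)\<^sup>2"
          unfolding F[OF T(1)] p(2)[OF x] PR[OF x] RP Z(2)[OF T(2) x] w2
          unfolding coord_2 restr_in[OF x]
          by (simp add: power2_eq_square algebra_simps)
        then show ?thesis by (simp add: kc)
      qed
      then show ?thesis using p(1) by blast
    qed
  qed
  show ?thesis by (rule canonical)
qed

end

theorem corollary5p1:
  fixes n :: nat and c :: complex and \<Omega> :: "complex \<Rightarrow> complex \<Rightarrow> complex mat"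
    and opt :: field_option and D :: vfield
  assumes "n \<ge> 1" and "c \<noteq> 0" and "intersection_matrix n c \<Omega>"
    and "dwork_field opt n \<Omega> D"
  shows "canonical_rankin_cohen (positive_modular_part opt n \<Omega>) (rc_bracket D)"
proof -
  interpret dwork n c \<Omega> opt by unfold_locales (fact assms)+
  have modular: "\<exists>Y. modular_field n c \<Omega> R Y" if "modular_vector_field n \<Omega> R" for R
    using that dwork_axioms
    unfolding modular_vector_field_def vector_field_def modular_field_def modular_field_axioms_def by blast
  show ?thesis
  proof (cases opt)
    case Option1
    then have "modular_vector_field n \<Omega> D" using assms(4) by simp
    then obtain Y where "modular_field n c \<Omega> D Y" using modular by blast
    then interpret modular_field n c \<Omega> opt D Y .
    show ?thesis by (rule canonical_option1[OF Option1])
  next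
    case Option2
    then obtain R P Z where "modular_vector_field n \<Omega> R" and P: "partial_derivative n \<Omega> 2 P"
      and Z: "radial_vector_field n \<Omega> Z" and F: "\<forall>f\<in>regular_functions n \<Omega>. D f = R f + coord n \<Omega> 2 *
             (lie_bracket R (\<lambda>h. (1 + (if n = 2 then 1 else 0)) * P h) f - Z f)"
      using assms(4) by auto
    then obtain Y where "modular_field n c \<Omega> R Y" using modular by blast
    then interpret modular_field n c \<Omega> opt R Y .
    show ?thesis by (rule canonical_option2[OF Option2 P Z]) (use F in blast)
  qed
qed

end
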